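(* Let $S=K[x_1,\dots,x_n]$ be a polynomial ring over a field $K$, let $I\subset S$ be a monomial ideal with linear powers, and let $i\ge0$ be an integer. The following statements hold. (a) The set $\mathrm{Ass}(\mathrm{HS}_i(I^k))$ stabilizes: $\mathrm{Ass}(\mathrm{HS}_i(I^{k+1}))=\mathrm{Ass}(\mathrm{HS}_i(I^k))$ for all $k\gg0$. Denote the common sets $\mathrm{Ass}(\mathrm{HS}_i(I^k))$ for $k\gg0$ by $\mathrm{Ass}_i^\infty(I)$. (b) For all $k\gg0$, $\mathrm{depth}\,S/\mathrm{HS}_i(I^{k+1})=\mathrm{depth}\,S/\mathrm{HS}_i(I^k)$. (c) For all $k\gg0$, $\mathrm{reg}\,\mathrm{HS}_i(I^k)$ is a linear function in $k$. (d) For all $k\gg0$, $\mathrm{v}(\mathrm{HS}_i(I^k))$ is a linear function in $k$. (e) For all $k\gg0$ and all $\mathfrak p\in\mathrm{Ass}_i^\infty(I)$, $\mathrm{v}_{\mathfrak p}(\mathrm{HS}_i(I^k))$ is a linear function in $k$.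
   Context: For $\mathbf a=(a_1,\dots,a_n)\in\mathbb Z_{\ge0}^n$ write $\mathbf x^{\mathbf a}=x_1^{a_1}\cdots x_n^{a_n}$. For a monomial ideal $J\subset S$, the $i$th homological shift ideal of $J$ is the monomial ideal $$\mathrm{HS}_i(J)=(\mathbf x^{\mathbf a}\ :\ \mathrm{Tor}^S_i(K,J)_{\mathbf a}\neq 0),$$ where $\mathrm{Tor}^S_i(K,J)$ carries its natural $\mathbb Z^n$-grading and $K=S/(x_1,\dots,x_n)$. A graded ideal $J$ generated in degree $d$ has linear resolution if $\mathrm{Tor}^S_i(K,J)_j=0$ for all $i$ and all $j\ne i+d$. A monomial ideal $I$ has linear powers if $I^k$ has linear resolution for all $k\ge1$. For a graded ideal $J\subset S$: $\mathrm{Ass}(J)$ is the set of associated primes of $J$ (i.e. of $S/J$); the Castelnuovo–Mumford regularity is $\mathrm{reg}(J)=\max\{j : \mathrm{Tor}^S_i(K,J)_{i+j}\ne0 \text{ for some } i\}$; for $\mathfrak p\in\mathrm{Ass}(J)$ the $\mathrm v_{\mathfrak p}$-number is $\mathrm v_{\mathfrak p}(J)=\min\{\deg(f) : f\in S_d \text{ for some } d,\ (J:f)=\mathfrak p\}$, where $S_d$ is the degree-$d$ component of $S$; and the $\mathrm v$-number is $\mathrm v(J)=\min_{\mathfrak p\in\mathrm{Ass}(J)}\mathrm v_{\mathfrak p}(J)$. "Is a linear function in $k$ for all $k\gg0$" means that it equals $ak+b$ for some constants $a,b$ and all sufficiently large $k$ (in (e), the constants may depend on $\mathfrak p$). *)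

theory Defs
  imports Complex_Main "HOL-Library.Poly_Mapping" "HOL-Library.Extended_Nat"
    "HOL-Library.Countable"
begin

section \<open>The polynomial ring and its ideals\<close>

text \<open>
  The variables are indexed by a finite type \<open>'x\<close>, so \<open>n\<close> is the cardinality of \<open>'x\<close>.
  Exponent vectors are the elements of \<open>'x \<Rightarrow>\<^sub>0 nat\<close>, and \<open>S = K[x\<^sub>1, \<dots>, x\<^sub>n]\<close> is the monoid
  ring of \<open>'x \<Rightarrow>\<^sub>0 nat\<close> over \<open>'k\<close>, whose multiplication is the convolution product of
  \<open>HOL-Library.Poly_Mapping\<close>.
\<close>

type_synonym 'x mon = "'x \<Rightarrow>\<^sub>0 nat"
type_synonym ('x, 'k) mpol = "'x mon \<Rightarrow>\<^sub>0 'k"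

definition xpow :: "'x mon \<Rightarrow> ('x, 'k::field) mpol" where
  "xpow a = Poly_Mapping.single a 1"

definition mdeg :: "('x::finite) mon \<Rightarrow> nat" where
  "mdeg a = (\<Sum>x\<in>UNIV. Poly_Mapping.lookup a x)"

definition hcomp :: "nat \<Rightarrow> ('x::finite, 'k::field) mpol set" where
  "hcomp d = {f. \<forall>m\<in>Poly_Mapping.keys f. mdeg m = d}"

abbreviation is_ideal :: "('a::comm_ring_1) set \<Rightarrow> bool" where
  "is_ideal \<equiv> module.subspace (*)"

abbreviation ideal_gen :: "('a::comm_ring_1) set \<Rightarrow> 'a set" where
  "ideal_gen \<equiv> module.span (*)"

definition ideal_mult :: "('a::comm_ring_1) set \<Rightarrow> 'a set \<Rightarrow> 'a set" where
  "ideal_mult I J = ideal_gen {f * g | f g. f \<in> I \<and> g \<in> J}"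

primrec ideal_pow :: "('a::comm_ring_1) set \<Rightarrow> nat \<Rightarrow> 'a set" where
  "ideal_pow I 0 = UNIV"
| "ideal_pow I (Suc k) = ideal_mult I (ideal_pow I k)"

definition prime_ideal :: "('a::comm_ring_1) set \<Rightarrow> bool" where
  "prime_ideal P \<longleftrightarrow> is_ideal P \<and> P \<noteq> UNIV \<and> (\<forall>f g. f * g \<in> P \<longrightarrow> f \<in> P \<or> g \<in> P)"

definition colon :: "('a::comm_ring_1) set \<Rightarrow> 'a \<Rightarrow> 'a set" where
  "colon J f = {g. g * f \<in> J}"

definition Ass :: "('a::comm_ring_1) set \<Rightarrow> 'a set set" where
  "Ass J = {P. prime_ideal P \<and> (\<exists>f. P = colon J f)}"

definition monomial_ideal :: "('x, 'k::field) mpol set \<Rightarrow> bool" where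
  "monomial_ideal J \<longleftrightarrow> (\<exists>A. J = ideal_gen (xpow ` A))"

definition irrelevant_ideal :: "('x, 'k::field) mpol set" where
  "irrelevant_ideal = ideal_gen (range (\<lambda>x. xpow (Poly_Mapping.single x 1)))"


section \<open>Multigraded free resolutions and Tor\<close>

text \<open>
  All free modules live inside the free \<open>S\<close>-module \<open>nat \<Rightarrow>\<^sub>0 S\<close> with basis \<open>nat\<close>: a set \<open>B\<close> of
  natural numbers spans the free submodule of vectors supported in \<open>B\<close>. A complex of
  \<open>\<int>\<^sup>n\<close>-graded free modules is given by bases, the multidegrees of the basis elements, the
  differentials \<open>diff F i : F\<^bsub>i+1\<^esub> \<rightarrow> F\<^bsub>i\<^esub>\<close>, and an augmentation \<open>F\<^bsub>0\<^esub> \<rightarrow> K\<close>. The differentials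
  are total functions, but only their values on \<open>F\<^bsub>i+1\<^esub>\<close> matter. Basis elements are allowed
  to have only nonnegative multidegrees; this suffices to resolve \<open>K\<close>.
\<close>

type_synonym ('x, 'k) fvec = "nat \<Rightarrow>\<^sub>0 ('x, 'k) mpol"

record (overloaded) ('x, 'k) fcomplex =
  basis :: "nat \<Rightarrow> nat set"
  shift :: "nat \<Rightarrow> nat \<Rightarrow> 'x mon"
  diff :: "nat \<Rightarrow> ('x, 'k) fvec \<Rightarrow> ('x, 'k) fvec"
  aug :: "('x, 'k) fvec \<Rightarrow> 'k"

definition vscale :: "('x, 'k::field) mpol \<Rightarrow> ('x, 'k) fvec \<Rightarrow> ('x, 'k) fvec" where
  "vscale f v = Poly_Mapping.map ((*) f) v"

text \<open>The \<open>S\<close>-module structure of \<open>K = S/(x\<^sub>1, \<dots>, x\<^sub>n)\<close>: \<open>S\<close> acts through the constant coefficient.\<close>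

definition kscale :: "('x, 'k::field) mpol \<Rightarrow> 'k \<Rightarrow> 'k" where
  "kscale f c = Poly_Mapping.lookup f 0 * c"

definition fmod :: "('x, 'k::field, 'z) fcomplex_scheme \<Rightarrow> nat \<Rightarrow> ('x, 'k) fvec set" where
  "fmod F i = {v. Poly_Mapping.keys v \<subseteq> basis F i}"

definition mhom :: "('x, 'k::field, 'z) fcomplex_scheme \<Rightarrow> nat \<Rightarrow> 'x mon \<Rightarrow> ('x, 'k) fvec set" where
  "mhom F i a = {v. \<forall>b\<in>Poly_Mapping.keys v. \<forall>m\<in>Poly_Mapping.keys (Poly_Mapping.lookup v b).
     m + shift F i b = a}"

definition thom :: "('x::finite, 'k::field, 'z) fcomplex_scheme \<Rightarrow> nat \<Rightarrow> nat \<Rightarrow> ('x, 'k) fvec set" where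
  "thom F i j = {v. \<forall>b\<in>Poly_Mapping.keys v. \<forall>m\<in>Poly_Mapping.keys (Poly_Mapping.lookup v b).
     mdeg (m + shift F i b) = j}"

definition free_resolution_K :: "('x::finite, 'k::field, 'z) fcomplex_scheme \<Rightarrow> bool" where
  "free_resolution_K F \<longleftrightarrow>
     (\<forall>i. finite (basis F i)) \<and>
     (\<forall>i. module_hom vscale vscale (diff F i)) \<and>
     (\<forall>i. diff F i ` fmod F (Suc i) \<subseteq> fmod F i) \<and>
     (\<forall>i a. diff F i ` (fmod F (Suc i) \<inter> mhom F (Suc i) a) \<subseteq> mhom F i a) \<and>
     module_hom vscale kscale (aug F) \<and>
     (\<forall>a v. a \<noteq> 0 \<longrightarrow> v \<in> fmod F 0 \<inter> mhom F 0 a \<longrightarrow> aug F v = 0) \<and>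
     aug F ` fmod F 0 = UNIV \<and>
     {v \<in> fmod F 0. aug F v = 0} = diff F 0 ` fmod F 1 \<and>
     (\<forall>i. {v \<in> fmod F (Suc i). diff F i v = 0} = diff F (Suc i) ` fmod F (Suc (Suc i)))"

text \<open>
  \<open>Tor\<^sub>i(K, J)\<close> is the homology of \<open>F \<otimes> J\<close> for a multigraded free resolution \<open>F\<close> of \<open>K\<close>, and it
  does not depend on \<open>F\<close>; existence of \<open>F\<close> is \<open>free_resolution_K_exists\<close> at the end. Since \<open>F\<^sub>i\<close> is
  free, \<open>F\<^sub>i \<otimes> J\<close> is the submodule of \<open>F\<^sub>i\<close> of all vectors with entries in \<open>J\<close>.
\<close>

definition resK :: "('x::finite, 'k::field) fcomplex" where
  "resK = (SOME F. free_resolution_K F)"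

definition tens :: "nat \<Rightarrow> ('x::finite, 'k::field) mpol set \<Rightarrow> ('x, 'k) fvec set" where
  "tens i J = {v \<in> fmod resK i. \<forall>b. Poly_Mapping.lookup v b \<in> J}"

fun tor_cycles :: "nat \<Rightarrow> ('x::finite, 'k::field) mpol set \<Rightarrow> ('x, 'k) fvec set" where
  "tor_cycles 0 J = tens 0 J"
| "tor_cycles (Suc i) J = {v \<in> tens (Suc i) J. diff resK i v = 0}"

definition tor_boundaries :: "nat \<Rightarrow> ('x::finite, 'k::field) mpol set \<Rightarrow> ('x, 'k) fvec set" where
  "tor_boundaries i J = diff resK i ` tens (Suc i) J"

text \<open>
  Nonvanishing of the component of \<open>Tor\<^sub>i(K, J)\<close> in multidegree \<open>a\<close> (for a monomial ideal \<open>J\<close>)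
  and in total degree \<open>j\<close> (for a graded ideal \<open>J\<close>): some cycle of that degree is not a boundary.
  The components in degrees with a negative entry are zero.
\<close>

definition tor_multi_nonzero :: "nat \<Rightarrow> ('x::finite, 'k::field) mpol set \<Rightarrow> 'x mon \<Rightarrow> bool" where
  "tor_multi_nonzero i J a \<longleftrightarrow> \<not> tor_cycles i J \<inter> mhom resK i a \<subseteq> tor_boundaries i J"

definition tor_nonzero :: "nat \<Rightarrow> ('x::finite, 'k::field) mpol set \<Rightarrow> nat \<Rightarrow> bool" where
  "tor_nonzero i J j \<longleftrightarrow> \<not> tor_cycles i J \<inter> thom resK i j \<subseteq> tor_boundaries i J"

definition HS :: "nat \<Rightarrow> ('x::finite, 'k::field) mpol set \<Rightarrow> ('x, 'k) mpol set" where
  "HS i J = ideal_gen {xpow a | a. tor_multi_nonzero i J a}"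

definition linear_resolution :: "('x::finite, 'k::field) mpol set \<Rightarrow> bool" where
  "linear_resolution J \<longleftrightarrow>
     (\<exists>d. (\<exists>G \<subseteq> hcomp d. J = ideal_gen G) \<and>
          (\<forall>i j. j \<noteq> i + d \<longrightarrow> \<not> tor_nonzero i J j))"

definition linear_powers :: "('x::finite, 'k::field) mpol set \<Rightarrow> bool" where
  "linear_powers I \<longleftrightarrow> (\<forall>k\<ge>1. linear_resolution (ideal_pow I k))"


section \<open>Numerical invariants\<close>

text \<open>The zero ideal has no nonzero Tor; its regularity is set to \<open>0\<close>.\<close>

definition reg :: "('x::finite, 'k::field) mpol set \<Rightarrow> int" where
  "reg J = (if J = {0} then 0 else Max {int j - int i | i j. tor_nonzero i J j})"

text \<open>\<open>regular_seq J fs\<close>: the list \<open>fs\<close> is an \<open>S/J\<close>-regular sequence.\<close>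

definition regular_seq :: "('a::comm_ring_1) set \<Rightarrow> 'a list \<Rightarrow> bool" where
  "regular_seq J fs \<longleftrightarrow>
     ideal_gen (J \<union> set fs) \<noteq> UNIV \<and>
     (\<forall>r<length fs. \<forall>g. g * fs ! r \<in> ideal_gen (J \<union> set (take r fs)) \<longrightarrow>
        g \<in> ideal_gen (J \<union> set (take r fs)))"

text \<open>The depth of \<open>S/J\<close> with respect to \<open>(x\<^sub>1, \<dots>, x\<^sub>n)\<close>; the zero module has depth \<open>\<infinity>\<close>.\<close>

definition depth_quot :: "('x, 'k::field) mpol set \<Rightarrow> enat" where
  "depth_quot J = (if J = UNIV then \<infinity>
     else (SUP fs\<in>{fs. set fs \<subseteq> irrelevant_ideal \<and> regular_seq J fs}. enat (length fs)))"

definition vnum_at :: "('x::finite, 'k::field) mpol set \<Rightarrow> ('x, 'k) mpol set \<Rightarrow> nat" where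
  "vnum_at P J = (LEAST d. \<exists>f\<in>hcomp d. colon J f = P)"

text \<open>\<open>Ass J\<close> is empty only for \<open>J = S\<close>, whose v-number is set to \<open>0\<close>.\<close>

definition vnum :: "('x::finite, 'k::field) mpol set \<Rightarrow> nat" where
  "vnum J = (if Ass J = {} then 0 else LEAST d. \<exists>P\<in>Ass J. d = vnum_at P J)"

definition Ass_inf :: "nat \<Rightarrow> ('x::finite, 'k::field) mpol set \<Rightarrow> ('x, 'k) mpol set set" where
  "Ass_inf i I = (THE A. \<forall>\<^sub>F k in sequentially. Ass (HS i (ideal_pow I k)) = A)"


section \<open>The Koszul complex is a multigraded free resolution of \<open>K\<close>\<close>

text \<open>
  Basis elements correspond to sets of variables, encoded as natural numbers by \<open>enc\<close>;
  \<open>kel A m c\<close> is \<open>c x\<^sup>m e\<^sub>A\<close>. Exactness follows from the contracting homotopy \<open>khom\<close>, which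
  divides \<open>x\<^sup>m e\<^sub>A\<close> by the least variable occurring in \<open>m\<close> or \<open>A\<close> and adds it to \<open>A\<close> (giving
  \<open>0\<close> if it already lies in \<open>A\<close>).
\<close>

lemma lookup_vscale: "Poly_Mapping.lookup (vscale f v) b = f * Poly_Mapping.lookup v b"
  unfolding vscale_def by (simp add: Poly_Mapping.map.rep_eq when_def)

lemma module_vscale: "module (vscale :: ('x, 'k::field) mpol \<Rightarrow> _)"
  by unfold_locales
    (auto intro!: poly_mapping_eqI simp: lookup_vscale lookup_add algebra_simps)

lemma lookup_mult_0:
  "Poly_Mapping.lookup (f * g :: ('x, 'k::field) mpol) 0 = Poly_Mapping.lookup f 0 * Poly_Mapping.lookup g 0"
proof -
  have *: "(Poly_Mapping.lookup f a * (\<Sum>q. Poly_Mapping.lookup g q when 0 = a + q))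
     = (Poly_Mapping.lookup f 0 * Poly_Mapping.lookup g 0 when a = 0)" for a :: "'x mon"
  proof (cases "a = 0")
    case False
    then have "a + q \<noteq> 0" for q
      by (metis add_is_0 lookup_add lookup_zero poly_mapping_eqI)
    then show ?thesis using False by (auto simp: when_def)
  next
    case True
    then have "(0 = a + q) = (q = 0)" for q by auto
    then show ?thesis using True by simp
  qed
  show ?thesis unfolding lookup_mult * by simp
qed

lemma module_kscale: "module (kscale :: ('x, 'k::field) mpol \<Rightarrow> _)"
  by unfold_locales
    (auto simp: kscale_def lookup_mult_0 lookup_add algebra_simps)

lemma pm_expand: "p = (\<Sum>k\<in>Poly_Mapping.keys p. Poly_Mapping.single k (Poly_Mapping.lookup p k))"
  by (rule poly_mapping_eqI)
     (simp add: lookup_sum lookup_single when_def in_keys_iff)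

lemma additive_eq_on_singles:
  fixes f g :: "('x, 'k::field) fvec \<Rightarrow> 'c::ab_group_add"
  assumes "additive f" "additive g"
    and eq: "\<And>b m c. b \<in> B \<Longrightarrow> f (Poly_Mapping.single b (Poly_Mapping.single m c))
                              = g (Poly_Mapping.single b (Poly_Mapping.single m c))"
    and v: "Poly_Mapping.keys v \<subseteq> B"
  shows "f v = g v"
proof -
  interpret f: additive f by fact
  interpret g: additive g by fact
  have s: "Poly_Mapping.single b (sum h A) = (\<Sum>x\<in>A. Poly_Mapping.single b (h x))"
    for b and h :: "'x mon \<Rightarrow> ('x,'k) mpol" and A
    by (induction A rule: infinite_finite_induct) (auto simp: single_add)
  have "v = (\<Sum>b\<in>Poly_Mapping.keys v. \<Sum>m\<in>Poly_Mapping.keys (Poly_Mapping.lookup v b).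
     Poly_Mapping.single b (Poly_Mapping.single m (Poly_Mapping.lookup (Poly_Mapping.lookup v b) m)))"
    (is "_ = ?w")
    unfolding s[symmetric] pm_expand[symmetric] ..
  moreover have "f ?w = g ?w"
    unfolding f.sum g.sum using v by (intro sum.cong refl eq) auto
  ultimately show ?thesis by metis
qed

definition enc :: "('x::finite) set \<Rightarrow> nat" where "enc = to_nat"
definition dec :: "nat \<Rightarrow> ('x::finite) set" where "dec = from_nat"

lemma dec_enc [simp]: "dec (enc A) = A" by (simp add: enc_def dec_def)
lemma enc_eq [simp]: "enc A = enc B \<longleftrightarrow> A = B" by (simp add: enc_def)

definition vless :: "('x::finite) \<Rightarrow> 'x \<Rightarrow> bool" where
  "vless x y \<longleftrightarrow> to_nat x < to_nat y"

lemma vless_linear: "x \<noteq> y \<Longrightarrow> \<not> vless x y \<Longrightarrow> vless y x"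
  unfolding vless_def by (metis nat_neq_iff to_nat_split)
lemma vless_asym: "vless x y \<Longrightarrow> \<not> vless y x" unfolding vless_def by simp
lemma vless_trans: "vless x y \<Longrightarrow> vless y z \<Longrightarrow> vless x z" unfolding vless_def by simp

definition ex1 :: "'x \<Rightarrow> 'x mon" where "ex1 x = Poly_Mapping.single x 1"
definition exS :: "('x::finite) set \<Rightarrow> 'x mon" where "exS A = (\<Sum>x\<in>A. ex1 x)"

lemma exS_remove: "y \<in> A \<Longrightarrow> exS A = ex1 y + exS (A - {y})"
  unfolding exS_def by (simp add: sum.remove)

definition ksgn :: "('x::finite) set \<Rightarrow> 'x \<Rightarrow> 'k::field" where
  "ksgn A y = (- 1) ^ card {z\<in>A. vless z y}"

definition kel :: "('x::finite) set \<Rightarrow> 'x mon \<Rightarrow> 'k::field \<Rightarrow> ('x,'k) fvec" where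
  "kel A m c = Poly_Mapping.single (enc A) (Poly_Mapping.single m c)"

lemma kel_add: "kel A m (c + d) = kel A m c + kel A m d"
  by (simp add: kel_def single_add)
lemma kel_0 [simp]: "kel A m 0 = 0" by (simp add: kel_def)
lemma kel_uminus: "kel A m (- c) = - kel A m c"
  by (simp add: kel_def single_uminus)

definition kgen :: "nat \<Rightarrow> ('x::finite, 'k::field) fvec" where
  "kgen b = (\<Sum>y\<in>dec b. kel (dec b - {y}) (ex1 y) (ksgn (dec b) y))"

definition kdiff :: "('x::finite, 'k::field) fvec \<Rightarrow> ('x, 'k) fvec" where
  "kdiff v = (\<Sum>b\<in>Poly_Mapping.keys v. vscale (Poly_Mapping.lookup v b) (kgen b))"

lemma kdiff_hom: "module_hom vscale vscale (kdiff :: ('x::finite, 'k::field) fvec \<Rightarrow> _)"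
proof -
  interpret module "vscale :: ('x, 'k) mpol \<Rightarrow> _" by (rule module_vscale)
  show ?thesis
  proof (unfold_locales)
    fix v w :: "('x, 'k) fvec"
    show "kdiff (v + w) = kdiff v + kdiff w" unfolding kdiff_def
      by (rule setsum_keys_plus_distrib) (auto simp: scale_left_distrib)
  next
    fix f :: "('x,'k) mpol" and v :: "('x, 'k) fvec"
    have "kdiff (vscale f v) = (\<Sum>b\<in>Poly_Mapping.keys v. vscale (Poly_Mapping.lookup (vscale f v) b) (kgen b))"
      unfolding kdiff_def
      by (rule sum.mono_neutral_left) (auto simp: in_keys_iff lookup_vscale)
    then show "kdiff (vscale f v) = vscale f (kdiff v)"
      by (simp add: kdiff_def lookup_vscale scale_sum_right)
  qed
qed

lemma vscale_kel: "vscale (Poly_Mapping.single m c) (kel A m' d) = kel A (m + m') (c * d)"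
  by (rule poly_mapping_eqI) (simp add: lookup_vscale kel_def lookup_single when_def mult_single)

lemma kdiff_kel: "kdiff (kel A m c) = (\<Sum>y\<in>A. kel (A - {y}) (m + ex1 y) (c * ksgn A y))"
proof (cases "c = 0")
  case True
  then show ?thesis by (simp add: kdiff_def)
next
  case False
  interpret module "vscale :: ('a, 'b) mpol \<Rightarrow> _" by (rule module_vscale)
  have "Poly_Mapping.single m c \<noteq> 0" using False
    by (metis lookup_single_eq lookup_zero)
  then have "kdiff (kel A m c) = vscale (Poly_Mapping.single m c) (kgen (enc A))"
    by (simp add: kdiff_def kel_def)
  then show ?thesis by (simp add: kgen_def scale_sum_right vscale_kel)
qed

definition pivot :: "('x::finite) set \<Rightarrow> 'x" where
  "pivot U = (SOME x. x \<in> U \<and> (\<forall>y\<in>U. y \<noteq> x \<longrightarrow> vless x y))"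

lemma pivot: assumes "U \<noteq> {}" shows "pivot U \<in> U \<and> (\<forall>y\<in>U. y \<noteq> pivot U \<longrightarrow> vless (pivot U) y)"
proof -
  obtain x where "x \<in> U" "\<And>y. y \<in> U \<Longrightarrow> to_nat x \<le> to_nat y"
    using assms ex_has_least_nat[of "\<lambda>x. x \<in> U" _ to_nat] by blast
  then have "x \<in> U \<and> (\<forall>y\<in>U. y \<noteq> x \<longrightarrow> vless x y)"
    unfolding vless_def by (metis le_neq_implies_less to_nat_split)
  then show ?thesis unfolding pivot_def by (rule someI)
qed

definition khom1 :: "nat \<Rightarrow> 'x mon \<Rightarrow> 'k::field \<Rightarrow> ('x::finite, 'k) fvec" where
  "khom1 b m c = (let U = dec b \<union> Poly_Mapping.keys m; x = pivot U in
     if U = {} \<or> x \<in> dec b then 0 else kel (insert x (dec b)) (m - ex1 x) c)"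

definition khom2 :: "nat \<Rightarrow> ('x::finite, 'k::field) mpol \<Rightarrow> ('x, 'k) fvec" where
  "khom2 b p = (\<Sum>m\<in>Poly_Mapping.keys p. khom1 b m (Poly_Mapping.lookup p m))"

definition khom :: "('x::finite, 'k::field) fvec \<Rightarrow> ('x, 'k) fvec" where
  "khom v = (\<Sum>b\<in>Poly_Mapping.keys v. khom2 b (Poly_Mapping.lookup v b))"

lemma khom1_0 [simp]: "khom1 b m 0 = 0" by (simp add: khom1_def Let_def)

lemma khom2_add: "khom2 b (p + q) = khom2 b p + khom2 b q"
  unfolding khom2_def
  by (rule setsum_keys_plus_distrib) (auto simp: khom1_def Let_def kel_add)

lemma khom2_0 [simp]: "khom2 b 0 = 0" by (simp add: khom2_def)

lemma khom_additive: "additive khom"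
  by unfold_locales (unfold khom_def, rule setsum_keys_plus_distrib, auto simp: khom2_add)

lemma khom_kel: "khom (kel A m c) = khom1 (enc A) m c"
proof (cases "c = 0")
  case False
  then have "Poly_Mapping.single m c \<noteq> 0" by (metis lookup_single_eq lookup_zero)
  with False show ?thesis by (simp add: khom_def kel_def khom2_def)
qed (simp add: khom_def)

lemma keys_plus_mon: "Poly_Mapping.keys (m + m' :: 'x mon) = Poly_Mapping.keys m \<union> Poly_Mapping.keys m'"
  by (auto simp: in_keys_iff lookup_add)

lemma kdiff_additive: "additive (kdiff :: ('x::finite, 'k::field) fvec \<Rightarrow> _)"
proof -
  interpret module_hom vscale vscale "kdiff :: ('x, 'k) fvec \<Rightarrow> _" by (rule kdiff_hom)
  show ?thesis by unfold_locales (rule add)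
qed

lemma ex1_cancel: "x \<in> Poly_Mapping.keys m \<Longrightarrow> m - ex1 x + ex1 x = m"
  by (rule poly_mapping_eqI)
     (auto simp: lookup_add lookup_minus ex1_def lookup_single when_def in_keys_iff)

lemma homotopy_kel:
  fixes c :: "'k::field" and A :: "'x::finite set"
  assumes ne: "A \<union> Poly_Mapping.keys m \<noteq> {}"
  shows "kdiff (khom (kel A m c)) + khom (kdiff (kel A m c)) = kel A m c"
proof -
  interpret h: additive "khom :: ('x, 'k) fvec \<Rightarrow> _" by (rule khom_additive)
  interpret d: additive "kdiff :: ('x, 'k) fvec \<Rightarrow> _" by (rule kdiff_additive)
  define U where "U = A \<union> Poly_Mapping.keys m"
  define x where "x = pivot U"
  have x: "x \<in> U" "\<And>y. y \<in> U \<Longrightarrow> y \<noteq> x \<Longrightarrow> vless x y"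
    using pivot[of U] ne unfolding x_def U_def by auto
  have Uy: "(A - {y}) \<union> Poly_Mapping.keys (m + ex1 y) = U" if "y \<in> A" for y
    using that by (auto simp: U_def keys_plus_mon ex1_def split: if_splits)
  have hy: "khom (kel (A - {y}) (m + ex1 y) e)
      = (if x \<in> A - {y} then 0 else kel (insert x (A - {y})) (m + ex1 y - ex1 x) e)"
    if "y \<in> A" for y and e :: 'k
    using ne Uy[OF that] unfolding khom_kel khom1_def Let_def dec_enc
    by (simp add: x_def U_def[symmetric])
  show ?thesis
  proof (cases "x \<in> A")
    case True
    have "{z \<in> A. vless z x} = {}" using x unfolding U_def by (auto dest: vless_asym)
    then have sg: "ksgn A x = (1::'k)" by (simp only: ksgn_def) simp
    have "khom (kdiff (kel A m c)) = (\<Sum>y\<in>A. if y = x then kel A m c else 0)"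
      unfolding kdiff_kel h.sum
      by (rule sum.cong) (auto simp: hy True sg insert_absorb)
    moreover have "khom (kel A m c) = 0"
      using True by (simp add: khom_kel khom1_def Let_def U_def[symmetric] x_def[symmetric])
    ultimately show ?thesis using True by (simp add: d.zero)
  next
    case False
    then have xm: "x \<in> Poly_Mapping.keys m" using x(1) by (simp add: U_def)
    have sg: "ksgn (insert x A) x = (1::'k)"
    proof -
      have e: "{z \<in> insert x A. vless z x} = {}"
      proof -
        have "\<not> vless z x" if "z \<in> insert x A" for z
          using x(2)[of z] that vless_asym[of x z] by (cases "z = x") (auto simp: U_def vless_def)
        then show ?thesis by blast
      qed
      show ?thesis unfolding ksgn_def e by simp
    qed
    have sy: "ksgn (insert x A) y = - (ksgn A y :: 'k)" if "y \<in> A" for y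
    proof -
      have "vless x y" using x(2)[of y] that False by (auto simp: U_def)
      then have "{z \<in> insert x A. vless z y} = insert x {z\<in>A. vless z y}" by auto
      then show ?thesis using False by (simp add: ksgn_def)
    qed
    have my: "m - ex1 x + ex1 y = m + ex1 y - ex1 x" for y
      using xm by (intro poly_mapping_eqI)
        (auto simp: lookup_add lookup_minus ex1_def lookup_single when_def in_keys_iff)
    have "khom (kel A m c) = kel (insert x A) (m - ex1 x) c"
      using False ne by (simp add: khom_kel khom1_def Let_def U_def[symmetric] x_def[symmetric])
    then have "kdiff (khom (kel A m c)) =
       kel A m c + (\<Sum>y\<in>A. kel (insert x A - {y}) (m - ex1 x + ex1 y) (c * ksgn (insert x A) y))"
      using False by (simp add: kdiff_kel sg ex1_cancel[OF xm])
    also have "(\<Sum>y\<in>A. kel (insert x A - {y}) (m - ex1 x + ex1 y) (c * ksgn (insert x A) y))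
        = - (\<Sum>y\<in>A. kel (insert x (A - {y})) (m + ex1 y - ex1 x) (c * ksgn A y))"
      unfolding sum_negf[symmetric]
    proof (rule sum.cong)
      fix y assume y: "y \<in> A"
      then have "insert x A - {y} = insert x (A - {y})" using False by auto
      then show "kel (insert x A - {y}) (m - ex1 x + ex1 y) (c * ksgn (insert x A) y) =
         - kel (insert x (A - {y})) (m + ex1 y - ex1 x) (c * ksgn A y)"
        by (simp add: my sy[OF y] kel_uminus)
    qed simp
    also have "(\<Sum>y\<in>A. kel (insert x (A - {y})) (m + ex1 y - ex1 x) (c * ksgn A y))
        = khom (kdiff (kel A m c))"
      unfolding kdiff_kel h.sum using False by (intro sum.cong) (auto simp: hy)
    finally show ?thesis by simp
  qed
qed

lemma kdiff_kdiff_kel: "kdiff (kdiff (kel A m (c::'k::field))) = (0 :: ('x::finite,'k) fvec)"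
proof -
  interpret d: additive "kdiff :: ('x, 'k) fvec \<Rightarrow> _" by (rule kdiff_additive)
  define f :: "'x \<times> 'x \<Rightarrow> ('x,'k) fvec" where
    "f = (\<lambda>(y,z). kel (A - {y} - {z}) (m + ex1 y + ex1 z) (c * ksgn A y * ksgn (A - {y}) z))"
  define P where "P = {(y,z). y \<in> A \<and> z \<in> A \<and> vless y z}"
  define Q where "Q = {(y,z). y \<in> A \<and> z \<in> A \<and> vless z y}"
  have fin: "finite X" for X :: "('x\<times>'x) set" by simp
  have "kdiff (kdiff (kel A m c)) = (\<Sum>y\<in>A. \<Sum>z\<in>A - {y}. f (y,z))"
    by (simp add: kdiff_kel d.sum f_def)
  also have "\<dots> = sum f (SIGMA y:A. A - {y})"
    by (simp add: sum.Sigma)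
  also have "(SIGMA y:A. A - {y}) = P \<union> Q"
    by (auto simp: P_def Q_def vless_def to_nat_split dest: vless_linear[unfolded vless_def])
  also have "sum f (P \<union> Q) = sum f P + sum f Q"
    by (rule sum.union_disjoint) (auto simp: P_def Q_def dest: vless_asym)
  also have "sum f Q = (\<Sum>p\<in>P. f (prod.swap p))"
    by (rule sum.reindex_bij_witness[of _ prod.swap prod.swap]) (auto simp: P_def Q_def)
  also have "\<dots> = (\<Sum>p\<in>P. - f p)"
  proof (rule sum.cong)
    fix p assume "p \<in> P"
    then obtain y z where p: "p = (y,z)" "y \<in> A" "z \<in> A" "vless y z" by (auto simp: P_def)
    have "ksgn (A - {z}) y = (ksgn A y :: 'k)"
    proof -
      have "{w \<in> A - {z}. vless w y} = {w \<in> A. vless w y}" using p vless_asym by auto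
      then show ?thesis by (simp add: ksgn_def)
    qed
    moreover have "ksgn A z = - (ksgn (A - {y}) z :: 'k)"
    proof -
      have "{w \<in> A. vless w z} = insert y {w \<in> A - {y}. vless w z}" using p by auto
      moreover have "y \<notin> {w \<in> A - {y}. vless w z}" by simp
      ultimately show ?thesis by (simp add: ksgn_def)
    qed
    moreover have "A - {z} - {y} = A - {y} - {z}" by auto
    ultimately show "f (prod.swap p) = - f p"
      by (simp add: p f_def kel_uminus[symmetric] algebra_simps)
  qed simp
  finally show ?thesis by (simp add: sum_negf)
qed

definition koszul :: "('x::finite, 'k::field) fcomplex" where
  "koszul = \<lparr>basis = (\<lambda>i. enc ` {A::'x set. card A = i}), shift = (\<lambda>i b. exS (dec b)),
     diff = (\<lambda>i. kdiff), aug = (\<lambda>v. Poly_Mapping.lookup (Poly_Mapping.lookup v (enc ({}::'x set))) 0)\<rparr>"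

lemma koszul_closed:
  fixes T :: "('x::finite, 'k::field) fvec \<Rightarrow> ('x,'k) fvec"
  assumes T: "additive T" and W: "0 \<in> W" "\<And>v w. v \<in> W \<Longrightarrow> w \<in> W \<Longrightarrow> v + w \<in> W"
    and s: "\<And>A m c. card A = i \<Longrightarrow> m + exS A \<in> D \<Longrightarrow> T (kel A m c) \<in> W"
    and v: "v \<in> fmod koszul i"
      "\<And>b m. b \<in> Poly_Mapping.keys v \<Longrightarrow> m \<in> Poly_Mapping.keys (Poly_Mapping.lookup v b) \<Longrightarrow> m + exS (dec b) \<in> D"
  shows "T v \<in> W"
proof -
  interpret T: additive T by fact
  have sW: "(\<And>x. x \<in> X \<Longrightarrow> h x \<in> W) \<Longrightarrow> sum h X \<in> W" for X :: "'z set" and h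
    by (induction X rule: infinite_finite_induct) (auto intro: W)
  have sn: "Poly_Mapping.single b (sum h X) = (\<Sum>x\<in>X. Poly_Mapping.single b (h x))"
    for b and h :: "'x mon \<Rightarrow> ('x,'k) mpol" and X
    by (induction X rule: infinite_finite_induct) (auto simp: single_add)
  have "v = (\<Sum>b\<in>Poly_Mapping.keys v. \<Sum>m\<in>Poly_Mapping.keys (Poly_Mapping.lookup v b).
     Poly_Mapping.single b (Poly_Mapping.single m (Poly_Mapping.lookup (Poly_Mapping.lookup v b) m)))"
    (is "_ = ?w")
    unfolding sn[symmetric] pm_expand[symmetric] ..
  moreover have "T ?w \<in> W"
    unfolding T.sum
  proof (intro sW)
    fix b m assume bm: "b \<in> Poly_Mapping.keys v" "m \<in> Poly_Mapping.keys (Poly_Mapping.lookup v b)"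
    then obtain A :: "'x set" where "b = enc A" "card A = i"
      using v(1) by (auto simp: fmod_def koszul_def)
    then show "T (Poly_Mapping.single b (Poly_Mapping.single m (Poly_Mapping.lookup (Poly_Mapping.lookup v b) m))) \<in> W"
      using s[of A m] v(2)[OF bm] by (simp add: kel_def)
  qed
  ultimately show ?thesis by metis
qed

lemma fmod_closed: "0 \<in> fmod F i" "v \<in> fmod F i \<Longrightarrow> w \<in> fmod F i \<Longrightarrow> v + w \<in> fmod F i"
proof -
  assume "v \<in> fmod F i" "w \<in> fmod F i"
  then show "v + w \<in> fmod F i"
    using keys_add[of v w] unfolding fmod_def by blast
qed (simp add: fmod_def)

lemma mhom_closed: "0 \<in> mhom F i a" "v \<in> mhom F i a \<Longrightarrow> w \<in> mhom F i a \<Longrightarrow> v + w \<in> mhom F i a"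
proof -
  assume vw: "v \<in> mhom F i a" "w \<in> mhom F i a"
  show "v + w \<in> mhom F i a" unfolding mhom_def
  proof safe
    fix b m assume "m \<in> Poly_Mapping.keys (Poly_Mapping.lookup (v + w) b)"
    then consider "m \<in> Poly_Mapping.keys (Poly_Mapping.lookup v b)"
      | "m \<in> Poly_Mapping.keys (Poly_Mapping.lookup w b)"
      using keys_add[of "Poly_Mapping.lookup v b" "Poly_Mapping.lookup w b"] by (auto simp: lookup_add)
    then show "m + shift F i b = a"
    proof cases
      case 1
      then have "b \<in> Poly_Mapping.keys v" by (auto simp: in_keys_iff)
      then show ?thesis using 1 vw unfolding mhom_def by blast
    next
      case 2
      then have "b \<in> Poly_Mapping.keys w" by (auto simp: in_keys_iff)
      then show ?thesis using 2 vw unfolding mhom_def by blast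
    qed
  qed
qed (simp add: mhom_def)

lemma kel_fmod: "card A = i \<Longrightarrow> kel A m c \<in> fmod koszul i"
  by (auto simp: fmod_def koszul_def kel_def)

lemma kel_mhom: "kel A m c \<in> mhom koszul i (m + exS A)"
  by (auto simp: mhom_def koszul_def kel_def)

lemma koszul_diff_range:
  fixes v :: "('x::finite, 'k::field) fvec"
  assumes "v \<in> fmod koszul (Suc i)"
  shows "kdiff v \<in> fmod koszul i"
proof (rule koszul_closed[OF kdiff_additive fmod_closed _ assms, where D = UNIV])
  fix A :: "'x set" and m and c :: 'k assume A: "card A = Suc i"
  have sW: "(\<And>x. x \<in> X \<Longrightarrow> h x \<in> fmod koszul i) \<Longrightarrow> sum h X \<in> fmod koszul i"
    for X :: "'x set" and h :: "_ \<Rightarrow> ('x,'k) fvec"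
    by (induction X rule: infinite_finite_induct) (auto intro: fmod_closed)
  show "kdiff (kel A m c) \<in> fmod koszul i"
    unfolding kdiff_kel using A by (intro sW kel_fmod) auto
qed auto

lemma koszul_diff_hom:
  fixes v :: "('x::finite, 'k::field) fvec"
  assumes "v \<in> fmod koszul (Suc i)" "v \<in> mhom koszul (Suc i) a"
  shows "kdiff v \<in> mhom koszul i a"
proof (rule koszul_closed[OF kdiff_additive mhom_closed _ assms(1), where D = "{a}"])
  fix A :: "'x set" and m and c :: 'k assume A: "m + exS A \<in> {a}"
  have sW: "(\<And>x. x \<in> X \<Longrightarrow> h x \<in> mhom koszul i a) \<Longrightarrow> sum h X \<in> mhom koszul i a"
    for X :: "'x set" and h :: "_ \<Rightarrow> ('x,'k) fvec"
    by (induction X rule: infinite_finite_induct) (auto intro: mhom_closed)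
  show "kdiff (kel A m c) \<in> mhom koszul i a"
    unfolding kdiff_kel
  proof (rule sW)
    fix y assume "y \<in> A"
    then have "m + ex1 y + exS (A - {y}) = a" using A by (simp add: exS_remove add.assoc)
    then show "kel (A - {y}) (m + ex1 y) (c * ksgn A y) \<in> mhom koszul i a"
      using kel_mhom by metis
  qed
qed (use assms(2) in \<open>auto simp: mhom_def koszul_def\<close>)

lemma koszul_hom_range:
  fixes v :: "('x::finite, 'k::field) fvec"
  assumes "v \<in> fmod koszul i"
  shows "khom v \<in> fmod koszul (Suc i)"
proof (rule koszul_closed[OF khom_additive fmod_closed _ assms, where D = UNIV])
  fix A :: "'x set" and m and c :: 'k assume A: "card A = i"
  show "khom (kel A m c) \<in> fmod koszul (Suc i)"
    using A by (auto simp: khom_kel khom1_def Let_def fmod_closed intro!: kel_fmod)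
qed auto

lemma koszul_diff_diff:
  fixes v :: "('x::finite, 'k::field) fvec"
  assumes "v \<in> fmod koszul i"
  shows "kdiff (kdiff v) = 0"
proof -
  interpret d: additive "kdiff :: ('x, 'k) fvec \<Rightarrow> _" by (rule kdiff_additive)
  have "additive (\<lambda>v. kdiff (kdiff v) :: ('x,'k) fvec)"
    by unfold_locales (simp add: d.add)
  from koszul_closed[OF this, of "{0}" i UNIV v] assms show ?thesis
    by (simp add: kdiff_kdiff_kel)
qed

lemma koszul_homotopy:
  fixes v :: "('x::finite, 'k::field) fvec"
  assumes "v \<in> fmod koszul i" "\<And>b m. b \<in> Poly_Mapping.keys v \<Longrightarrow>
      m \<in> Poly_Mapping.keys (Poly_Mapping.lookup v b) \<Longrightarrow> m + exS (dec b) \<noteq> (0 :: 'x mon)"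
  shows "kdiff (khom v) + khom (kdiff v) = v"
proof -
  interpret d: additive "kdiff :: ('x, 'k) fvec \<Rightarrow> _" by (rule kdiff_additive)
  interpret h: additive "khom :: ('x, 'k) fvec \<Rightarrow> _" by (rule khom_additive)
  have a: "additive (\<lambda>v. kdiff (khom v) + khom (kdiff v) - v :: ('x,'k) fvec)"
    by unfold_locales (simp add: d.add h.add)
  have "kdiff (khom v) + khom (kdiff v) - v \<in> {0}"
  proof (rule koszul_closed[OF a _ _ _ assms(1), where D = "- {0}"])
    fix A :: "'x set" and m and c :: 'k assume "m + exS A \<in> - {0}"
    then have "A \<union> Poly_Mapping.keys m \<noteq> {}" by (auto simp: exS_def)
    then show "kdiff (khom (kel A m c)) + khom (kdiff (kel A m c)) - kel A m c \<in> {0}"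
      by (simp add: homotopy_kel)
  qed (use assms(2) in auto)
  then show ?thesis by simp
qed

lemma exS_nonzero:
  assumes "A \<noteq> {}" shows "m + exS A \<noteq> 0"
proof -
  obtain y where y: "y \<in> A" using assms by blast
  have "Poly_Mapping.lookup (m + exS A) y = Poly_Mapping.lookup m y + (Poly_Mapping.lookup (ex1 y) y + Poly_Mapping.lookup (exS (A - {y})) y)"
    by (simp only: exS_remove[OF y] lookup_add)
  then have "Poly_Mapping.lookup (m + exS A) y \<noteq> 0"
    by (simp add: ex1_def)
  then show ?thesis by (metis lookup_zero)
qed

lemma koszul_fmod_0:
  fixes v :: "('x::finite, 'k::field) fvec"
  shows "v \<in> fmod koszul 0 \<longleftrightarrow> Poly_Mapping.keys v \<subseteq> {enc ({} :: 'x set)}"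
  by (auto simp: fmod_def koszul_def)

theorem koszul_free_resolution_K: "free_resolution_K (koszul :: ('x::finite, 'k::field) fcomplex)"
proof -
  let ?F = "koszul :: ('x, 'k) fcomplex"
  interpret d: additive "kdiff :: ('x, 'k) fvec \<Rightarrow> _" by (rule kdiff_additive)
  interpret h: additive "khom :: ('x, 'k) fvec \<Rightarrow> _" by (rule khom_additive)
  have D [simp]: "diff ?F i = kdiff" for i by (simp add: koszul_def)
  have G [simp]: "aug ?F v = Poly_Mapping.lookup (Poly_Mapping.lookup v (enc ({}::'x set))) 0" for v
    by (simp add: koszul_def)
  have aug: "module_hom vscale kscale (aug ?F)"
  proof -
    interpret V: module "vscale :: ('x, 'k) mpol \<Rightarrow> _" by (rule module_vscale)
    interpret K: module "kscale :: ('x, 'k) mpol \<Rightarrow> _" by (rule module_kscale)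
    show ?thesis
      by unfold_locales (auto simp: lookup_add lookup_vscale lookup_mult_0 kscale_def)
  qed
  have aug_hom: "aug ?F v = 0" if "a \<noteq> 0" "v \<in> fmod ?F 0 \<inter> mhom ?F 0 a" for a v
  proof (rule ccontr)
    assume "aug ?F v \<noteq> 0"
    then have "0 \<in> Poly_Mapping.keys (Poly_Mapping.lookup v (enc ({}::'x set)))"
      by (simp add: in_keys_iff)
    moreover from this have "enc ({}::'x set) \<in> Poly_Mapping.keys v" by (auto simp: in_keys_iff)
    ultimately have "0 + shift ?F 0 (enc ({}::'x set)) = a" using that unfolding mhom_def by blast
    then show False using that by (simp add: koszul_def exS_def)
  qed
  have aug_surj: "aug ?F ` fmod ?F 0 = UNIV"
  proof (intro equalityI subset_UNIV subsetI)
    fix c :: 'k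
    have "aug ?F (kel {} 0 c) = c" by (simp add: kel_def)
    then show "c \<in> aug ?F ` fmod ?F 0" using kel_fmod[of "{}" 0 0 c] by (metis card.empty image_eqI)
  qed
  have ex0: "{v \<in> fmod ?F 0. aug ?F v = 0} = kdiff ` fmod ?F 1"
  proof (intro equalityI subsetI)
    fix v assume "v \<in> {v \<in> fmod ?F 0. aug ?F v = 0}"
    then have v: "v \<in> fmod ?F 0" "aug ?F v = 0" by auto
    have "kdiff (khom v) + khom (kdiff v) = v"
    proof (rule koszul_homotopy[OF v(1)])
      fix b m assume bm: "b \<in> Poly_Mapping.keys v" "m \<in> Poly_Mapping.keys (Poly_Mapping.lookup v b)"
      then have b: "b = enc ({}::'x set)" using v(1) by (auto simp: koszul_fmod_0)
      have "m \<noteq> 0" using v(2) bm b by (auto simp: in_keys_iff)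
      then show "m + exS (dec b) \<noteq> (0::'x mon)" by (simp add: b exS_def)
    qed
    moreover have "kdiff v = 0"
    proof -
      have "kdiff v \<in> {0}"
        by (rule koszul_closed[OF kdiff_additive _ _ _ v(1), where D = UNIV]) (auto simp: kdiff_kel)
      then show ?thesis by simp
    qed
    ultimately have "v = kdiff (khom v)" by (simp add: h.zero)
    then show "v \<in> kdiff ` fmod ?F 1" using koszul_hom_range[OF v(1)] by auto
  next
    fix v assume "v \<in> kdiff ` fmod ?F 1"
    then obtain w where w: "v = kdiff w" "w \<in> fmod ?F (Suc 0)" by auto
    have "kdiff w \<in> {u. aug ?F u = 0}"
    proof (rule koszul_closed[OF kdiff_additive _ _ _ w(2), where D = UNIV])
      fix A :: "'x set" and m and c :: 'k assume "card A = Suc 0"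
      then obtain y where A: "A = {y}" by (auto simp: card_Suc_eq)
      have "m + ex1 y \<noteq> 0" using exS_nonzero[of "{y}" m] by (simp add: exS_def)
      then show "kdiff (kel A m c) \<in> {u. aug ?F u = 0}"
        by (simp add: A kdiff_kel) (simp add: kel_def lookup_single when_def)
    qed (auto simp: lookup_add)
    then show "v \<in> {v \<in> fmod ?F 0. aug ?F v = 0}"
      using w koszul_diff_range[OF w(2)] by simp
  qed
  have ex: "{v \<in> fmod ?F (Suc i). kdiff v = 0} = kdiff ` fmod ?F (Suc (Suc i))" for i
  proof (intro equalityI subsetI)
    fix v assume "v \<in> {v \<in> fmod ?F (Suc i). kdiff v = 0}"
    then have v: "v \<in> fmod ?F (Suc i)" "kdiff v = 0" by auto
    have "kdiff (khom v) + khom (kdiff v) = v"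
    proof (rule koszul_homotopy[OF v(1)])
      fix b m assume "b \<in> Poly_Mapping.keys v"
      then obtain A :: "'x set" where "b = enc A" "card A = Suc i"
        using v(1) by (auto simp: fmod_def koszul_def)
      moreover from this have "A \<noteq> {}" by auto
      ultimately show "m + exS (dec b) \<noteq> (0::'x mon)" using exS_nonzero[of A m] by simp
    qed
    then have "v = kdiff (khom v)" by (simp add: v(2) h.zero)
    then show "v \<in> kdiff ` fmod ?F (Suc (Suc i))" using koszul_hom_range[OF v(1)] by auto
  qed (auto simp: koszul_diff_diff dest: koszul_diff_range)
  have "finite (basis ?F i)" for i by (simp add: koszul_def)
  then show ?thesis
    unfolding free_resolution_K_def D
    using kdiff_hom koszul_diff_range koszul_diff_hom aug aug_hom aug_surj ex0 ex
    by (intro conjI allI impI) blast+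
qed

corollary free_resolution_K_exists:
  "\<exists>F :: ('x::finite, 'k::field) fcomplex. free_resolution_K F"
  using koszul_free_resolution_K by blast

corollary free_resolution_K_resK: "free_resolution_K (resK :: ('x::finite, 'k::field) fcomplex)"
  unfolding resK_def by (rule someI_ex) (rule free_resolution_K_exists)

end

theory Submission
  imports Defs "HOL-Library.Multiset" "HOL-Library.FuncSet"
begin

text \<open>
  In multidegree \<open>a\<close>, \<open>Tor\<^sub>i(K, J)\<close> of a monomial ideal \<open>J\<close> is the homology of a simplicial complex
  read off from the exponents of \<open>J\<close>. The cycles belonging to all ideals \<open>I\<^sup>l J\<close> together form a finitely
  generated module over the Rees algebra of \<open>I\<close>, by Dickson's lemma and a leading term argument, and
  variables annihilate homology. Hence for large \<open>l\<close> each nonzero multidegree of \<open>Tor\<^sub>i(K, I\<^sup>l\<^sup>+\<^sup>1 J)\<close> is one of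
  \<open>Tor\<^sub>i(K, I\<^sup>l J)\<close> plus a generator of \<open>I\<close>. If \<open>I\<close> has linear powers, then for degree reasons adding a
  generator of \<open>I\<close> conversely preserves nonvanishing for the powers of \<open>I\<close>, so that
  \<open>HS\<^sub>i(I\<^sup>k\<^sup>+\<^sup>1) = I HS\<^sub>i(I\<^sup>k)\<close> for large \<open>k\<close>.

  This reduces everything to the ideals \<open>I\<^sup>l J\<close> with \<open>I\<close> and \<open>J\<close> monomial and \<open>I\<close> generated in one degree.
  Regularity and the set of nonvanishing \<open>Tor\<^sub>i\<close> are controlled by the finite generation above, and the
  latter determines the depth by the depth sensitivity of the Koszul complex. Associated primes and
  v-numbers are governed by the monomials \<open>x\<^sup>c\<close> for which \<open>I\<^sup>l J : x\<^sup>c\<close> is a given monomial prime; the pairs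
  \<open>(c, l)\<close> form a convex subset of a finitely generated module over the Rees algebra.
\<close>

text \<open>Homology is defined through an arbitrarily chosen \<open>resK\<close>, of which only the
  resolution axioms are known; the simplicial description becomes available after passing to the
  Koszul complex. From then on ideals are replaced by sets of exponents, and multiplication by a
  generator of \<open>I\<close> becomes the inclusion of one simplicial complex into another, with
  the same coefficient function. Finite generation alone bounds the invariants but does not make
  them linear. If \<open>d\<close> is the degree of the generators of \<open>I\<close>, the
  sequences \<open>d * l - reg\<close> and \<open>v - d * l\<close> are integer valued, bounded
  above and eventually nondecreasing, hence eventually constant: the slope is \<open>d\<close>, and
  the intercept is never computed. Monotonicity comes from removing one generator of
  \<open>I\<close> from a monomial of level \<open>l + 1\<close>, which is possible once
  \<open>l\<close> is at least the level of every member of a finite generating set. The zero and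
  the unit ideal are separated beforehand: the depth computation uses proper ideals and the
  v-numbers use nonzero ones.\<close>

abbreviation "lookup \<equiv> Poly_Mapping.lookup"
abbreviation "keys \<equiv> Poly_Mapping.keys"
abbreviation "single \<equiv> Poly_Mapping.single"


section \<open>Exponent vectors\<close>

text \<open>\<open>seq_monosub\<close> gives a monotone subsequence; a decreasing one is constant
  once it reaches its minimum, so its tail qualifies as well.\<close>

lemma incseq_subseq_nat:
  fixes s :: "nat \<Rightarrow> nat"
  shows "\<exists>r. strict_mono r \<and> incseq (s \<circ> r)"
proof -
  obtain f where f: "strict_mono f" "monoseq (\<lambda>n. s (f n))"
    using seq_monosub[of s] by blast
  show ?thesis
  proof (cases "incseq (\<lambda>n. s (f n))")
    case True
    then show ?thesis using f(1) by (auto simp: o_def)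
  next
    case False
    then have dec: "decseq (\<lambda>n. s (f n))" using f(2) by (simp add: monoseq_iff)
    obtain N where N: "\<And>n. s (f N) \<le> s (f n)"
      using ex_has_least_nat[of "\<lambda>_. True" 0 "\<lambda>n. s (f n)"] by auto
    have "s (f (n + N)) = s (f N)" for n
      using N[of "n + N"] decseqD[OF dec, of N "n + N"] by simp
    then have "incseq (s \<circ> (\<lambda>n. f (n + N)))" by (simp add: incseq_def)
    moreover have "strict_mono (\<lambda>n. f (n + N))" using f(1) by (simp add: strict_mono_def)
    ultimately show ?thesis by blast
  qed
qed

lemma simultaneous_incseq_subseq:
  fixes s :: "nat \<Rightarrow> 'i \<Rightarrow> nat"
  assumes "finite I"
  shows "\<exists>r. strict_mono r \<and> (\<forall>i\<in>I. incseq (\<lambda>n. s (r n) i))"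
  using assms
proof (induction I)
  case empty
  have "strict_mono (id :: nat \<Rightarrow> nat)" by (simp add: strict_mono_def)
  then show ?case by blast
next
  case (insert j I)
  then obtain r where r: "strict_mono r" "\<And>i. i \<in> I \<Longrightarrow> incseq (\<lambda>n. s (r n) i)" by blast
  obtain q where q: "strict_mono q" "incseq ((\<lambda>n. s (r n) j) \<circ> q)"
    using incseq_subseq_nat by blast
  have "incseq (\<lambda>n. s (r (q n)) i)" if "i \<in> I" for i
    using r(2)[OF that] q(1) by (simp add: incseq_def strict_mono_less_eq)
  moreover have "strict_mono (r \<circ> q)" using r(1) q(1) by (rule strict_mono_o)
  ultimately show ?case using q(2) by (intro exI[of _ "r \<circ> q"]) (auto simp: o_def)
qed

text \<open>If no finite subset worked, elements could be picked forever so that none dominates an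
  earlier one, against the existence of a subsequence increasing in every coordinate. The
  coordinates are arbitrary measures \<open>\<mu>\<close>, because \<open>qle_noetherian\<close>
  mixes multiplicities of generators with exponents of variables.\<close>

lemma dickson:
  fixes \<mu> :: "'s \<Rightarrow> 'i \<Rightarrow> nat"
  assumes I: "finite I"
  shows "\<exists>X0. finite X0 \<and> X0 \<subseteq> X \<and> (\<forall>x\<in>X. \<exists>y\<in>X0. \<forall>i\<in>I. \<mu> y i \<le> \<mu> x i)"
proof (rule ccontr)
  assume no: "\<not> ?thesis"
  \<comment> \<open>The recursion carries the whole set of elements picked so far, since a new one
    is compared with all of them.\<close>
  define R where "R S S' \<longleftrightarrow> (\<exists>x\<in>X. S' = insert x S \<and> (\<forall>y\<in>S. \<not> (\<forall>i\<in>I. \<mu> y i \<le> \<mu> x i)))"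
    for S S'
  have "\<exists>S. \<forall>n. (finite (S n) \<and> S n \<subseteq> X) \<and> R (S n) (S (Suc n))"
  proof (rule dependent_nat_choice[where P = "\<lambda>_ S. finite S \<and> S \<subseteq> X" and Q = "\<lambda>_. R"])
    show "\<exists>S. finite S \<and> S \<subseteq> X" by (rule exI[of _ "{}"]) simp
  next
    fix S and n :: nat assume S: "finite S \<and> S \<subseteq> X"
    have "\<not> (finite S \<and> S \<subseteq> X \<and> (\<forall>x\<in>X. \<exists>y\<in>S. \<forall>i\<in>I. \<mu> y i \<le> \<mu> x i))"
      using no by (rule contrapos_nn) (rule exI)
    then obtain x where "x \<in> X" "\<forall>y\<in>S. \<not> (\<forall>i\<in>I. \<mu> y i \<le> \<mu> x i)"
      using S by auto
    then have "R S (insert x S)" "finite (insert x S) \<and> insert x S \<subseteq> X" using S by (auto simp: R_def)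
    then show "\<exists>S'. (finite S' \<and> S' \<subseteq> X) \<and> R S S'" by blast
  qed
  then obtain S where "\<forall>n. R (S n) (S (Suc n))"
    by blast
  then obtain x where x: "\<And>n. S (Suc n) = insert (x n) (S n)"
      "\<And>n y. y \<in> S n \<Longrightarrow> \<not> (\<forall>i\<in>I. \<mu> y i \<le> \<mu> (x n) i)"
    unfolding R_def by metis
  have mono: "S m \<subseteq> S n" if "m \<le> n" for m n
    using that by (rule lift_Suc_mono_le[of S, rotated]) (auto simp: x(1))
  have mem: "x m \<in> S n" if "m < n" for m n
    using mono[of "Suc m" n] that x(1) by auto
  obtain r where r: "strict_mono r" "\<forall>i\<in>I. incseq (\<lambda>n. \<mu> (x (r n)) i)"
    using simultaneous_incseq_subseq[OF I, of "\<lambda>n. \<mu> (x n)"] by blast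
  have "r 0 < r 1" using r(1) by (simp add: strict_mono_def)
  moreover have "\<forall>i\<in>I. \<mu> (x (r 0)) i \<le> \<mu> (x (r 1)) i" using r(2) by (auto simp: incseq_def)
  ultimately show False using x(2) mem by blast
qed

section \<open>Degree, divisibility and a monomial order\<close>

lemma mdeg_add [simp]: "mdeg (a + b) = mdeg a + mdeg b"
  by (simp add: mdeg_def lookup_add sum.distrib)

lemma mdeg_0 [simp]: "mdeg 0 = 0"
  by (simp add: mdeg_def)

lemma mdeg_eq_0_iff [simp]: "mdeg a = 0 \<longleftrightarrow> a = 0"
  by (auto simp: mdeg_def intro!: poly_mapping_eqI)

lemma mdeg_ex1 [simp]: "mdeg (ex1 x) = 1"
  by (simp add: mdeg_def ex1_def lookup_single when_def)

lemma mdeg_exS [simp]: "mdeg (exS A) = card A"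
proof -
  have "mdeg (sum ex1 A) = card A" if "finite A" for A :: "'a set"
    using that by (induction A) auto
  then show ?thesis by (simp add: exS_def)
qed

lemma mdeg_sum_mset: "(\<And>g. g \<in># M \<Longrightarrow> mdeg g = d) \<Longrightarrow> mdeg (sum_mset M) = d * size M"
  by (induction M) auto

lemma lookup_ex1: "lookup (ex1 x) y = (if y = x then 1 else 0)"
  by (simp add: ex1_def lookup_single when_def)

lemma lookup_sum_mset: "lookup (sum_mset M) x = sum_mset (image_mset (\<lambda>g. lookup g x) M)"
  by (induction M) (auto simp: lookup_add)

definition mle :: "'x mon \<Rightarrow> 'x mon \<Rightarrow> bool" where
  "mle a b \<longleftrightarrow> (\<forall>x. lookup a x \<le> lookup b x)"

lemma mle_iff: "mle a b \<longleftrightarrow> (\<exists>m. b = a + m)"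
proof
  assume "mle a b"
  then have "b = a + (b - a)"
    by (intro poly_mapping_eqI) (simp add: lookup_add lookup_minus mle_def)
  then show "\<exists>m. b = a + m" ..
qed (auto simp: mle_def lookup_add)

lemma mle_diff: "mle a b \<Longrightarrow> a + (b - a) = b"
  by (intro poly_mapping_eqI) (simp add: lookup_add lookup_minus mle_def)

lemma mle_diff': "mle a b \<Longrightarrow> b - a + a = b"
  using mle_diff[of a b] by (simp add: add.commute)

lemma mle_add: "mle a (a + m)"
  by (auto simp: mle_iff)

lemma ex1_le_iff: "mle (ex1 x) a \<longleftrightarrow> lookup a x > 0"
  by (auto simp: mle_def lookup_ex1 Suc_le_eq)

lemma finite_mdeg_le: "finite {a :: ('x::finite \<Rightarrow>\<^sub>0 nat). mdeg a \<le> d}"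
proof (rule finite_imageD)
  have "lookup ` {a :: 'x mon. mdeg a \<le> d} \<subseteq> (UNIV \<rightarrow> {..d})"
  proof (clarsimp simp: mdeg_def)
    fix a :: "'x mon" and x assume "sum (lookup a) UNIV \<le> d"
    then show "lookup a x \<le> d" using member_le_sum[of x UNIV "lookup a"] by simp
  qed
  moreover have "finite (UNIV \<rightarrow> {..d} :: ('x \<Rightarrow> nat) set)"
    using finite_PiE[of "UNIV :: 'x set" "\<lambda>_. {..d}"] by (simp add: PiE_UNIV_domain)
  ultimately show "finite (lookup ` {a :: 'x mon. mdeg a \<le> d})" by (rule finite_subset)
qed (simp add: inj_on_def lookup_inject)

text \<open>Only the degree lexicographic order is needed; since it has order type \<open>\<omega>\<close>, it is the
  pullback of the order of \<open>nat\<close> along its rank function.\<close>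

lemma monomial_order_exists:
  "\<exists>\<rho> :: ('x::finite) mon \<Rightarrow> nat. inj \<rho> \<and> (\<forall>a b c. \<rho> a < \<rho> b \<longrightarrow> \<rho> (a + c) < \<rho> (b + c))"
proof -
  \<comment> \<open>The type \<open>'x\<close> carries no order; numbering the variables by
    \<open>to_nat\<close> borrows the linear order of \<open>nat\<close>-indexed finitely supported
    functions for the tie break.\<close>
  define \<phi> :: "'x mon \<Rightarrow> (nat \<Rightarrow>\<^sub>0 nat)" where
    "\<phi> a = (\<Sum>x\<in>UNIV. single (to_nat x) (lookup a x))" for a
  have \<phi>_lookup: "lookup (\<phi> a) (to_nat x) = lookup a x" for a x
    by (simp add: \<phi>_def lookup_sum lookup_single when_def)
  have \<phi>_add: "\<phi> (a + b) = \<phi> a + \<phi> b" for a b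
    by (simp add: \<phi>_def lookup_add single_add sum.distrib)
  have \<phi>_inj: "a = b" if "\<phi> a = \<phi> b" for a b
    using that by (metis \<phi>_lookup poly_mapping_eqI)
  define lt where "lt a b \<longleftrightarrow> mdeg a < mdeg b \<or> mdeg a = mdeg b \<and> \<phi> a < \<phi> b" for a b
  have lt_trans: "lt a b \<Longrightarrow> lt b c \<Longrightarrow> lt a c" for a b c
    by (auto simp: lt_def)
  have lt_irrefl: "\<not> lt a a" for a by (simp add: lt_def)
  have lt_total: "a \<noteq> b \<Longrightarrow> lt a b \<or> lt b a" for a b
    using \<phi>_inj[of a b] linorder_less_linear[of "\<phi> a" "\<phi> b"]
      linorder_less_linear[of "mdeg a" "mdeg b"] unfolding lt_def by metis
  have lt_add: "lt a b \<Longrightarrow> lt (a + c) (b + c)" for a b c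
    by (auto simp: lt_def \<phi>_add add_strict_right_mono)
  define \<rho> where "\<rho> a = card {b. lt b a}" for a
  have fin: "finite {b. lt b a}" for a
    by (rule finite_subset[OF _ finite_mdeg_le[of "mdeg a"]]) (auto simp: lt_def)
  have mono: "\<rho> a < \<rho> b" if "lt a b" for a b
    unfolding \<rho>_def
  proof (rule psubset_card_mono[OF fin])
    show "{c. lt c a} \<subset> {c. lt c b}" using that lt_trans lt_irrefl by blast
  qed
  have iff: "\<rho> a < \<rho> b \<longleftrightarrow> lt a b" for a b
    using mono lt_total by (metis less_asym less_irrefl)
  have "inj \<rho>" using mono lt_total by (metis injI less_irrefl)
  then show ?thesis using lt_add by (auto simp: iff)
qed

section \<open>Products of generators and the Rees preorder\<close>

text \<open>Multisets rather than lists or functions: the multiplicity of each generator is the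
  coordinate to which Dickson's lemma is applied.\<close>

definition nsums :: "'x mon set \<Rightarrow> nat \<Rightarrow> 'x mon set" where
  "nsums G k = {sum_mset M | M. set_mset M \<subseteq> G \<and> size M = k}"

lemma nsums_0 [simp]: "nsums G 0 = {0}"
  by (auto simp: nsums_def)

lemma nsums_Suc: "nsums G (Suc k) = {g + s | g s. g \<in> G \<and> s \<in> nsums G k}"
proof (intro equalityI subsetI)
  fix a assume "a \<in> nsums G (Suc k)"
  then obtain M where M: "a = sum_mset M" "set_mset M \<subseteq> G" "size M = Suc k"
    by (auto simp: nsums_def)
  then obtain g N where "M = add_mset g N" by (metis size_eq_Suc_imp_eq_union)
  with M show "a \<in> {g + s | g s. g \<in> G \<and> s \<in> nsums G k}"
    unfolding nsums_def by auto
next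
  fix a assume "a \<in> {g + s | g s. g \<in> G \<and> s \<in> nsums G k}"
  then obtain g M where "a = g + sum_mset M" "g \<in> G" "set_mset M \<subseteq> G" "size M = k"
    by (auto simp: nsums_def)
  then show "a \<in> nsums G (Suc k)"
    unfolding nsums_def by (auto intro!: exI[of _ "add_mset g M"])
qed

lemma nsums_add: "s \<in> nsums G k \<Longrightarrow> t \<in> nsums G l \<Longrightarrow> s + t \<in> nsums G (k + l)"
proof -
  assume "s \<in> nsums G k" "t \<in> nsums G l"
  then obtain M N where "s = sum_mset M" "set_mset M \<subseteq> G" "size M = k"
      "t = sum_mset N" "set_mset N \<subseteq> G" "size N = l"
    by (auto simp: nsums_def)
  then show ?thesis unfolding nsums_def by (auto intro!: exI[of _ "M + N"])
qed

lemma nsums_nonempty: "G \<noteq> {} \<Longrightarrow> nsums G k \<noteq> {}"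
  by (induction k) (auto simp: nsums_Suc)

lemma mdeg_nsums:
  assumes "\<And>g. g \<in> G \<Longrightarrow> mdeg g = d" "s \<in> nsums G k"
  shows "mdeg s = d * k"
proof -
  obtain M where M: "s = sum_mset M" "set_mset M \<subseteq> G" "size M = k"
    using assms(2) by (auto simp: nsums_def)
  have "mdeg (sum_mset M) = d * size M"
    by (rule mdeg_sum_mset) (use assms(1) M(2) in blast)
  then show ?thesis using M by simp
qed

text \<open>\<open>qle G\<close> is the divisibility preorder of the monomials of the Rees algebra \<open>S[x\<^sup>g t : g \<in> G]\<close>,
  a pair \<open>(a, k)\<close> standing for \<open>x\<^sup>a t\<^sup>k\<close>.\<close>

definition qle :: "'x mon set \<Rightarrow> 'x mon \<times> nat \<Rightarrow> 'x mon \<times> nat \<Rightarrow> bool" where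
  "qle G p q \<longleftrightarrow> snd p \<le> snd q \<and> (\<exists>s\<in>nsums G (snd q - snd p). \<exists>m. fst q = fst p + s + m)"

text \<open>An element above \<open>v\<close> is described by the multiplicities of the generators
  of \<open>I\<close> in a chosen factorization and by the exponent that is left over. These are
  finitely many numbers, and comparing them implies \<open>qle\<close>; so Dickson's lemma is
  applied once for each \<open>v\<close> in \<open>V0\<close>. In module terms, monomial submodules
  of a finitely generated module over the Rees algebra are finitely generated.\<close>

lemma qle_noetherian:
  fixes G :: "('x::finite) mon set"
  assumes G: "finite G" and V0: "finite V0" and N: "\<And>p. p \<in> N \<Longrightarrow> \<exists>v\<in>V0. qle G v p"
  shows "\<exists>N0. finite N0 \<and> N0 \<subseteq> N \<and> (\<forall>p\<in>N. \<exists>q\<in>N0. qle G q p)"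
proof -
  have "\<forall>p\<in>N. \<exists>v M m. v \<in> V0 \<and> snd v \<le> snd p \<and> set_mset M \<subseteq> G \<and> size M = snd p - snd v \<and>
      fst p = fst v + sum_mset M + m"
  proof
    fix p assume "p \<in> N"
    then obtain v where "v \<in> V0" "qle G v p" using N by blast
    then show "\<exists>v M m. v \<in> V0 \<and> snd v \<le> snd p \<and> set_mset M \<subseteq> G \<and> size M = snd p - snd v \<and>
      fst p = fst v + sum_mset M + m"
      unfolding qle_def nsums_def by blast
  qed
  then obtain v M m where vMm: "\<And>p. p \<in> N \<Longrightarrow> v p \<in> V0" "\<And>p. p \<in> N \<Longrightarrow> snd (v p) \<le> snd p"
      "\<And>p. p \<in> N \<Longrightarrow> set_mset (M p) \<subseteq> G" "\<And>p. p \<in> N \<Longrightarrow> size (M p) = snd p - snd (v p)"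
      "\<And>p. p \<in> N \<Longrightarrow> fst p = fst (v p) + sum_mset (M p) + m p"
    by metis
  define \<mu> where "\<mu> p = case_sum (count (M p)) (lookup (m p))" for p
  have "\<exists>X0. finite X0 \<and> X0 \<subseteq> {p \<in> N. v p = w} \<and>
      (\<forall>p\<in>{p \<in> N. v p = w}. \<exists>q\<in>X0. \<forall>i\<in>G <+> (UNIV :: 'x set). \<mu> q i \<le> \<mu> p i)" for w
    by (rule dickson) (simp add: G)
  then have "\<forall>w. \<exists>X0. finite X0 \<and> X0 \<subseteq> {p \<in> N. v p = w} \<and>
      (\<forall>p\<in>{p \<in> N. v p = w}. \<exists>q\<in>X0. \<forall>i\<in>G <+> (UNIV :: 'x set). \<mu> q i \<le> \<mu> p i)" ..
  then obtain X where X': "\<forall>w. finite (X w) \<and> X w \<subseteq> {p \<in> N. v p = w} \<and>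
      (\<forall>p\<in>{p \<in> N. v p = w}. \<exists>q\<in>X w. \<forall>i\<in>G <+> (UNIV :: 'x set). \<mu> q i \<le> \<mu> p i)"
    by (rule choice[THEN exE])
  have X: "finite (X w)" "X w \<subseteq> {p \<in> N. v p = w}" for w using spec[OF X', of w] by simp_all
  have X3: "\<exists>q\<in>X w. \<forall>i\<in>G <+> (UNIV :: 'x set). \<mu> q i \<le> \<mu> p i" if "p \<in> N" "v p = w" for p w
    using spec[OF X', of w] that by (cases p) simp
  have "\<exists>q\<in>\<Union>(X ` V0). qle G q p" if p: "p \<in> N" for p
  proof -
    obtain q where q: "q \<in> X (v p)" "\<And>i. i \<in> G <+> (UNIV :: 'x set) \<Longrightarrow> \<mu> q i \<le> \<mu> p i"
      using X3[OF p refl] by blast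
    have qN: "q \<in> N" "v q = v p" using subsetD[OF X(2) q(1)] by simp_all
    have M: "M q \<subseteq># M p"
    proof (rule mset_subset_eqI)
      fix g show "count (M q) g \<le> count (M p) g"
      proof (cases "g \<in> G")
        case True then show ?thesis using q(2)[of "Inl g"] by (auto simp: \<mu>_def)
      next
        case False
        then have "g \<notin># M q" using vMm(3)[OF qN(1)] by blast
        then show ?thesis by (simp add: not_in_iff)
      qed
    qed
    have "mle (m q) (m p)" unfolding mle_def
    proof
      fix x show "lookup (m q) x \<le> lookup (m p) x" using q(2)[of "Inr x"] by (auto simp: \<mu>_def)
    qed
    then obtain m' where m': "m p = m q + m'" by (auto simp: mle_iff)
    obtain M' where M': "M p = M q + M'" using M by (auto simp: mset_subset_eq_exists_conv)
    have "size (M p) = size (M q) + size M'" by (simp add: M')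
    then have sz: "size M' = snd p - snd q" "snd q \<le> snd p"
      using vMm(2,4)[OF p] vMm(2,4)[OF qN(1)] qN(2) by auto
    have "set_mset M' \<subseteq> G" using vMm(3)[OF p] M' by auto
    then have "sum_mset M' \<in> nsums G (snd p - snd q)" using sz by (auto simp: nsums_def)
    moreover have "fst p = fst q + sum_mset M' + m'"
      using vMm(5)[OF p] vMm(5)[OF qN(1)] qN(2) M' m' by (simp add: algebra_simps)
    ultimately have "qle G q p" using sz(2) unfolding qle_def by blast
    then show ?thesis using q(1) vMm(1)[OF p] by blast
  qed
  moreover have "finite (\<Union>(X ` V0))" using X(1) V0 by (intro finite_UN_I)
  moreover have "\<Union>(X ` V0) \<subseteq> N" using X(2) by (intro UN_least) blast
  ultimately show ?thesis by blast
qed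


section \<open>Ideals and monomial ideals\<close>

lemma module_times: "module ((*) :: 'a::comm_ring_1 \<Rightarrow> 'a \<Rightarrow> 'a)"
  by unfold_locales (auto simp: algebra_simps)

lemma is_ideal_iff:
  "is_ideal J \<longleftrightarrow> 0 \<in> J \<and> (\<forall>f\<in>J. \<forall>g\<in>J. f + g \<in> J) \<and> (\<forall>r. \<forall>f\<in>J. r * f \<in> J)"
  by (simp add: module.subspace_def[OF module_times])

lemma ideal_0: "is_ideal J \<Longrightarrow> 0 \<in> J"
  and ideal_add: "is_ideal J \<Longrightarrow> f \<in> J \<Longrightarrow> g \<in> J \<Longrightarrow> f + g \<in> J"
  and ideal_mult_left: "is_ideal J \<Longrightarrow> f \<in> J \<Longrightarrow> r * f \<in> J"
  by (simp_all add: is_ideal_iff)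

lemma ideal_mult_right: "is_ideal J \<Longrightarrow> f \<in> J \<Longrightarrow> f * r \<in> J"
  using ideal_mult_left[of J f r] by (simp add: mult.commute)

lemma ideal_uminus: "is_ideal J \<Longrightarrow> f \<in> J \<Longrightarrow> - f \<in> J"
  using ideal_mult_left[of J f "-1"] by simp

lemma ideal_diff: "is_ideal J \<Longrightarrow> f \<in> J \<Longrightarrow> g \<in> J \<Longrightarrow> f - g \<in> J"
  using ideal_add[of J f "- g"] ideal_uminus[of J g] by simp

lemma ideal_sum: "is_ideal J \<Longrightarrow> (\<And>x. x \<in> A \<Longrightarrow> f x \<in> J) \<Longrightarrow> sum f A \<in> J"
  by (induction A rule: infinite_finite_induct) (auto simp: ideal_0 ideal_add)

lemma is_ideal_ideal_gen: "is_ideal (ideal_gen A)"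
  by (rule module.subspace_span[OF module_times])

lemma ideal_gen_superset: "A \<subseteq> ideal_gen A"
  by (rule module.span_superset[OF module_times])

lemma ideal_gen_minimal: "A \<subseteq> L \<Longrightarrow> is_ideal L \<Longrightarrow> ideal_gen A \<subseteq> L"
  by (rule module.span_minimal[OF module_times])

lemma ideal_eq_UNIV_iff: "is_ideal J \<Longrightarrow> J = UNIV \<longleftrightarrow> 1 \<in> J"
  using ideal_mult_left[of J 1] by auto

section \<open>Monomial ideals as sets of exponents\<close>

definition upset :: "'x mon set \<Rightarrow> bool" where
  "upset U \<longleftrightarrow> (\<forall>a\<in>U. \<forall>m. a + m \<in> U)"

definition upclosure :: "'x mon set \<Rightarrow> 'x mon set" where
  "upclosure A = {a + m | a m. a \<in> A}"

text \<open>For arbitrary \<open>U\<close> this is just the span of the monomials in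
  \<open>U\<close>; it is an ideal as soon as \<open>U\<close> is an upset.\<close>

definition mideal :: "'x mon set \<Rightarrow> ('x, 'k::field) mpol set" where
  "mideal U = {f. keys f \<subseteq> U}"

lemma upsetD: "upset U \<Longrightarrow> a \<in> U \<Longrightarrow> a + m \<in> U"
  by (simp add: upset_def)

lemma upclosureI: "a \<in> A \<Longrightarrow> a + m \<in> upclosure A"
  by (auto simp: upclosure_def)

lemma upclosure_superset: "a \<in> A \<Longrightarrow> a \<in> upclosure A"
  using upclosureI[of a A 0] by simp

lemma upset_upclosure [simp]: "upset (upclosure A)"
proof (unfold upset_def, intro ballI allI)
  fix b m assume "b \<in> upclosure A"
  then obtain a n where "b = a + n" "a \<in> A" by (auto simp: upclosure_def)
  then show "b + m \<in> upclosure A" using upclosureI[of a A "n + m"] by (simp add: add.assoc)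
qed

lemma xpow_mult: "xpow a * xpow b = xpow (a + b)"
  by (simp add: xpow_def mult_single)

lemma keys_xpow [simp]: "keys (xpow a :: ('x, 'k::field) mpol) = {a}"
  by (simp add: xpow_def)

lemma xpow_in_mideal [simp]: "xpow a \<in> (mideal U :: ('x, 'k::field) mpol set) \<longleftrightarrow> a \<in> U"
  by (simp add: mideal_def)

lemma keys_times_subset: "keys (f * g) \<subseteq> {a + b | a b. a \<in> keys f \<and> b \<in> keys g}"
  by (rule keys_mult)

lemma is_ideal_mideal:
  assumes "upset U" shows "is_ideal (mideal U :: ('x, 'k::field) mpol set)"
proof -
  have "keys (f + g) \<subseteq> U" if "keys f \<subseteq> U" "keys g \<subseteq> U" for f g :: "('x, 'k) mpol"
    using that keys_add[of f g] by blast
  moreover have "keys (r * f) \<subseteq> U" if "keys f \<subseteq> U" for r f :: "('x, 'k) mpol"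
    using that keys_times_subset[of r f] upsetD[OF assms] by (fastforce simp: add.commute)
  ultimately show ?thesis by (simp add: is_ideal_iff mideal_def)
qed

lemma single_eq_xpow: "single m c = single 0 c * xpow m"
  by (simp add: xpow_def mult_single)

lemma mideal_subset_ideal:
  fixes L :: "('x, 'k::field) mpol set"
  assumes "is_ideal L" "\<And>a. a \<in> U \<Longrightarrow> xpow a \<in> L"
  shows "mideal U \<subseteq> L"
proof
  fix f :: "('x, 'k) mpol" assume f: "f \<in> mideal U"
  have "(\<Sum>m\<in>keys f. single m (lookup f m)) \<in> L"
  proof (rule ideal_sum[OF assms(1)])
    fix m assume "m \<in> keys f"
    then show "single m (lookup f m) \<in> L"
      using f assms unfolding single_eq_xpow[of m] by (auto simp: mideal_def intro: ideal_mult_left)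
  qed
  then show "f \<in> L" using pm_expand[of f] by simp
qed

lemma ideal_gen_xpow: "ideal_gen (xpow ` A) = (mideal (upclosure A) :: ('x, 'k::field) mpol set)"
proof
  show "ideal_gen (xpow ` A) \<subseteq> (mideal (upclosure A) :: ('x, 'k) mpol set)"
    by (intro ideal_gen_minimal is_ideal_mideal) (auto simp: upclosure_superset)
  show "mideal (upclosure A) \<subseteq> (ideal_gen (xpow ` A) :: ('x, 'k) mpol set)"
  proof (rule mideal_subset_ideal[OF is_ideal_ideal_gen])
    fix b assume "b \<in> upclosure A"
    then obtain a m where "b = a + m" "a \<in> A" by (auto simp: upclosure_def)
    then have "xpow b = xpow m * (xpow a :: ('x, 'k) mpol)" "xpow a \<in> (ideal_gen (xpow ` A) :: ('x, 'k) mpol set)"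
      using ideal_gen_superset[of "xpow ` A"] by (auto simp: xpow_mult add.commute)
    then show "xpow b \<in> (ideal_gen (xpow ` A) :: ('x, 'k) mpol set)"
      by (simp add: ideal_mult_left[OF is_ideal_ideal_gen])
  qed
qed

lemma ideal_mult_mideal:
  assumes "upset U" "upset V"
  shows "ideal_mult (mideal U) (mideal V) = (mideal {u + v | u v. u \<in> U \<and> v \<in> V} :: ('x, 'k::field) mpol set)"
    (is "?L = mideal ?W")
proof
  have W: "upset ?W" using assms by (auto simp: upset_def add.assoc) blast
  show "?L \<subseteq> mideal ?W" unfolding ideal_mult_def
  proof (rule ideal_gen_minimal[OF _ is_ideal_mideal[OF W]], clarify)
    fix f g :: "('x, 'k) mpol" assume "f \<in> mideal U" "g \<in> mideal V"
    then show "f * g \<in> mideal ?W"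
      using keys_times_subset[of f g] unfolding mideal_def by blast
  qed
  show "mideal ?W \<subseteq> ?L"
  proof (rule mideal_subset_ideal)
    show "is_ideal ?L" unfolding ideal_mult_def by (rule is_ideal_ideal_gen)
    fix a assume "a \<in> ?W"
    then obtain u v where "a = u + v" "u \<in> U" "v \<in> V" by auto
    then have "xpow a \<in> {f * g | f g. f \<in> mideal U \<and> g \<in> (mideal V :: ('x, 'k) mpol set)}"
      by (intro CollectI exI[of _ "xpow u"] exI[of _ "xpow v"]) (simp add: xpow_mult)
    then show "xpow a \<in> ?L" unfolding ideal_mult_def by (rule subsetD[OF ideal_gen_superset])
  qed
qed

text \<open>The exponents of the ideal \<open>I\<^sup>l J\<close>, where \<open>I\<close> and \<open>J\<close> are generated by \<open>x\<^sup>g\<close>, \<open>g \<in> G\<close>, and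
  \<open>x\<^sup>b\<close>, \<open>b \<in> B\<close>.\<close>

definition rees :: "'x mon set \<Rightarrow> 'x mon set \<Rightarrow> nat \<Rightarrow> 'x mon set" where
  "rees G B l = {s + b + m | s b m. s \<in> nsums G l \<and> b \<in> B}"

lemma reesI: "s \<in> nsums G l \<Longrightarrow> b \<in> B \<Longrightarrow> s + b + m \<in> rees G B l"
  by (auto simp: rees_def)

lemma upset_rees [simp]: "upset (rees G B l)"
  unfolding upset_def rees_def by (force simp: add.assoc)

text \<open>Closure under the Rees algebra: multiplying by \<open>k - l\<close> generators of
  \<open>I\<close> and any monomial leads from \<open>I\<^sup>l J\<close> to
  \<open>I\<^sup>k J\<close>.\<close>

lemma rees_qle: "a \<in> rees G B l \<Longrightarrow> qle G (a, l) (c, k) \<Longrightarrow> c \<in> rees G B k"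
proof -
  assume "a \<in> rees G B l" "qle G (a, l) (c, k)"
  then obtain s b m t m' where a: "a = s + b + m" "s \<in> nsums G l" "b \<in> B"
    and c: "l \<le> k" "t \<in> nsums G (k - l)" "c = a + t + m'"
    by (auto simp: rees_def qle_def)
  have "s + t \<in> nsums G k" using nsums_add[OF a(2) c(2)] c(1) by simp
  moreover have "c = (s + t) + b + (m + m')" using a c by (simp add: algebra_simps)
  ultimately show ?thesis unfolding rees_def using a(3) by blast
qed

lemma rees_Suc: "rees G B (Suc l) = {u + v | u v. u \<in> upclosure G \<and> v \<in> rees G B l}"
proof (intro equalityI subsetI)
  fix a assume "a \<in> rees G B (Suc l)"
  then obtain g s b m where "a = (g + s) + b + m" "g \<in> G" "s \<in> nsums G l" "b \<in> B"
    by (auto simp: rees_def nsums_Suc)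
  then have "a = g + (s + b + m)" "g \<in> upclosure G" "s + b + m \<in> rees G B l"
    using upclosure_superset[of g G] reesI[of s G l b B m] by (simp_all add: ac_simps)
  then show "a \<in> {u + v | u v. u \<in> upclosure G \<and> v \<in> rees G B l}" by blast
next
  fix a assume "a \<in> {u + v | u v. u \<in> upclosure G \<and> v \<in> rees G B l}"
  then obtain u v where uv: "a = u + v" "u \<in> upclosure G" "v \<in> rees G B l" by blast
  obtain g n where u: "u = g + n" "g \<in> G" using uv(2) unfolding upclosure_def by blast
  obtain s b m where v: "v = s + b + m" "s \<in> nsums G l" "b \<in> B" using uv(3) unfolding rees_def by blast
  have "g + s \<in> nsums G (Suc l)" using u(2) v(2) unfolding nsums_Suc by blast
  moreover have "a = (g + s) + b + (n + m)" using uv(1) u(1) v(1) by (simp only: ac_simps)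
  ultimately show "a \<in> rees G B (Suc l)" using v(3) reesI by blast
qed

text \<open>The choice \<open>B = {0}\<close> stands for \<open>J = S\<close>. It is consistent with
  \<open>ideal_pow\<close> at \<open>k = 0\<close>, where the power is the whole ring.\<close>

lemma ideal_pow_mideal:
  "ideal_pow (mideal (upclosure G)) k = (mideal (rees G {0} k) :: ('x, 'k::field) mpol set)"
proof (induction k)
  case 0
  have "rees G {0} 0 = UNIV" by (auto simp: rees_def)
  then show ?case by (auto simp: mideal_def)
next
  case (Suc k)
  then show ?case by (simp add: ideal_mult_mideal rees_Suc)
qed

lemma HS_eq_mideal:
  "HS i J = (mideal (upclosure {a. tor_multi_nonzero i J a}) :: ('x::finite, 'k::field) mpol set)"
  unfolding HS_def ideal_gen_xpow[symmetric] by (rule arg_cong[where f = ideal_gen]) auto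

lemma monomial_ideal_finite_gens:
  fixes J :: "('x::finite, 'k::field) mpol set"
  assumes "monomial_ideal J"
  shows "\<exists>G. finite G \<and> J = mideal (upclosure G)"
proof -
  obtain A where A: "J = mideal (upclosure A)"
    using assms by (auto simp: monomial_ideal_def ideal_gen_xpow)
  obtain G where G: "finite G" "G \<subseteq> A" "\<And>a. a \<in> A \<Longrightarrow> \<exists>g\<in>G. mle g a"
    using dickson[of "UNIV :: 'x set" A lookup, OF finite_UNIV]
    by (elim exE conjE) (simp add: mle_def)
  have "upclosure A \<subseteq> upclosure G"
  proof
    fix b assume "b \<in> upclosure A"
    then obtain a m where "b = a + m" "a \<in> A" by (auto simp: upclosure_def)
    moreover from this obtain g n where "g \<in> G" "a = g + n" using G(3)[of a] by (auto simp: mle_iff)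
    ultimately show "b \<in> upclosure G" by (auto simp: upclosure_def add.assoc)
  qed
  moreover have "upclosure G \<subseteq> upclosure A" using G(2) by (auto simp: upclosure_def)
  ultimately have "upclosure A = upclosure G" by simp
  then show ?thesis using A G(1) by auto
qed


section \<open>Independence of Tor of the resolution\<close>

definition vin :: "('x, 'k::field) mpol set \<Rightarrow> ('x, 'k) fvec \<Rightarrow> bool" where
  "vin L v \<longleftrightarrow> (\<forall>b. lookup v b \<in> L)"

definition fgen :: "nat \<Rightarrow> ('x, 'k::field) fvec" where
  "fgen b = single b 1"

definition lin :: "(nat \<Rightarrow> ('x, 'k::field) fvec) \<Rightarrow> ('x, 'k) fvec \<Rightarrow> ('x, 'k) fvec" where
  "lin M v = (\<Sum>b\<in>keys v. vscale (lookup v b) (M b))"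

lemma vscale_0_left [simp]: "vscale 0 v = 0"
  by (rule poly_mapping_eqI) (simp add: lookup_vscale)

lemma vscale_0_right [simp]: "vscale f 0 = 0"
  by (rule poly_mapping_eqI) (simp add: lookup_vscale)

lemma vscale_1 [simp]: "vscale 1 v = v"
  by (rule poly_mapping_eqI) (simp add: lookup_vscale)

lemma vscale_add_left: "vscale (f + g) v = vscale f v + vscale g v"
  by (rule poly_mapping_eqI) (simp add: lookup_vscale lookup_add algebra_simps)

lemma vscale_add_right: "vscale f (v + w) = vscale f v + vscale f w"
  by (rule poly_mapping_eqI) (simp add: lookup_vscale lookup_add algebra_simps)

lemma vscale_diff_right: "vscale f (v - w) = vscale f v - vscale f w"
  by (rule poly_mapping_eqI) (simp add: lookup_vscale lookup_minus algebra_simps)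

lemma vscale_vscale: "vscale f (vscale g v) = vscale (f * g) v"
  by (rule poly_mapping_eqI) (simp add: lookup_vscale algebra_simps)

lemma vscale_sum_right: "vscale f (sum g A) = (\<Sum>x\<in>A. vscale f (g x))"
  by (induction A rule: infinite_finite_induct) (auto simp: vscale_add_right)

definition shom :: "(('x, 'k::field) fvec \<Rightarrow> ('x, 'k) fvec) \<Rightarrow> bool" where
  "shom f \<longleftrightarrow> (\<forall>v w. f (v + w) = f v + f w) \<and> (\<forall>r v. f (vscale r v) = vscale r (f v))"

lemma shom_iff: "module_hom vscale vscale f \<longleftrightarrow> shom f"
proof
  assume "module_hom vscale vscale f"
  then interpret module_hom vscale vscale f .
  show "shom f" by (simp add: shom_def add scale)
next
  assume "shom f"
  interpret module "vscale :: ('a, 'b) mpol \<Rightarrow> _" by (rule module_vscale)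
  show "module_hom vscale vscale f"
    using \<open>shom f\<close> by unfold_locales (auto simp: shom_def)
qed

lemma shom_add: "shom f \<Longrightarrow> f (v + w) = f v + f w"
  and shom_vscale: "shom f \<Longrightarrow> f (vscale r v) = vscale r (f v)"
  by (simp_all add: shom_def)

lemma shom_0: "shom f \<Longrightarrow> f 0 = 0"
  using shom_vscale[of f 0 0] by simp

lemma shom_comp: "shom f \<Longrightarrow> shom g \<Longrightarrow> shom (\<lambda>v. f (g v))"
  by (simp add: shom_def)

lemma shom_plus: "shom f \<Longrightarrow> shom g \<Longrightarrow> shom (\<lambda>v. f v + g v)"
  by (simp add: shom_def vscale_add_right)

lemma shom_diff: "shom f \<Longrightarrow> f (v - w) = f v - f w"
  using shom_add[of f "v - w" w] by simp

lemma shom_sum: "shom f \<Longrightarrow> f (sum g A) = (\<Sum>x\<in>A. f (g x))"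
  by (induction A rule: infinite_finite_induct) (auto simp: shom_0 shom_add)

lemma fvec_expand: "v = (\<Sum>b\<in>keys v. vscale (lookup v b) (fgen b))"
proof -
  have "vscale p (fgen b) = single b p" for p :: "('a, 'b) mpol" and b
    by (rule poly_mapping_eqI) (simp add: lookup_vscale fgen_def lookup_single when_def)
  then show ?thesis using pm_expand[of v] by simp
qed

lemma shom_expand: "shom f \<Longrightarrow> f v = (\<Sum>b\<in>keys v. vscale (lookup v b) (f (fgen b)))"
  by (subst fvec_expand[of v]) (simp only: shom_sum shom_vscale)

lemma shom_lin [simp]: "shom (lin M)"
  unfolding shom_def
proof (intro conjI allI)
  fix v w r
  show "lin M (v + w) = lin M v + lin M w" unfolding lin_def
    by (rule setsum_keys_plus_distrib) (auto simp: vscale_add_left)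
  have "lin M (vscale r v) = (\<Sum>b\<in>keys v. vscale (lookup (vscale r v) b) (M b))"
    unfolding lin_def by (rule sum.mono_neutral_left) (auto simp: in_keys_iff lookup_vscale)
  then show "lin M (vscale r v) = vscale r (lin M v)"
    by (simp add: lin_def lookup_vscale vscale_sum_right vscale_vscale)
qed

lemma keys_fgen [simp]: "keys (fgen b) = {b}"
  by (simp add: fgen_def)

lemma lin_fgen [simp]: "lin M (fgen b) = M b"
  by (simp add: lin_def) (simp add: fgen_def)

lemma vin_sum: "is_ideal L \<Longrightarrow> (\<And>x. x \<in> A \<Longrightarrow> vin L (f x)) \<Longrightarrow> vin L (sum f A)"
  by (simp add: vin_def lookup_sum ideal_sum)

lemma vin_0: "is_ideal L \<Longrightarrow> vin L 0"
  by (simp add: vin_def ideal_0)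

lemma vin_add: "is_ideal L \<Longrightarrow> vin L v \<Longrightarrow> vin L w \<Longrightarrow> vin L (v + w)"
  by (simp add: vin_def lookup_add ideal_add)

lemma vin_diff: "is_ideal L \<Longrightarrow> vin L v \<Longrightarrow> vin L w \<Longrightarrow> vin L (v - w)"
  by (simp add: vin_def lookup_minus ideal_diff)

lemma vin_vscale: "is_ideal L \<Longrightarrow> vin L v \<Longrightarrow> vin L (vscale r v)"
  by (simp add: vin_def lookup_vscale ideal_mult_left)

text \<open>The coefficients of the image are combinations of those of \<open>v\<close>. Hence every
  \<open>S\<close>-linear map, homotopies included, acts on complexes tensored with an
  ideal.\<close>

lemma shom_vin:
  assumes "shom f" "is_ideal L" "vin L v"
  shows "vin L (f v)"
  unfolding shom_expand[OF assms(1), of v]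
  using assms by (intro vin_sum) (auto simp: vin_def lookup_vscale ideal_mult_right)

lemma fmod_sum: "(\<And>x. x \<in> A \<Longrightarrow> f x \<in> fmod F i) \<Longrightarrow> sum f A \<in> fmod F i"
  by (induction A rule: infinite_finite_induct) (auto intro: fmod_closed)

lemma fmod_vscale: "v \<in> fmod F i \<Longrightarrow> vscale r v \<in> fmod F i"
proof -
  assume v: "v \<in> fmod F i"
  have "keys (vscale r v) \<subseteq> keys v" by (auto simp: in_keys_iff lookup_vscale)
  then show ?thesis using v by (auto simp: fmod_def)
qed

lemma fmod_diff: "v \<in> fmod F i \<Longrightarrow> w \<in> fmod F i \<Longrightarrow> v - w \<in> fmod F i"
  using keys_diff[of v w] by (auto simp: fmod_def)

lemma fgen_fmod: "b \<in> basis F i \<Longrightarrow> fgen b \<in> fmod F i"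
  by (simp add: fmod_def)

lemma fgen_mhom: "fgen b \<in> mhom F i (shift F i b)"
  by (auto simp: mhom_def fgen_def)

lemma shom_fmod:
  assumes "shom f" "\<And>b. b \<in> basis F i \<Longrightarrow> f (fgen b) \<in> fmod G j" "v \<in> fmod F i"
  shows "f v \<in> fmod G j"
  unfolding shom_expand[OF assms(1), of v]
  using assms by (intro fmod_sum fmod_vscale assms(2)) (auto simp: fmod_def)

lemma shom_eqI:
  assumes "shom f" "shom g" "\<And>b. b \<in> basis F i \<Longrightarrow> f (fgen b) = g (fgen b)" "v \<in> fmod F i"
  shows "f v = g v"
  unfolding shom_expand[OF assms(1), of v] shom_expand[OF assms(2), of v]
  using assms(3,4) by (intro sum.cong) (auto simp: fmod_def)

section \<open>Multigraded components\<close>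

text \<open>One notion for both gradings: \<open>D\<close> is a single multidegree for
  \<open>mhom\<close> and the set of all multidegrees of a given total degree for
  \<open>thom\<close>.\<close>

definition vh :: "('x, 'k::field, 'z) fcomplex_scheme \<Rightarrow> nat \<Rightarrow> 'x mon set \<Rightarrow> ('x, 'k) fvec set" where
  "vh F i D = {v. \<forall>b m. lookup (lookup v b) m \<noteq> 0 \<longrightarrow> m + shift F i b \<in> D}"

lemma mhom_eq_vh: "mhom F i a = vh F i {a}"
  unfolding mhom_def vh_def by (fastforce simp: in_keys_iff)

lemma thom_eq_vh: "thom F i j = vh F i {a. mdeg a = j}"
  unfolding thom_def vh_def by (fastforce simp: in_keys_iff)

lemma vh_sum: "(\<And>x. x \<in> A \<Longrightarrow> f x \<in> vh F i D) \<Longrightarrow> sum f A \<in> vh F i D"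
  unfolding vh_def lookup_sum mem_Collect_eq by (meson sum.neutral)

lemma shom_vh:
  assumes "shom f" "\<And>b. b \<in> basis F i \<Longrightarrow> f (fgen b) \<in> mhom G j (shift F i b)"
    and v: "v \<in> fmod F i" "v \<in> vh F i D"
  shows "f v \<in> vh G j D"
  unfolding shom_expand[OF assms(1), of v]
proof (rule vh_sum)
  fix b assume b: "b \<in> keys v"
  then have "f (fgen b) \<in> mhom G j (shift F i b)" using assms(2) v(1) by (auto simp: fmod_def)
  then have h: "m + shift G j c = shift F i b" if "m \<in> keys (lookup (f (fgen b)) c)" for c m
    using that by (auto simp: mhom_eq_vh vh_def in_keys_iff)
  show "vscale (lookup v b) (f (fgen b)) \<in> vh G j D"
    unfolding vh_def mem_Collect_eq
  proof (intro allI impI)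
    fix c m assume "lookup (lookup (vscale (lookup v b) (f (fgen b))) c) m \<noteq> 0"
    then have "m \<in> keys (lookup v b * lookup (f (fgen b)) c)" by (simp add: in_keys_iff lookup_vscale)
    then obtain m1 m2 where m: "m = m1 + m2" "m1 \<in> keys (lookup v b)" "m2 \<in> keys (lookup (f (fgen b)) c)"
      using keys_times_subset by blast
    have "m1 + shift F i b \<in> D" using v(2) m(2) by (auto simp: vh_def in_keys_iff)
    then show "m + shift G j c \<in> D" using h[OF m(3)] m(1) by (simp add: add.assoc)
  qed
qed

definition pfilter :: "('a \<Rightarrow> bool) \<Rightarrow> ('a \<Rightarrow>\<^sub>0 'b::comm_monoid_add) \<Rightarrow> ('a \<Rightarrow>\<^sub>0 'b)" where
  "pfilter P p = (\<Sum>m\<in>keys p. if P m then single m (lookup p m) else 0)"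

lemma lookup_pfilter: "lookup (pfilter P p) m = (if P m then lookup p m else 0)"
proof -
  have "lookup (pfilter P p) m = (\<Sum>n\<in>keys p. if n = m then (if P m then lookup p m else 0) else 0)"
    unfolding pfilter_def lookup_sum by (rule sum.cong) (auto simp: lookup_single)
  then show ?thesis by (simp add: in_keys_iff)
qed

definition hpart :: "('x, 'k::field, 'z) fcomplex_scheme \<Rightarrow> nat \<Rightarrow> 'x mon \<Rightarrow> ('x, 'k) fvec \<Rightarrow> ('x, 'k) fvec" where
  "hpart F i a v = (\<Sum>b\<in>keys v. single b (pfilter (\<lambda>m. m + shift F i b = a) (lookup v b)))"

lemma lookup_hpart:
  "lookup (lookup (hpart F i a v) b) m = (if m + shift F i b = a then lookup (lookup v b) m else 0)"
proof -
  have "lookup (hpart F i a v) b = (\<Sum>c\<in>keys v. if c = b then pfilter (\<lambda>m. m + shift F i b = a) (lookup v b) else 0)"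
    unfolding hpart_def lookup_sum by (rule sum.cong) (auto simp: lookup_single)
  also have "\<dots> = pfilter (\<lambda>m. m + shift F i b = a) (lookup v b)"
    by (auto simp: in_keys_iff pfilter_def)
  finally show ?thesis by (simp add: lookup_pfilter)
qed

lemma fvec_eqI:
  fixes v w :: "('x, 'k::field) fvec"
  assumes "\<And>b m. lookup (lookup v b) m = lookup (lookup w b) m" shows "v = w"
  by (intro poly_mapping_eqI assms)

lemma hpart_add: "hpart F i a (v + w) = hpart F i a v + hpart F i a w"
  by (rule fvec_eqI) (simp add: lookup_hpart lookup_add)

lemma hpart_0: "hpart F i a 0 = 0"
  by (rule fvec_eqI) (simp add: lookup_hpart)

lemma hpart_sum: "hpart F i a (sum f A) = (\<Sum>x\<in>A. hpart F i a (f x))"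
  by (induction A rule: infinite_finite_induct) (auto simp: hpart_add hpart_0)

lemma hpart_fmod: "v \<in> fmod F i \<Longrightarrow> hpart F j a v \<in> fmod F i"
proof -
  assume v: "v \<in> fmod F i"
  have "lookup v b = 0 \<Longrightarrow> lookup (hpart F j a v) b = 0" for b
    by (rule poly_mapping_eqI) (simp add: lookup_hpart)
  then have "keys (hpart F j a v) \<subseteq> keys v" by (auto simp: in_keys_iff)
  then show ?thesis using v by (simp add: fmod_def)
qed

lemma hpart_mhom: "hpart F i a v \<in> mhom F i a"
  by (auto simp: mhom_eq_vh vh_def lookup_hpart)

lemma hpart_of_mhom: "w \<in> mhom F i a' \<Longrightarrow> hpart F i a w = (if a = a' then w else 0)"
  by (rule fvec_eqI) (auto simp: lookup_hpart mhom_eq_vh vh_def)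

lemma hpart_decomp: "\<exists>D. finite D \<and> (\<forall>a. a \<notin> D \<longrightarrow> hpart F i a v = 0) \<and> v = (\<Sum>a\<in>D. hpart F i a v)"
proof -
  define D where "D = (\<Union>b\<in>keys v. (\<lambda>m. m + shift F i b) ` keys (lookup v b))"
  have fin: "finite D" by (simp add: D_def)
  have D: "lookup (lookup v b) m \<noteq> 0 \<Longrightarrow> m + shift F i b \<in> D" for b m
    unfolding D_def by (rule UN_I[of b]) (auto simp: in_keys_iff)
  have "hpart F i a v = 0" if "a \<notin> D" for a
    using D that by (intro fvec_eqI) (auto simp: lookup_hpart)
  moreover have "v = (\<Sum>a\<in>D. hpart F i a v)"
    using D fin by (intro fvec_eqI) (auto simp: lookup_hpart lookup_sum)
  ultimately show ?thesis using fin by blast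
qed

text \<open>A graded map sends the other components of \<open>w\<close> to other degrees, so they
  cannot contribute. This makes preimages of homogeneous elements homogeneous.\<close>

lemma shom_hpart:
  assumes f: "shom f" and hom: "\<And>a v. v \<in> fmod F i \<Longrightarrow> v \<in> mhom F i a \<Longrightarrow> f v \<in> mhom G j a"
    and w: "w \<in> fmod F i" "f w \<in> mhom G j a"
  shows "f (hpart F i a w) = f w"
proof -
  obtain D where D: "finite D" "\<And>c. c \<notin> D \<Longrightarrow> hpart F i c w = 0" "w = (\<Sum>c\<in>D. hpart F i c w)"
    using hpart_decomp[of F i w] by blast
  have "f w = hpart G j a (f w)" using hpart_of_mhom[OF w(2), of a] by simp
  also have "\<dots> = hpart G j a (\<Sum>c\<in>D. f (hpart F i c w))" by (subst D(3)) (simp only: shom_sum[OF f])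
  also have "\<dots> = (\<Sum>c\<in>D. if c = a then f (hpart F i a w) else 0)"
    unfolding hpart_sum
    by (intro sum.cong refl)
      (auto simp: hpart_of_mhom[OF hom[OF hpart_fmod[OF w(1)] hpart_mhom]])
  also have "\<dots> = f (hpart F i a w)" using D(1,2) shom_0[OF f] by auto
  finally show ?thesis ..
qed

section \<open>Exactness, comparison maps and homotopies\<close>

text \<open>At position 0 the augmentation takes the role of the differential, so that exactness has
  the same form at every position (\<open>zcyc_iff\<close>).\<close>

definition zcyc :: "('x, 'k::field, 'z) fcomplex_scheme \<Rightarrow> nat \<Rightarrow> ('x, 'k) fvec \<Rightarrow> bool" where
  "zcyc F i v \<longleftrightarrow> v \<in> fmod F i \<and> (case i of 0 \<Rightarrow> aug F v = 0 | Suc j \<Rightarrow> diff F j v = 0)"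

locale kres =
  fixes F :: "('x::finite, 'k::field) fcomplex"
  assumes res: "free_resolution_K F"
begin

lemma shom_d: "shom (diff F i)"
  using res unfolding free_resolution_K_def shom_iff by (elim conjE) (erule spec)

lemma d_fmod:
  assumes "v \<in> fmod F (Suc i)" shows "diff F i v \<in> fmod F i"
proof -
  have "\<forall>i. diff F i ` fmod F (Suc i) \<subseteq> fmod F i"
    using res unfolding free_resolution_K_def by (elim conjE)
  then show ?thesis using assms by blast
qed

lemma d_mhom:
  assumes "v \<in> fmod F (Suc i)" "v \<in> mhom F (Suc i) a" shows "diff F i v \<in> mhom F i a"
proof -
  have "\<forall>i a. diff F i ` (fmod F (Suc i) \<inter> mhom F (Suc i) a) \<subseteq> mhom F i a"
    using res unfolding free_resolution_K_def by (elim conjE)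
  then show ?thesis using assms by blast
qed

lemma zcyc_iff: "zcyc F i v \<longleftrightarrow> v \<in> diff F i ` fmod F (Suc i)"
proof (cases i)
  case 0
  have "{v \<in> fmod F 0. aug F v = 0} = diff F 0 ` fmod F (Suc 0)"
    using res unfolding free_resolution_K_def One_nat_def by (elim conjE)
  then show ?thesis using 0 by (auto simp: zcyc_def)
next
  case (Suc j)
  have "{v \<in> fmod F (Suc j). diff F j v = 0} = diff F (Suc j) ` fmod F (Suc (Suc j))"
    using res unfolding free_resolution_K_def by (elim conjE) (erule spec)
  then show ?thesis using Suc by (auto simp: zcyc_def)
qed

lemma aug_hom: "module_hom vscale kscale (aug F)"
  using res unfolding free_resolution_K_def by (elim conjE)

lemma aug_add: "aug F (v + w) = aug F v + aug F w"
  and aug_vscale: "aug F (vscale r v) = kscale r (aug F v)"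
  using aug_hom by (simp_all add: module_hom.add module_hom.scale)

lemma aug_0: "aug F 0 = 0"
proof -
  have "aug F 0 + aug F 0 = aug F 0 + 0" using aug_add[of 0 0] by simp
  then show ?thesis by (simp only: add_left_cancel)
qed

lemma aug_sum: "aug F (sum f A) = (\<Sum>x\<in>A. aug F (f x))"
  by (induction A rule: infinite_finite_induct) (auto simp: aug_add aug_0)

lemma aug_mhom:
  assumes "a \<noteq> 0" "v \<in> fmod F 0" "v \<in> mhom F 0 a" shows "aug F v = 0"
proof -
  have "\<forall>a v. a \<noteq> 0 \<longrightarrow> v \<in> fmod F 0 \<inter> mhom F 0 a \<longrightarrow> aug F v = 0"
    using res unfolding free_resolution_K_def by (elim conjE)
  then show ?thesis using assms by blast
qed

lemma zcyc_d: "v \<in> fmod F (Suc i) \<Longrightarrow> zcyc F i (diff F i v)"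
  by (simp add: zcyc_iff)

lemma zcyc_preimage:
  assumes "zcyc F i v" "v \<in> mhom F i a"
  shows "\<exists>w. w \<in> fmod F (Suc i) \<and> w \<in> mhom F (Suc i) a \<and> diff F i w = v"
proof -
  obtain w where w: "w \<in> fmod F (Suc i)" "diff F i w = v" using assms(1) by (auto simp: zcyc_iff)
  then have "diff F i (hpart F (Suc i) a w) = v"
    using shom_hpart[OF shom_d d_mhom w(1)] assms(2) by auto
  then show ?thesis using hpart_fmod[OF w(1)] hpart_mhom by blast
qed

text \<open>\<open>K\<close> is concentrated in degree 0, so all other components of a preimage are
  killed by the augmentation.\<close>

lemma aug_preimage: "\<exists>w. w \<in> fmod F 0 \<and> w \<in> mhom F 0 0 \<and> aug F w = c"
proof -
  have "aug F ` fmod F 0 = UNIV" using res unfolding free_resolution_K_def by (elim conjE)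
  then obtain w where w: "w \<in> fmod F 0" "aug F w = c" by (metis UNIV_I image_iff)
  obtain D where D: "finite D" "\<And>c. c \<notin> D \<Longrightarrow> hpart F 0 c w = 0" "w = (\<Sum>c\<in>D. hpart F 0 c w)"
    using hpart_decomp[of F 0 w] by blast
  have "aug F w = (\<Sum>c\<in>D. aug F (hpart F 0 c w))" by (subst D(3)) (rule aug_sum)
  also have "\<dots> = (\<Sum>c\<in>D. if c = 0 then aug F (hpart F 0 0 w) else 0)"
    by (intro sum.cong refl) (simp add: aug_mhom[OF _ hpart_fmod[OF w(1)] hpart_mhom])
  also have "\<dots> = aug F (hpart F 0 0 w)" using D(1,2) aug_0 by auto
  finally show ?thesis using w hpart_fmod[OF w(1)] hpart_mhom by metis
qed

end

text \<open>The identity of \<open>K\<close> is lifted one homological degree at a time: a basis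
  element goes to a preimage of the image of its boundary. Choosing homogeneous preimages makes the
  lift respect multidegrees, which is what carries degreewise vanishing from one resolution to the
  other.\<close>

lemma comparison_map:
  fixes F G :: "('x::finite, 'k::field) fcomplex"
  assumes F: "free_resolution_K F" and G: "free_resolution_K G"
  shows "\<exists>\<phi>. (\<forall>i. shom (\<phi> i)) \<and> (\<forall>i v. v \<in> fmod F i \<longrightarrow> \<phi> i v \<in> fmod G i) \<and>
     (\<forall>i v D. v \<in> fmod F i \<longrightarrow> v \<in> vh F i D \<longrightarrow> \<phi> i v \<in> vh G i D) \<and>
     (\<forall>i v. v \<in> fmod F (Suc i) \<longrightarrow> diff G i (\<phi> (Suc i) v) = \<phi> i (diff F i v)) \<and>
     (\<forall>v. v \<in> fmod F 0 \<longrightarrow> aug G (\<phi> 0 v) = aug F v)"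
proof -
  interpret F: kres F by (rule kres.intro) (rule F)
  interpret G: kres G by (rule kres.intro) (rule G)
  \<comment> \<open>That cycles go to cycles belongs to the invariant: by exactness of
    \<open>G\<close> it provides the preimages for the next degree.\<close>
  define ok where "ok i M \<longleftrightarrow> (\<forall>b\<in>basis F i. M b \<in> fmod G i \<and> M b \<in> mhom G i (shift F i b)) \<and>
      (\<forall>v. zcyc F i v \<longrightarrow> zcyc G i (lin M v)) \<and>
      (i = 0 \<longrightarrow> (\<forall>v\<in>fmod F 0. aug G (lin M v) = aug F v))" for i M
  define step where "step i M M' \<longleftrightarrow> (\<forall>v\<in>fmod F (Suc i). diff G i (lin M' v) = lin M (diff F i v))"
    for i M and M' :: "nat \<Rightarrow> ('x, 'k) fvec"
  have okD: "lin M v \<in> fmod G i" "v \<in> vh F i D \<Longrightarrow> lin M v \<in> vh G i D"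
    if "ok i M" "v \<in> fmod F i" for i M v D
  proof -
    show "lin M v \<in> fmod G i"
      using that by (intro shom_fmod[OF shom_lin _ that(2)]) (auto simp: ok_def)
    show "lin M v \<in> vh G i D" if "v \<in> vh F i D"
      using \<open>ok i M\<close> that
      by (intro shom_vh[OF shom_lin _ \<open>v \<in> fmod F i\<close>]) (auto simp: ok_def)
  qed
  have "\<exists>M. \<forall>i. ok i (M i) \<and> step i (M i) (M (Suc i))"
  proof (rule dependent_nat_choice[where P = ok and Q = step])
    have "\<exists>w. w \<in> fmod G 0 \<and> w \<in> mhom G 0 (shift F 0 b) \<and> aug G w = aug F (fgen b)"
      if b: "b \<in> basis F 0" for b
    proof (cases "shift F 0 b = 0")
      case True
      then show ?thesis using G.aug_preimage by simp
    next
      case False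
      then have "aug F (fgen b) = 0" using F.aug_mhom fgen_fmod[OF b] fgen_mhom by blast
      then show ?thesis using G.aug_0 by (intro exI[of _ 0]) (auto intro: fmod_closed mhom_closed)
    qed
    then obtain M where M: "\<And>b. b \<in> basis F 0 \<Longrightarrow> M b \<in> fmod G 0"
        "\<And>b. b \<in> basis F 0 \<Longrightarrow> M b \<in> mhom G 0 (shift F 0 b)"
        "\<And>b. b \<in> basis F 0 \<Longrightarrow> aug G (M b) = aug F (fgen b)" by metis
    have aug: "aug G (lin M v) = aug F v" if "v \<in> fmod F 0" for v
    proof -
      have "aug F v = (\<Sum>b\<in>keys v. kscale (lookup v b) (aug F (fgen b)))"
        by (subst fvec_expand[of v]) (simp only: F.aug_sum F.aug_vscale)
      moreover have "aug G (lin M v) = (\<Sum>b\<in>keys v. kscale (lookup v b) (aug G (M b)))"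
        by (simp only: lin_def G.aug_sum G.aug_vscale)
      ultimately show ?thesis using that M(3) by (auto simp: fmod_def intro!: sum.cong)
    qed
    have "lin M v \<in> fmod G 0" if "v \<in> fmod F 0" for v
      using M(1) by (intro shom_fmod[OF shom_lin _ that]) simp
    then have "ok 0 M" using M aug by (auto simp: ok_def zcyc_def)
    then show "\<exists>M. ok 0 M" by (rule exI[where x = M])
  next
    fix M i assume ok: "ok i M"
    have "\<exists>w. w \<in> fmod G (Suc i) \<and> w \<in> mhom G (Suc i) (shift F (Suc i) b) \<and>
        diff G i w = lin M (diff F i (fgen b))" if b: "b \<in> basis F (Suc i)" for b
    proof (rule G.zcyc_preimage)
      have f: "fgen b \<in> fmod F (Suc i)" "fgen b \<in> mhom F (Suc i) (shift F (Suc i) b)"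
        using b by (auto intro: fgen_fmod fgen_mhom)
      show "zcyc G i (lin M (diff F i (fgen b)))" using ok F.zcyc_d[OF f(1)] by (simp add: ok_def)
      show "lin M (diff F i (fgen b)) \<in> mhom G i (shift F (Suc i) b)"
        using okD(2)[OF ok F.d_fmod[OF f(1)]] F.d_mhom[OF f] by (simp add: mhom_eq_vh)
    qed
    then obtain M' where M': "\<And>b. b \<in> basis F (Suc i) \<Longrightarrow> M' b \<in> fmod G (Suc i)"
        "\<And>b. b \<in> basis F (Suc i) \<Longrightarrow> M' b \<in> mhom G (Suc i) (shift F (Suc i) b)"
        "\<And>b. b \<in> basis F (Suc i) \<Longrightarrow> diff G i (M' b) = lin M (diff F i (fgen b))" by metis
    have d: "diff G i (lin M' v) = lin M (diff F i v)" if "v \<in> fmod F (Suc i)" for v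
    proof (rule shom_eqI[OF _ _ _ that, where f = "\<lambda>v. diff G i (lin M' v)"
          and g = "\<lambda>v. lin M (diff F i v)"])
      show "shom (\<lambda>v. diff G i (lin M' v))" "shom (\<lambda>v. lin M (diff F i v))"
        by (rule shom_comp[OF G.shom_d shom_lin], rule shom_comp[OF shom_lin F.shom_d])
    qed (simp add: M'(3))
    have fm: "lin M' v \<in> fmod G (Suc i)" if "v \<in> fmod F (Suc i)" for v
      using M'(1) by (intro shom_fmod[OF shom_lin _ that]) simp
    have "ok (Suc i) M'"
      using M' d fm by (auto simp: ok_def zcyc_def shom_0)
    then show "\<exists>M'. ok (Suc i) M' \<and> step i M M'" using d unfolding step_def by blast
  qed
  then obtain M where M: "\<And>i. ok i (M i)" "\<And>i. step i (M i) (M (Suc i))" by blast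
  show ?thesis
    using okD[OF M(1)] M(1)[of 0] M(2)
    by (intro exI[of _ "\<lambda>i. lin (M i)"]) (auto simp: step_def ok_def)
qed

text \<open>A lift of the zero map of \<open>K\<close> is null-homotopic. It is applied to
  \<open>g f - id\<close> for two comparison maps and to multiplication by a polynomial without
  constant term. The homotopy is not asked to be graded, as that polynomial may be
  inhomogeneous.\<close>

lemma null_homotopy:
  fixes F G :: "('x::finite, 'k::field) fcomplex"
  assumes F: "free_resolution_K F" and G: "free_resolution_K G"
    and \<phi>: "\<And>i. shom (\<phi> i)" "\<And>i v. v \<in> fmod F i \<Longrightarrow> \<phi> i v \<in> fmod G i"
      "\<And>i v. v \<in> fmod F (Suc i) \<Longrightarrow> diff G i (\<phi> (Suc i) v) = \<phi> i (diff F i v)"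
      "\<And>v. v \<in> fmod F 0 \<Longrightarrow> aug G (\<phi> 0 v) = 0"
  shows "\<exists>h. (\<forall>i. shom (h i)) \<and> (\<forall>i v. v \<in> fmod F i \<longrightarrow> h i v \<in> fmod G (Suc i)) \<and>
     (\<forall>v. v \<in> fmod F 0 \<longrightarrow> \<phi> 0 v = diff G 0 (h 0 v)) \<and>
     (\<forall>i v. v \<in> fmod F (Suc i) \<longrightarrow> \<phi> (Suc i) v = diff G (Suc i) (h (Suc i) v) + h i (diff F i v))"
proof -
  interpret F: kres F by (rule kres.intro) (rule F)
  interpret G: kres G by (rule kres.intro) (rule G)
  \<comment> \<open>The second clause makes
    \<open>\<phi> (Suc i) (fgen b) - lin M (diff F i (fgen b))\<close> a cycle, hence a boundary,
    which defines the homotopy on the next basis.\<close>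
  define ok where "ok i M \<longleftrightarrow> (\<forall>b\<in>basis F i. M b \<in> fmod G (Suc i)) \<and>
      (\<forall>v. zcyc F i v \<longrightarrow> diff G i (lin M v) = \<phi> i v) \<and>
      (i = 0 \<longrightarrow> (\<forall>v\<in>fmod F 0. \<phi> 0 v = diff G 0 (lin M v)))" for i M
  define step where "step i M M' \<longleftrightarrow> (\<forall>v\<in>fmod F (Suc i).
      \<phi> (Suc i) v = diff G (Suc i) (lin M' v) + lin M (diff F i v))"
    for i M and M' :: "nat \<Rightarrow> ('x, 'k) fvec"
  have okD: "lin M v \<in> fmod G (Suc i)" if "ok i M" "v \<in> fmod F i" for i M v
    using that by (intro shom_fmod[OF shom_lin _ that(2)]) (auto simp: ok_def)
  have "\<exists>M. \<forall>i. ok i (M i) \<and> step i (M i) (M (Suc i))"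
  proof (rule dependent_nat_choice[where P = ok and Q = step])
    have "\<exists>w. w \<in> fmod G (Suc 0) \<and> diff G 0 w = \<phi> 0 (fgen b)" if b: "b \<in> basis F 0" for b
    proof -
      have "zcyc G 0 (\<phi> 0 (fgen b))" using \<phi>(2,4) fgen_fmod[OF b] by (simp add: zcyc_def)
      then show ?thesis using G.zcyc_iff by auto
    qed
    then obtain M where M: "\<And>b. b \<in> basis F 0 \<Longrightarrow> M b \<in> fmod G (Suc 0)"
        "\<And>b. b \<in> basis F 0 \<Longrightarrow> diff G 0 (M b) = \<phi> 0 (fgen b)" by metis
    have "\<phi> 0 v = diff G 0 (lin M v)" if "v \<in> fmod F 0" for v
    proof (rule shom_eqI[OF \<phi>(1) _ _ that, where g = "\<lambda>v. diff G 0 (lin M v)"])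
      show "shom (\<lambda>v. diff G 0 (lin M v))" by (rule shom_comp[OF G.shom_d shom_lin])
    qed (simp add: M(2))
    then have "ok 0 M" using M(1) by (auto simp: ok_def zcyc_def)
    then show "\<exists>M. ok 0 M" by (rule exI[where x = M])
  next
    fix M i assume ok: "ok i M"
    have "\<exists>w. w \<in> fmod G (Suc (Suc i)) \<and>
        diff G (Suc i) w = \<phi> (Suc i) (fgen b) - lin M (diff F i (fgen b))"
      if b: "b \<in> basis F (Suc i)" for b
    proof -
      have f: "fgen b \<in> fmod F (Suc i)" by (rule fgen_fmod[OF b])
      have "diff G i (lin M (diff F i (fgen b))) = \<phi> i (diff F i (fgen b))"
        using ok F.zcyc_d[OF f] by (simp add: ok_def)
      then have "zcyc G (Suc i) (\<phi> (Suc i) (fgen b) - lin M (diff F i (fgen b)))"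
        using \<phi>(2,3)[OF f] okD[OF ok F.d_fmod[OF f]]
        by (simp add: zcyc_def fmod_diff shom_diff[OF G.shom_d])
      then show ?thesis using G.zcyc_iff by auto
    qed
    then obtain M' where M': "\<And>b. b \<in> basis F (Suc i) \<Longrightarrow> M' b \<in> fmod G (Suc (Suc i))"
        "\<And>b. b \<in> basis F (Suc i) \<Longrightarrow> diff G (Suc i) (M' b) = \<phi> (Suc i) (fgen b) - lin M (diff F i (fgen b))"
      by metis
    have d: "\<phi> (Suc i) v = diff G (Suc i) (lin M' v) + lin M (diff F i v)"
      if "v \<in> fmod F (Suc i)" for v
    proof (rule shom_eqI[OF \<phi>(1) _ _ that, where g = "\<lambda>v. diff G (Suc i) (lin M' v) + lin M (diff F i v)"])
      show "shom (\<lambda>v. diff G (Suc i) (lin M' v) + lin M (diff F i v))"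
        by (intro shom_plus shom_comp[OF G.shom_d shom_lin] shom_comp[OF shom_lin F.shom_d])
    qed (simp add: M'(2))
    have "ok (Suc i) M'"
      using M'(1) d by (auto simp: ok_def zcyc_def shom_0)
    then show "\<exists>M'. ok (Suc i) M' \<and> step i M M'" using d unfolding step_def by blast
  qed
  then obtain M where M: "\<And>i. ok i (M i)" "\<And>i. step i (M i) (M (Suc i))" by blast
  show ?thesis
    using okD[OF M(1)] M(1)[of 0] M(2)
    by (intro exI[of _ "\<lambda>i. lin (M i)"]) (simp add: step_def ok_def)
qed

section \<open>Vanishing of Tor in a set of multidegrees\<close>

definition tor_vanish ::
  "('x, 'k::field, 'z) fcomplex_scheme \<Rightarrow> nat \<Rightarrow> ('x, 'k) mpol set \<Rightarrow> 'x mon set \<Rightarrow> bool" where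
  "tor_vanish F i J D \<longleftrightarrow> (\<forall>z. z \<in> fmod F i \<longrightarrow> vin J z \<longrightarrow> (\<forall>j. i = Suc j \<longrightarrow> diff F j z = 0) \<longrightarrow>
     z \<in> vh F i D \<longrightarrow> (\<exists>w. w \<in> fmod F (Suc i) \<and> vin J w \<and> diff F i w = z))"

text \<open>The cycle is pushed into \<open>G\<close>, bounded there, and the bounding vector is
  brought back; the homotopy between \<open>g f\<close> and the identity corrects the difference.
  All maps keep entries in \<open>J\<close> by \<open>shom_vin\<close>.\<close>

lemma tor_vanish_independent:
  fixes F G :: "('x::finite, 'k::field) fcomplex"
  assumes F: "free_resolution_K F" and G: "free_resolution_K G" and J: "is_ideal J"
    and van: "tor_vanish G i J D"
  shows "tor_vanish F i J D"
  unfolding tor_vanish_def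
proof (intro allI impI)
  interpret F: kres F by (rule kres.intro) (rule F)
  interpret G: kres G by (rule kres.intro) (rule G)
  fix z assume z: "z \<in> fmod F i" "vin J z" "\<forall>j. i = Suc j \<longrightarrow> diff F j z = 0" "z \<in> vh F i D"
  obtain f where f: "\<And>i. shom (f i)" "\<And>i v. v \<in> fmod F i \<Longrightarrow> f i v \<in> fmod G i"
     "\<And>i v D. v \<in> fmod F i \<Longrightarrow> v \<in> vh F i D \<Longrightarrow> f i v \<in> vh G i D"
     "\<And>i v. v \<in> fmod F (Suc i) \<Longrightarrow> diff G i (f (Suc i) v) = f i (diff F i v)"
     "\<And>v. v \<in> fmod F 0 \<Longrightarrow> aug G (f 0 v) = aug F v"
    using comparison_map[OF F G] by blast
  obtain g where g: "\<And>i. shom (g i)" "\<And>i v. v \<in> fmod G i \<Longrightarrow> g i v \<in> fmod F i"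
     "\<And>i v. v \<in> fmod G (Suc i) \<Longrightarrow> diff F i (g (Suc i) v) = g i (diff G i v)"
     "\<And>v. v \<in> fmod G 0 \<Longrightarrow> aug F (g 0 v) = aug G v"
    using comparison_map[OF G F] by blast
  have gf: "shom (\<lambda>v. g i (f i v) - v)" for i
    using f(1) g(1) by (simp add: shom_def vscale_diff_right)
  have "\<exists>h. (\<forall>i. shom (h i)) \<and> (\<forall>i v. v \<in> fmod F i \<longrightarrow> h i v \<in> fmod F (Suc i)) \<and>
     (\<forall>v. v \<in> fmod F 0 \<longrightarrow> g 0 (f 0 v) - v = diff F 0 (h 0 v)) \<and>
     (\<forall>i v. v \<in> fmod F (Suc i) \<longrightarrow> g (Suc i) (f (Suc i) v) - v = diff F (Suc i) (h (Suc i) v) + h i (diff F i v))"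
  proof (rule null_homotopy[OF F F gf])
    fix i v assume "v \<in> fmod F (Suc i)"
    then show "diff F i (g (Suc i) (f (Suc i) v) - v) = g i (f i (diff F i v)) - diff F i v"
      using f g by (simp add: shom_diff[OF F.shom_d])
  next
    fix v assume v: "v \<in> fmod F 0"
    have "aug F (g 0 (f 0 v) - v + v) = aug F (g 0 (f 0 v) - v) + aug F v" by (rule F.aug_add)
    then show "aug F (g 0 (f 0 v) - v) = 0" using f(2,5)[OF v] g(4)[OF f(2)[OF v]] by simp
  qed (use f g in \<open>auto intro: fmod_diff\<close>)
  then obtain h where h: "\<And>i. shom (h i)" "\<And>i v. v \<in> fmod F i \<Longrightarrow> h i v \<in> fmod F (Suc i)"
     "\<And>v. v \<in> fmod F 0 \<Longrightarrow> g 0 (f 0 v) - v = diff F 0 (h 0 v)"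
     "\<And>i v. v \<in> fmod F (Suc i) \<Longrightarrow> g (Suc i) (f (Suc i) v) - v = diff F (Suc i) (h (Suc i) v) + h i (diff F i v)"
    by blast
  \<comment> \<open>The homotopy term containing the boundary of \<open>z\<close> vanishes because
    \<open>z\<close> is a cycle; for \<open>i = 0\<close> there is no such term.\<close>
  have hz: "g i (f i z) - z = diff F i (h i z)"
    using z(1,3) h(3,4) shom_0[OF h(1)] by (cases i) auto
  have "\<exists>w. w \<in> fmod G (Suc i) \<and> vin J w \<and> diff G i w = f i z"
  proof -
    have "\<forall>j. i = Suc j \<longrightarrow> diff G j (f i z) = 0"
      using z(1,3) f(4) shom_0[OF f(1)] by auto
    then show ?thesis
      using van z f(2)[OF z(1)] f(3)[OF z(1,4)] shom_vin[OF f(1) J z(2)] unfolding tor_vanish_def by blast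
  qed
  then obtain w where w: "w \<in> fmod G (Suc i)" "vin J w" "diff G i w = f i z" by blast
  have "diff F i (g (Suc i) w - h i z) = z"
    using g(3)[OF w(1)] w(3) hz by (simp add: shom_diff[OF F.shom_d]) (simp add: algebra_simps)
  moreover have "g (Suc i) w - h i z \<in> fmod F (Suc i)" using g(2)[OF w(1)] h(2)[OF z(1)] by (rule fmod_diff)
  moreover have "vin J (g (Suc i) w - h i z)"
    by (intro vin_diff J shom_vin[OF g(1)] shom_vin[OF h(1)] w(2) z(2))
  ultimately show "\<exists>w. w \<in> fmod F (Suc i) \<and> vin J w \<and> diff F i w = z" by blast
qed

lemma tor_vanish_resK:
  assumes "is_ideal J"
  shows "tor_vanish (resK :: ('x::finite, 'k::field) fcomplex) i J D \<longleftrightarrow> tor_vanish koszul i J D"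
  using tor_vanish_independent[OF _ _ assms] koszul_free_resolution_K free_resolution_K_resK by blast

lemma in_tor_cycles_iff:
  "z \<in> tor_cycles i J \<longleftrightarrow> z \<in> fmod resK i \<and> vin J z \<and> (\<forall>j. i = Suc j \<longrightarrow> diff resK j z = 0)"
  by (cases i) (auto simp: tens_def vin_def)

lemma in_tor_boundaries_iff:
  "z \<in> tor_boundaries i J \<longleftrightarrow> (\<exists>w. w \<in> fmod resK (Suc i) \<and> vin J w \<and> diff resK i w = z)"
  by (auto simp: tor_boundaries_def tens_def vin_def)

lemma tor_multi_nonzero_koszul:
  "is_ideal J \<Longrightarrow> tor_multi_nonzero i J a \<longleftrightarrow> \<not> tor_vanish koszul i J {a}"
  by (simp add: tor_vanish_resK[symmetric])
    (auto simp: tor_multi_nonzero_def tor_vanish_def subset_iff in_tor_cycles_iff in_tor_boundaries_iff mhom_eq_vh)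

lemma tor_nonzero_koszul:
  "is_ideal J \<Longrightarrow> tor_nonzero i J j \<longleftrightarrow> \<not> tor_vanish koszul i J {a. mdeg a = j}"
  by (simp add: tor_vanish_resK[symmetric])
    (auto simp: tor_nonzero_def tor_vanish_def subset_iff in_tor_cycles_iff in_tor_boundaries_iff thom_eq_vh)


section \<open>Tor in a multidegree as simplicial homology\<close>

text \<open>In multidegree \<open>a\<close> the Koszul complex of a monomial ideal with exponent set \<open>U\<close> has the basis
  \<open>x\<^bsup>a - A\<^esup> e\<^sub>A\<close> with \<open>A\<close> in the simplicial complex \<open>Dl U a\<close>; an element is the function of its
  coefficients on sets of variables, and the differential becomes \<open>bd\<close>.\<close>

definition Dl :: "('x::finite) mon set \<Rightarrow> 'x mon \<Rightarrow> 'x set set" where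
  "Dl U a = {A. mle (exS A) a \<and> a - exS A \<in> U}"

text \<open>The Koszul differential read at its target: the coefficient at \<open>B\<close> collects
  the contributions of all sets with one more element. The complex \<open>D\<close> does not
  enter.\<close>

definition bd :: "(('x::finite) set \<Rightarrow> 'k::field) \<Rightarrow> 'x set \<Rightarrow> 'k" where
  "bd c B = (\<Sum>y\<in>- B. ksgn (insert y B) y * c (insert y B))"

text \<open>Chains of all complexes are functions on the same set of subsets, and \<open>D\<close>
  restricts only the support. Hence multiplying a chain of \<open>I\<^sup>l J\<close> by a monomial
  of the Rees algebra leaves the function unchanged and enlarges \<open>D\<close>.\<close>

definition chain :: "nat \<Rightarrow> 'x set set \<Rightarrow> ('x set \<Rightarrow> 'k::field) \<Rightarrow> bool" where
  "chain i D c \<longleftrightarrow> (\<forall>A. c A \<noteq> 0 \<longrightarrow> A \<in> D \<and> card A = i)"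

definition cyc :: "nat \<Rightarrow> ('x::finite) set set \<Rightarrow> ('x set \<Rightarrow> 'k::field) \<Rightarrow> bool" where
  "cyc i D c \<longleftrightarrow> chain i D c \<and> (\<forall>B. bd c B = 0)"

definition bdy :: "nat \<Rightarrow> ('x::finite) set set \<Rightarrow> ('x set \<Rightarrow> 'k::field) \<Rightarrow> bool" where
  "bdy i D c \<longleftrightarrow> (\<exists>e. chain (Suc i) D e \<and> (\<forall>B. bd e B = c B))"

text \<open>The first argument only fixes the coefficient field.\<close>

definition torc :: "'k::field itself \<Rightarrow> nat \<Rightarrow> ('x::finite) set set \<Rightarrow> bool" where
  "torc K i D \<longleftrightarrow> (\<exists>c :: 'x set \<Rightarrow> 'k. cyc i D c \<and> \<not> bdy i D c)"

section \<open>Translation between vectors and coefficient functions\<close>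

definition strand :: "('x::finite, 'k::field) fvec \<Rightarrow> 'x mon \<Rightarrow> 'x set \<Rightarrow> 'k" where
  "strand v a A = (if mle (exS A) a then lookup (lookup v (enc A)) (a - exS A) else 0)"

definition vec :: "'x mon \<Rightarrow> (('x::finite) set \<Rightarrow> 'k::field) \<Rightarrow> ('x, 'k) fvec" where
  "vec a c = (\<Sum>A\<in>{A. mle (exS A) a}. kel A (a - exS A) (c A))"

lemma bd_add: "bd (\<lambda>A. c A + e A) B = bd c B + bd e B"
  by (simp add: bd_def algebra_simps sum.distrib)

lemma bd_scale: "bd (\<lambda>A. r * c A) B = r * bd c B"
  by (simp add: bd_def sum_distrib_left algebra_simps)

lemma chain_mono: "chain i D c \<Longrightarrow> D \<subseteq> D' \<Longrightarrow> chain i D' c"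
  by (auto simp: chain_def)

lemma cyc_mono: "cyc i D c \<Longrightarrow> D \<subseteq> D' \<Longrightarrow> cyc i D' c"
  by (auto simp: cyc_def intro: chain_mono)

lemma bdy_mono: "bdy i D c \<Longrightarrow> D \<subseteq> D' \<Longrightarrow> bdy i D' c"
  by (auto simp: bdy_def intro: chain_mono)

lemma bdy_add:
  assumes "bdy i D c" "bdy i D e" shows "bdy i D (\<lambda>A. c A + e A)"
proof -
  obtain c' e' where *: "chain (Suc i) D c'" "\<forall>B. bd c' B = c B" "chain (Suc i) D e'" "\<forall>B. bd e' B = e B"
    using assms by (auto simp: bdy_def)
  have "chain (Suc i) D (\<lambda>A. c' A + e' A)" using *(1,3) unfolding chain_def by (metis add.right_neutral)
  then show ?thesis unfolding bdy_def using *(2,4) by (intro exI[of _ "\<lambda>A. c' A + e' A"]) (simp add: bd_add)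
qed

lemma bdy_scale:
  assumes "bdy i D c" shows "bdy i D (\<lambda>A. r * c A)"
proof -
  obtain c' where *: "chain (Suc i) D c'" "\<forall>B. bd c' B = c B"
    using assms by (auto simp: bdy_def)
  then show ?thesis unfolding bdy_def
    by (intro exI[of _ "\<lambda>A. r * c' A"]) (auto simp: bd_scale chain_def)
qed

lemma Dl_iff: "A \<in> Dl U a \<longleftrightarrow> (\<exists>n\<in>U. a = exS A + n)"
  by (auto simp: Dl_def mle_add) (metis mle_diff)

lemma strand_kel: "strand (kel A m c) a B = (if A = B \<and> a = m + exS A then c else 0)"
proof -
  have "mle (exS B) a \<and> a - exS B = m \<longleftrightarrow> a = m + exS B"
    using mle_diff'[of "exS B" a] mle_add[of "exS B" m] by (auto simp: add.commute[of _ "exS B"])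
  then show ?thesis by (auto simp: strand_def kel_def lookup_single when_def)
qed

lemma strand_add: "strand (v + w) a A = strand v a A + strand w a A"
  by (simp add: strand_def lookup_add)

lemma strand_0: "strand 0 a A = 0"
  by (simp add: strand_def)

lemma strand_sum: "strand (sum f X) a A = (\<Sum>x\<in>X. strand (f x) a A)"
  by (induction X rule: infinite_finite_induct) (auto simp: strand_add strand_0)

lemma strand_plus_exS: "strand v (m + exS A) A = lookup (lookup v (enc A)) m"
  by (simp add: strand_def mle_add add.commute[of m])

lemma strand_vec: "strand (vec a c) a' A = (if a' = a \<and> mle (exS A) a then c A else 0)"
proof -
  have "strand (vec a c) a' A = (\<Sum>B\<in>{B. mle (exS B) a}. if B = A then (if a' = a then c A else 0) else 0)"
    unfolding vec_def strand_sum strand_kel by (rule sum.cong) (auto simp: mle_diff')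
  then show ?thesis by simp
qed

lemma koszul_simps [simp]: "diff koszul i = kdiff" "shift koszul i (enc A) = exS A"
  "basis (koszul :: ('x::finite, 'k::field) fcomplex) i = enc ` {A :: 'x set. card A = i}"
  by (simp_all add: koszul_def)

lemma strand_kdiff_kel:
  "strand (kdiff (kel A m c)) a B = bd (strand (kel A m c) a) (B :: ('x::finite) set)"
proof -
  have "strand (kdiff (kel A m c)) a B
      = (\<Sum>y\<in>A. if y \<notin> B \<and> insert y B = A \<and> a = m + exS A then ksgn A y * c else 0)"
    unfolding kdiff_kel strand_sum strand_kel
  proof (rule sum.cong[OF refl])
    fix y assume y: "y \<in> A"
    then have "A - {y} = B \<longleftrightarrow> y \<notin> B \<and> insert y B = A" by auto
    moreover have "m + ex1 y + exS (A - {y}) = m + exS A" using exS_remove[OF y] by (simp add: add.assoc)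
    ultimately show "(if A - {y} = B \<and> a = m + ex1 y + exS (A - {y}) then c * ksgn A y else 0) =
        (if y \<notin> B \<and> insert y B = A \<and> a = m + exS A then ksgn A y * c else 0)" by (auto simp: mult.commute)
  qed
  also have "\<dots> = (\<Sum>y\<in>UNIV. if y \<notin> B \<and> insert y B = A \<and> a = m + exS A then ksgn A y * c else 0)"
    by (rule sum.mono_neutral_left) auto
  also have "\<dots> = (\<Sum>y\<in>- B. if y \<notin> B \<and> insert y B = A \<and> a = m + exS A then ksgn A y * c else 0)"
    by (rule sum.mono_neutral_right) auto
  also have "\<dots> = bd (strand (kel A m c) a) B"
    unfolding bd_def strand_kel by (rule sum.cong) auto
  finally show ?thesis .
qed

lemma strand_kdiff:
  fixes v :: "('x::finite, 'k::field) fvec"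
  assumes "v \<in> fmod koszul i"
  shows "strand (kdiff v) a B = bd (strand v a) B"
proof (rule additive_eq_on_singles[where B = "range (enc :: 'x set \<Rightarrow> nat)" and v = v
      and f = "\<lambda>v. strand (kdiff v) a B" and g = "\<lambda>v. bd (strand v a) B"])
  interpret d: additive "kdiff :: ('x, 'k) fvec \<Rightarrow> _" by (rule kdiff_additive)
  show "additive (\<lambda>v. strand (kdiff v) a B :: 'k)" by unfold_locales (simp add: d.add strand_add)
  show "additive (\<lambda>v. bd (strand v a) B :: 'k)"
    by unfold_locales (simp add: strand_add[abs_def] bd_add)
  show "strand (kdiff (single b (single m c))) a B = bd (strand (single b (single m c)) a) B"
    if "b \<in> range (enc :: 'x set \<Rightarrow> nat)" for b m c
    using that strand_kdiff_kel[of _ m c a B] by (auto simp: kel_def)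
  show "keys v \<subseteq> range (enc :: 'x set \<Rightarrow> nat)" using assms by (auto simp: fmod_def)
qed

lemma strand_eqI:
  fixes v w :: "('x::finite, 'k::field) fvec"
  assumes "v \<in> fmod koszul i" "w \<in> fmod koszul j" "\<And>a A. strand v a A = strand w a A"
  shows "v = w"
proof (rule fvec_eqI)
  fix b m
  show "lookup (lookup v b) m = lookup (lookup w b) m"
  proof (cases "b \<in> range (enc :: 'x set \<Rightarrow> nat)")
    case True
    then obtain A :: "'x set" where "b = enc A" by auto
    then show ?thesis using assms(3)[of "m + exS A" A] by (simp add: strand_plus_exS)
  next
    case False
    then have "b \<notin> keys v" "b \<notin> keys w" using assms(1,2) by (auto simp: fmod_def)
    then show ?thesis by (simp add: in_keys_iff)
  qed
qed

lemma vec_fmod: "chain i D c \<Longrightarrow> vec a c \<in> fmod koszul i"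
  unfolding vec_def
proof (rule fmod_sum)
  fix A assume "chain i D c"
  then show "kel A (a - exS A) (c A) \<in> fmod koszul i"
    by (cases "c A = 0") (auto simp: chain_def fmod_closed intro!: kel_fmod)
qed

lemma vin_mideal_iff:
  fixes v :: "('x::finite, 'k::field) fvec"
  assumes v: "v \<in> fmod koszul i"
  shows "vin (mideal U) v \<longleftrightarrow> (\<forall>a. chain i (Dl U a) (strand v a))"
proof
  assume L: "vin (mideal U) v"
  show "\<forall>a. chain i (Dl U a) (strand v a)" unfolding chain_def
  proof (intro allI impI)
    fix a and A :: "'x set" assume "strand v a A \<noteq> 0"
    then have A: "mle (exS A) a" "a - exS A \<in> keys (lookup v (enc A))"
      by (auto simp: strand_def in_keys_iff split: if_splits)
    then have "enc A \<in> keys v" by (auto simp: in_keys_iff)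
    then have "card A = i" using v by (auto simp: fmod_def)
    then show "A \<in> Dl U a \<and> card A = i" using A L by (auto simp: Dl_def vin_def mideal_def)
  qed
next
  assume R: "\<forall>a. chain i (Dl U a) (strand v a)"
  show "vin (mideal U) v" unfolding vin_def mideal_def mem_Collect_eq
  proof (intro allI subsetI)
    fix b m assume m: "m \<in> keys (lookup v b)"
    then have "b \<in> keys v" by (auto simp: in_keys_iff)
    then obtain A :: "'x set" where b: "b = enc A" using v by (auto simp: fmod_def)
    have "strand v (m + exS A) A \<noteq> 0" using m b by (simp add: strand_plus_exS in_keys_iff)
    then have "A \<in> Dl U (m + exS A)" using R by (auto simp: chain_def)
    then show "m \<in> U" by (simp add: Dl_def)
  qed
qed

lemma vh_koszul_iff:
  fixes v :: "('x::finite, 'k::field) fvec"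
  assumes v: "v \<in> fmod koszul i"
  shows "v \<in> vh koszul i D \<longleftrightarrow> (\<forall>a A. strand v a A \<noteq> 0 \<longrightarrow> a \<in> D)"
proof
  assume L: "v \<in> vh koszul i D"
  show "\<forall>a A. strand v a A \<noteq> 0 \<longrightarrow> a \<in> D"
  proof (intro allI impI)
    fix a A assume "strand v a A \<noteq> 0"
    then have A: "mle (exS A) a" "lookup (lookup v (enc A)) (a - exS A) \<noteq> 0"
      by (auto simp: strand_def split: if_splits)
    then have "(a - exS A) + shift (koszul :: ('x, 'k) fcomplex) i (enc A) \<in> D"
      using L unfolding vh_def by blast
    then show "a \<in> D" using A(1) by (simp add: mle_diff')
  qed
next
  assume R: "\<forall>a A. strand v a A \<noteq> 0 \<longrightarrow> a \<in> D"
  show "v \<in> vh koszul i D" unfolding vh_def mem_Collect_eq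
  proof (intro allI impI)
    fix b m assume m: "lookup (lookup v b) m \<noteq> 0"
    then have "b \<in> keys v" by (auto simp: in_keys_iff)
    then obtain A :: "'x set" where b: "b = enc A" using v by (auto simp: fmod_def)
    have "strand v (m + exS A) A \<noteq> 0" using m b by (simp add: strand_plus_exS)
    then show "m + shift (koszul :: ('x, 'k) fcomplex) i b \<in> D" using R b by auto
  qed
qed

lemma finite_strands:
  fixes v :: "('x::finite, 'k::field) fvec"
  shows "finite {a. \<exists>A. strand v a A \<noteq> 0}"
proof (rule finite_subset)
  show "{a. \<exists>A. strand v a A \<noteq> 0} \<subseteq> (\<Union>A\<in>UNIV. (\<lambda>m. m + exS A) ` keys (lookup v (enc A)))"
  proof clarify
    fix a A assume "strand v a A \<noteq> 0"
    then have "mle (exS A) a" "a - exS A \<in> keys (lookup v (enc A))"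
      by (auto simp: strand_def in_keys_iff split: if_splits)
    then show "a \<in> (\<Union>A\<in>UNIV. (\<lambda>m. m + exS A) ` keys (lookup v (enc A)))"
      by (intro UN_I[of A]) (auto simp: mle_diff' intro!: image_eqI[of _ _ "a - exS A"])
  qed
qed simp

text \<open>For \<open>i = 0\<close> the left side is vacuous, and the right side holds because
  \<open>bd\<close> reads only coefficients at nonempty sets.\<close>

lemma kdiff_eq_0_iff:
  fixes v :: "('x::finite, 'k::field) fvec"
  assumes "v \<in> fmod koszul i"
  shows "(\<forall>j. i = Suc j \<longrightarrow> kdiff v = 0) \<longleftrightarrow> (\<forall>a B. bd (strand v a) B = 0)"
proof (cases i)
  case 0
  have "bd (strand v a) B = 0" for a B
  proof -
    have "strand v a (insert y B) = 0" for y
    proof -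
      have "enc (insert y B) \<notin> keys v" using assms 0 by (auto simp: fmod_def)
      then show ?thesis by (simp add: strand_def in_keys_iff)
    qed
    then show ?thesis by (simp add: bd_def)
  qed
  then show ?thesis using 0 by simp
next
  case (Suc j)
  have "kdiff v \<in> fmod koszul j" using assms Suc by (simp add: koszul_diff_range)
  then have "kdiff v = 0 \<longleftrightarrow> (\<forall>a B. strand (kdiff v) a B = 0)"
    using strand_eqI[of "kdiff v" j 0 j] by (auto simp: strand_0 fmod_closed)
  then show ?thesis using Suc by (simp add: strand_kdiff[OF assms])
qed

text \<open>The Koszul complex is the direct sum of its strands. A cycle has finitely many nonzero
  strands, and bounding chains of these are reassembled by \<open>vec\<close>.\<close>

lemma tor_vanish_koszul_iff:
  fixes U :: "('x::finite) mon set"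
  shows "tor_vanish koszul i (mideal U :: ('x, 'k::field) mpol set) D
    \<longleftrightarrow> (\<forall>a\<in>D. \<not> torc TYPE('k) i (Dl U a))"
proof
  assume van: "tor_vanish koszul i (mideal U :: ('x, 'k) mpol set) D"
  show "\<forall>a\<in>D. \<not> torc TYPE('k) i (Dl U a)"
    unfolding torc_def
  proof clarify
    fix a and c :: "'x set \<Rightarrow> 'k" assume a: "a \<in> D" and c: "cyc i (Dl U a) c" "\<not> bdy i (Dl U a) c"
    have ch: "chain i (Dl U a) c" and bd: "\<And>B. bd c B = 0" using c(1) by (auto simp: cyc_def)
    have cle: "c A \<noteq> 0 \<Longrightarrow> mle (exS A) a" for A using ch by (auto simp: chain_def Dl_def)
    let ?z = "vec a c"
    have st: "strand ?z a' A = (if a' = a then c A else 0)" for a' A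
      using cle by (auto simp: strand_vec)
    have st': "strand ?z a = c" "a' \<noteq> a \<Longrightarrow> strand ?z a' = (\<lambda>_. 0)" for a'
      by (auto simp: st fun_eq_iff)
    have z: "?z \<in> fmod koszul i" using ch by (rule vec_fmod)
    have "vin (mideal U) ?z" unfolding vin_mideal_iff[OF z]
      using ch by (auto simp: st chain_def)
    moreover have "?z \<in> vh koszul i D" unfolding vh_koszul_iff[OF z] using a by (auto simp: st)
    moreover have "\<forall>j. i = Suc j \<longrightarrow> kdiff ?z = 0"
      unfolding kdiff_eq_0_iff[OF z] using bd st' by (metis (mono_tags, lifting) bd_def mult_zero_right sum.neutral)
    ultimately obtain w where w: "w \<in> fmod koszul (Suc i)" "vin (mideal U) w" "kdiff w = ?z"
      using van z unfolding tor_vanish_def koszul_simps by blast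
    have "bd (strand w a) B = c B" for B
      using strand_kdiff[OF w(1), of a B] w(3) by (simp add: st)
    then have "bdy i (Dl U a) c" using w(2) unfolding vin_mideal_iff[OF w(1)] bdy_def by blast
    then show False using c(2) by simp
  qed
next
  assume tr: "\<forall>a\<in>D. \<not> torc TYPE('k) i (Dl U a)"
  show "tor_vanish koszul i (mideal U :: ('x, 'k) mpol set) D"
    unfolding tor_vanish_def koszul_simps
  proof (intro allI impI)
    fix z :: "('x, 'k) fvec"
    assume z: "z \<in> fmod koszul i" "vin (mideal U) z" "\<forall>j. i = Suc j \<longrightarrow> kdiff z = 0" "z \<in> vh koszul i D"
    have "\<exists>e. chain (Suc i) (Dl U a) e \<and> (\<forall>B. bd e B = strand z a B)" for a
    proof (cases "a \<in> D")
      case True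
      have "cyc i (Dl U a) (strand z a)"
        using z(2,3) unfolding cyc_def vin_mideal_iff[OF z(1)] kdiff_eq_0_iff[OF z(1)] by blast
      then show ?thesis using tr True unfolding torc_def bdy_def by blast
    next
      case False
      then have "strand z a B = 0" for B using z(4) unfolding vh_koszul_iff[OF z(1)] by blast
      then show ?thesis by (intro exI[of _ "\<lambda>_. 0"]) (simp add: chain_def bd_def)
    qed
    then obtain e where e: "\<And>a. chain (Suc i) (Dl U a) (e a)" "\<And>a B. bd (e a) B = strand z a B" by metis
    define D0 where "D0 = {a. \<exists>A. strand z a A \<noteq> 0}"
    have fin: "finite D0" unfolding D0_def by (rule finite_strands)
    define w where "w = (\<Sum>a\<in>D0. vec a (e a))"
    have w: "w \<in> fmod koszul (Suc i)" unfolding w_def by (intro fmod_sum vec_fmod[OF e(1)])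
    have "strand w a A = (if a \<in> D0 then e a A else 0)" for a A
    proof -
      have cle: "e a A \<noteq> 0 \<Longrightarrow> mle (exS A) a" using e(1)[of a] by (auto simp: chain_def Dl_def)
      have "strand w a A = (\<Sum>a'\<in>D0. if a' = a then e a A else 0)"
        unfolding w_def strand_sum by (rule sum.cong) (use cle in \<open>auto simp: strand_vec\<close>)
      then show ?thesis using fin by simp
    qed
    then have st: "strand w a = (if a \<in> D0 then e a else (\<lambda>_. 0))" for a by (auto simp: fun_eq_iff)
    have "vin (mideal U) w" unfolding vin_mideal_iff[OF w] st using e(1) by (auto simp: chain_def)
    moreover have "kdiff w = z"
    proof (rule strand_eqI[OF koszul_diff_range[OF w] z(1)])
      fix a B
      show "strand (kdiff w) a B = strand z a B"
        unfolding strand_kdiff[OF w] st using e(2) by (auto simp: D0_def bd_def)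
    qed
    ultimately show "\<exists>w. w \<in> fmod koszul (Suc i) \<and> vin (mideal U) w \<and> kdiff w = z" using w by blast
  qed
qed

lemma tor_multi_nonzero_mideal:
  "upset U \<Longrightarrow> tor_multi_nonzero i (mideal U :: ('x::finite, 'k::field) mpol set) a \<longleftrightarrow> torc TYPE('k) i (Dl U a)"
  using tor_multi_nonzero_koszul[OF is_ideal_mideal] by (simp add: tor_vanish_koszul_iff)

lemma tor_nonzero_mideal:
  "upset U \<Longrightarrow> tor_nonzero i (mideal U :: ('x::finite, 'k::field) mpol set) j
    \<longleftrightarrow> (\<exists>a. mdeg a = j \<and> torc TYPE('k) i (Dl U a))"
  using tor_nonzero_koszul[OF is_ideal_mideal] by (auto simp: tor_vanish_koszul_iff)

section \<open>Multiplication on Koszul homology\<close>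

text \<open>On \<open>K\<close> the polynomial \<open>f\<close> acts through its constant
  coefficient, so multiplication by \<open>f\<close> lifts the zero map.\<close>

lemma koszul_mult_homotopy:
  fixes f :: "('x::finite, 'k::field) mpol"
  assumes "lookup f 0 = 0"
  shows "\<exists>h. (\<forall>i. shom (h i)) \<and> (\<forall>i v. v \<in> fmod koszul i \<longrightarrow> h i v \<in> fmod koszul (Suc i)) \<and>
     (\<forall>v. v \<in> fmod koszul 0 \<longrightarrow> vscale f v = kdiff (h 0 v)) \<and>
     (\<forall>i v. v \<in> fmod koszul (Suc i) \<longrightarrow> vscale f v = kdiff (h (Suc i) v) + h i (kdiff v))"
proof -
  let ?F = "koszul :: ('x, 'k) fcomplex"
  interpret F: kres ?F by (rule kres.intro) (rule koszul_free_resolution_K)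
  have "\<exists>h. (\<forall>i. shom (h i)) \<and> (\<forall>i v. v \<in> fmod ?F i \<longrightarrow> h i v \<in> fmod ?F (Suc i)) \<and>
     (\<forall>v. v \<in> fmod ?F 0 \<longrightarrow> vscale f v = diff ?F 0 (h 0 v)) \<and>
     (\<forall>i v. v \<in> fmod ?F (Suc i) \<longrightarrow> vscale f v = diff ?F (Suc i) (h (Suc i) v) + h i (diff ?F i v))"
  proof (rule null_homotopy)
    show "free_resolution_K ?F" "free_resolution_K ?F" by (rule koszul_free_resolution_K)+
    show "shom (vscale f)" for i :: nat by (simp add: shom_def vscale_add_right vscale_vscale mult.commute)
    show "diff ?F i (vscale f v) = vscale f (diff ?F i v)" for i v by (rule shom_vscale[OF F.shom_d])
    show "aug ?F (vscale f v) = 0" for v using assms F.aug_vscale[of f v] by (simp add: kscale_def)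
  qed (rule fmod_vscale)
  then show ?thesis by simp
qed

text \<open>Multiplication by a variable is null-homotopic, and the homotopy keeps entries in the
  ideal. On coefficient functions this multiplication is the identity; only the multidegree moves
  from \<open>a\<close> to \<open>a + ex1 y\<close>.\<close>

lemma variable_kills_homology:
  fixes c :: "('x::finite) set \<Rightarrow> 'k::field"
  assumes U: "upset U" and c: "cyc i (Dl U a) c"
  shows "bdy i (Dl U (a + ex1 y)) c"
proof -
  have ch: "chain i (Dl U a) c" and bd: "\<And>B. bd c B = 0" using c by (auto simp: cyc_def)
  have cle: "c A \<noteq> 0 \<Longrightarrow> mle (exS A) a" for A using ch by (auto simp: chain_def Dl_def)
  let ?z = "vec a c" and ?x = "xpow (ex1 y) :: ('x, 'k) mpol"
  have st: "strand ?z a' A = (if a' = a then c A else 0)" for a' A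
    using cle by (auto simp: strand_vec)
  then have st': "strand ?z a' = (if a' = a then c else (\<lambda>_. 0))" for a'
    by (auto simp: fun_eq_iff)
  have z: "?z \<in> fmod koszul i" using ch by (rule vec_fmod)
  have vz: "vin (mideal U) ?z" unfolding vin_mideal_iff[OF z]
    using ch by (auto simp: st chain_def)
  have dz: "\<forall>j. i = Suc j \<longrightarrow> kdiff ?z = 0"
    unfolding kdiff_eq_0_iff[OF z] st' using bd by (auto simp: bd_def)
  have "lookup ?x 0 = 0"
  proof -
    have "ex1 y \<noteq> 0" using mdeg_ex1[of y] by fastforce
    then show ?thesis by (simp add: xpow_def lookup_single)
  qed
  from koszul_mult_homotopy[OF this] obtain h where h: "\<And>i. shom (h i)"
     "\<And>i v. v \<in> fmod koszul i \<Longrightarrow> h i v \<in> fmod koszul (Suc i)"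
     "\<And>v. v \<in> fmod koszul 0 \<Longrightarrow> vscale ?x v = kdiff (h 0 v)"
     "\<And>i v. v \<in> fmod koszul (Suc i) \<Longrightarrow> vscale ?x v = kdiff (h (Suc i) v) + h i (kdiff v)"
    by blast
  have xz: "vscale ?x ?z = kdiff (h i ?z)"
    using z dz h(3,4) shom_0[OF h(1)] by (cases i) auto
  have "vscale ?x ?z = (\<Sum>A\<in>{A. mle (exS A) a}. kel A (ex1 y + (a - exS A)) (c A))"
    unfolding vec_def vscale_sum_right xpow_def vscale_kel by simp
  then have "strand (vscale ?x ?z) (a + ex1 y) B =
      (\<Sum>A\<in>{A. mle (exS A) a}. if A = B \<and> a + ex1 y = ex1 y + (a - exS A) + exS A then c A else 0)" for B
    by (simp only: strand_sum strand_kel)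
  also have "\<dots> B = (\<Sum>A\<in>{A. mle (exS A) a}. if A = B then c B else 0)" for B
    by (rule sum.cong) (auto simp: add.assoc mle_diff' add.commute[of a])
  also have "\<dots> B = c B" for B using cle by auto
  finally have "strand (vscale ?x ?z) (a + ex1 y) B = c B" for B .
  moreover have hz: "h i ?z \<in> fmod koszul (Suc i)" by (rule h(2)[OF z])
  ultimately have "bd (strand (h i ?z) (a + ex1 y)) B = c B" for B
    using strand_kdiff[OF hz, of "a + ex1 y" B] xz by simp
  moreover have "vin (mideal U) (h i ?z)" by (rule shom_vin[OF h(1) is_ideal_mideal[OF U] vz])
  ultimately show ?thesis unfolding bdy_def vin_mideal_iff[OF hz] by blast
qed


section \<open>Homology of the Rees module\<close>

lemma finite_nsums: "finite G \<Longrightarrow> finite (nsums G k)"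
proof (induction k)
  case (Suc k)
  then have "finite ((\<lambda>(g, s). g + s) ` (G \<times> nsums G k))" by simp
  moreover have "nsums G (Suc k) = (\<lambda>(g, s). g + s) ` (G \<times> nsums G k)"
    by (auto simp: nsums_Suc)
  ultimately show ?case by simp
qed simp

lemma qleI: "l \<le> k \<Longrightarrow> s \<in> nsums G (k - l) \<Longrightarrow> qle G (a, l) (a + s, k)"
  unfolding qle_def by (auto intro!: bexI[of _ s] exI[of _ 0])

lemma qle_Suc: "g \<in> G \<Longrightarrow> qle G (a, k) (g + a, Suc k)"
  using qleI[of k "Suc k" g G a] by (simp add: nsums_Suc add.commute)

text \<open>Multiplication by a monomial of the Rees algebra, seen on faces. It turns cycles at
  \<open>q\<close> into cycles at \<open>p\<close> by mere inclusion.\<close>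

lemma Dl_qle: "qle G q p \<Longrightarrow> Dl (rees G B (snd q)) (fst q) \<subseteq> Dl (rees G B (snd p)) (fst p)"
proof
  fix A assume q: "qle G q p" and "A \<in> Dl (rees G B (snd q)) (fst q)"
  then obtain n where n: "n \<in> rees G B (snd q)" "fst q = exS A + n" by (auto simp: Dl_iff)
  obtain s m where sm: "snd q \<le> snd p" "s \<in> nsums G (snd p - snd q)" "fst p = fst q + s + m"
    using q by (auto simp: qle_def)
  have "qle G (n, snd q) (n + s + m, snd p)" using sm(1,2) unfolding qle_def by auto
  then have "n + s + m \<in> rees G B (snd p)" using n(1) rees_qle by blast
  then show "A \<in> Dl (rees G B (snd p)) (fst p)"
    unfolding Dl_iff using n(2) sm(3) by (intro bexI[of _ "n + s + m"]) (simp_all add: add.assoc)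
qed

text \<open>Leading term argument: the cycles of all \<open>I\<^sup>l J\<close> form a submodule of a free module over the
  Rees algebra, and their leading terms in position \<open>A\<close> generate a monomial submodule.\<close>

lemma rees_cycles_finitely_generated:
  fixes G :: "('x::finite) mon set"
  assumes G: "finite G" and B: "finite B"
  obtains X0 where "finite X0"
    and "\<And>i p. torc TYPE('k::field) i (Dl (rees G B (snd p)) (fst p)) \<Longrightarrow>
      \<exists>q\<in>X0. qle G q p \<and> (\<exists>c :: 'x set \<Rightarrow> 'k. cyc i (Dl (rees G B (snd q)) (fst q)) c \<and>
        \<not> bdy i (Dl (rees G B (snd p)) (fst p)) c)"
proof -
  define D where "D p = Dl (rees G B (snd p)) (fst p)" for p
  have Dmono: "qle G q p \<Longrightarrow> D q \<subseteq> D p" for q p unfolding D_def by (rule Dl_qle)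
  define lead where "lead c A \<longleftrightarrow> c A \<noteq> 0 \<and> (\<forall>A'. c A' \<noteq> 0 \<longrightarrow> enc A' \<le> enc A)"
    for c :: "'x set \<Rightarrow> 'k" and A
  define ini where "ini A = {p. \<exists>c. cyc (card A) (D p) c \<and> lead c A}" for A
  \<comment> \<open>A face \<open>A\<close> occurs at \<open>(a, l)\<close> when
    \<open>a - exS A\<close> is an exponent of \<open>I\<^sup>l J\<close>; the pair then lies above
    some \<open>(b + exS A, 0)\<close>, the position of \<open>x\<^sup>b e\<^sub>A\<close>.\<close>
  have "\<exists>N0. finite N0 \<and> N0 \<subseteq> ini A \<and> (\<forall>p\<in>ini A. \<exists>q\<in>N0. qle G q p)" for A
  proof (rule qle_noetherian[OF G, of "(\<lambda>b. (b + exS A, 0)) ` B"])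
    fix p assume "p \<in> ini A"
    then have "A \<in> D p" by (auto simp: ini_def lead_def cyc_def chain_def)
    then obtain n where n: "n \<in> rees G B (snd p)" "fst p = exS A + n" by (auto simp: D_def Dl_iff)
    then obtain s b m where s: "n = s + b + m" "s \<in> nsums G (snd p)" "b \<in> B" by (auto simp: rees_def)
    have "fst p = (b + exS A) + s + m" unfolding n(2) s(1) by (simp only: ac_simps)
    then have "qle G (b + exS A, 0) p" unfolding qle_def using s(2) by auto
    then show "\<exists>v\<in>(\<lambda>b. (b + exS A, 0)) ` B. qle G v p" using s(3) by blast
  qed (simp add: B)
  then have "\<forall>A. \<exists>N0. finite N0 \<and> N0 \<subseteq> ini A \<and> (\<forall>p\<in>ini A. \<exists>q\<in>N0. qle G q p)" ..
  then obtain N where N: "\<forall>A. finite (N A) \<and> N A \<subseteq> ini A \<and> (\<forall>p\<in>ini A. \<exists>q\<in>N A. qle G q p)"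
    by (rule choice[THEN exE])
  have fin: "finite (\<Union>(range N))" using N by (intro finite_UN_I) simp_all
  have "\<exists>q\<in>\<Union>(range N). qle G q p \<and> (\<exists>c :: 'x set \<Rightarrow> 'k. cyc i (D q) c \<and> \<not> bdy i (D p) c)"
    if tor: "torc TYPE('k) i (D p)" for i p
  proof (rule ccontr)
    assume "\<not> ?thesis"
    then have all: "bdy i (D p) c" if "q \<in> N A" "qle G q p" "cyc i (D q) c" for q A and c :: "'x set \<Rightarrow> 'k"
      using that by blast
    \<comment> \<open>If every generating cycle below \<open>p\<close> bounds at \<open>p\<close>,
      cancelling leading coefficients one by one shows that all cycles at \<open>p\<close> bound.
      The number \<open>n\<close> bounds the codes of the faces still present.\<close>
    have "bdy i (D p) z" if "cyc i (D p) z" "\<And>A. z A \<noteq> 0 \<Longrightarrow> enc A < n" for n and z :: "'x set \<Rightarrow> 'k"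
      using that
    proof (induction n arbitrary: z)
      case 0
      then have "z A = 0" for A by auto
      then show ?case unfolding bdy_def by (intro exI[of _ "\<lambda>_. 0"]) (simp add: chain_def bd_def)
    next
      case (Suc n)
      show ?case
      proof (cases "\<exists>A. z A \<noteq> 0 \<and> enc A = n")
        case False
        then have "z A \<noteq> 0 \<Longrightarrow> enc A < n" for A using Suc.prems(2)[of A] by (auto simp: less_Suc_eq)
        then show ?thesis using Suc.IH Suc.prems(1) by blast
      next
        case True
        then obtain A where A: "z A \<noteq> 0" "enc A = n" by blast
        have "lead z A" using A Suc.prems(2) by (auto simp: lead_def less_Suc_eq_le)
        moreover have "card A = i" using Suc.prems(1) A(1) by (auto simp: cyc_def chain_def)
        ultimately have "p \<in> ini A" using Suc.prems(1) by (auto simp: ini_def)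
        then obtain q where q: "q \<in> N A" "qle G q p" using N by meson
        then have "q \<in> ini A" using N by blast
        then obtain c where c: "cyc i (D q) c" "lead c A" using \<open>card A = i\<close> by (auto simp: ini_def)
        define z' where "z' = (\<lambda>B. z B + (- (z A / c A)) * c B)"
        have cp: "cyc i (D p) c" using cyc_mono[OF c(1) Dmono[OF q(2)]] .
        have "cyc i (D p) z'"
          using Suc.prems(1) cp unfolding cyc_def z'_def bd_add bd_scale chain_def
          by (metis add.right_neutral mult_zero_right)
        moreover have "enc B < n" if B: "z' B \<noteq> 0" for B
        proof -
          have "z B \<noteq> 0 \<or> c B \<noteq> 0" using B by (auto simp: z'_def)
          then have "enc B \<le> n" using Suc.prems(2)[of B] c(2) A(2) by (auto simp: lead_def)
          moreover have "B \<noteq> A" using B c(2) by (auto simp: z'_def lead_def)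
          then have "enc B \<noteq> n" using A(2) enc_eq[of B A] by simp
          ultimately show ?thesis by simp
        qed
        ultimately have "bdy i (D p) z'" by (rule Suc.IH)
        moreover have "bdy i (D p) (\<lambda>B. (z A / c A) * c B)" by (intro bdy_scale all[OF q c(1)])
        ultimately have "bdy i (D p) (\<lambda>B. z' B + (z A / c A) * c B)" by (rule bdy_add)
        then show ?thesis by (simp add: z'_def)
      qed
    qed
    note * = this
    obtain z :: "'x set \<Rightarrow> 'k" where z: "cyc i (D p) z" "\<not> bdy i (D p) z" using tor by (auto simp: torc_def)
    have "enc A < Suc (Max (range (enc :: 'x set \<Rightarrow> nat)))" for A :: "'x set"
      by (simp add: less_Suc_eq_le)
    then show False using * z by blast
  qed
  then show thesis using fin unfolding D_def by (rule that[rotated])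
qed

text \<open>If a variable divided the factor between the generator \<open>q\<close> and
  \<open>(a, l)\<close>, the cycle of \<open>q\<close> would occur at level \<open>l\<close> one
  variable below \<open>a\<close> and so bound at \<open>a\<close>. Thus only generators of
  \<open>I\<close> separate the two.\<close>

lemma rees_homology_finitely_generated:
  fixes G :: "('x::finite) mon set"
  assumes G: "finite G" and B: "finite B"
  obtains X0 where "finite X0"
    and "\<And>i a l. torc TYPE('k::field) i (Dl (rees G B l) a) \<Longrightarrow>
      \<exists>(a0, l0)\<in>X0. l0 \<le> l \<and> (\<exists>s\<in>nsums G (l - l0). a = a0 + s) \<and>
        (\<exists>c :: 'x set \<Rightarrow> 'k. cyc i (Dl (rees G B l0) a0) c \<and> \<not> bdy i (Dl (rees G B l) a) c)"
proof -
  obtain X0 where X0: "finite X0" "\<And>i p. torc TYPE('k::field) i (Dl (rees G B (snd p)) (fst p)) \<Longrightarrow>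
     \<exists>q\<in>X0. qle G q p \<and> (\<exists>c :: 'x set \<Rightarrow> 'k. cyc i (Dl (rees G B (snd q)) (fst q)) c \<and>
        \<not> bdy i (Dl (rees G B (snd p)) (fst p)) c)"
    by (rule rees_cycles_finitely_generated[OF G B]) (rule that)
  have "\<exists>(a0, l0)\<in>X0. l0 \<le> l \<and> (\<exists>s\<in>nsums G (l - l0). a = a0 + s) \<and>
        (\<exists>c :: 'x set \<Rightarrow> 'k. cyc i (Dl (rees G B l0) a0) c \<and> \<not> bdy i (Dl (rees G B l) a) c)"
    if tor: "torc TYPE('k::field) i (Dl (rees G B l) a)" for i a l
  proof -
    have "torc TYPE('k::field) i (Dl (rees G B (snd (a, l))) (fst (a, l)))" using tor by simp
    from X0(2)[OF this] obtain q c where q: "q \<in> X0" "qle G q (a, l)"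
      "cyc i (Dl (rees G B (snd q)) (fst q)) c" "\<not> bdy i (Dl (rees G B l) a) (c :: 'x set \<Rightarrow> 'k)"
      by auto
    obtain s m where sm: "snd q \<le> l" "s \<in> nsums G (l - snd q)" "a = fst q + s + m"
      using q(2) by (auto simp: qle_def)
    have "m = 0"
    proof (rule ccontr)
      assume "m \<noteq> 0"
      then obtain y where "lookup m y \<noteq> 0" by (metis lookup_zero poly_mapping_eqI)
      then obtain m' where m: "m = ex1 y + m'" using ex1_le_iff[of y m] by (auto simp: mle_iff)
      have "qle G q (fst q + s + m', l)" using sm(1,2) unfolding qle_def by auto
      then have "cyc i (Dl (rees G B l) (fst q + s + m')) c"
        using cyc_mono[OF q(3) Dl_qle] by fastforce
      from variable_kills_homology[OF upset_rees this, of y] q(4) show False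
        using sm(3) m by (simp add: ac_simps)
    qed
    then show ?thesis using q sm by (intro bexI[of _ q]) (auto simp: case_prod_beta)
  qed
  then show thesis using X0(1) by (rule that[rotated])
qed

text \<open>Above \<open>k1\<close>, the largest level of a generating cycle, at least one generator
  \<open>g\<close> of \<open>I\<close> can be split off. Before multiplication by \<open>g\<close>
  the cycle cannot bound, since it does not bound afterwards.\<close>

lemma rees_homology_step:
  fixes G :: "('x::finite) mon set"
  assumes G: "finite G" and B: "finite B"
  shows "\<exists>k1. \<forall>i a l. k1 \<le> l \<longrightarrow> torc TYPE('k::field) i (Dl (rees G B (Suc l)) a) \<longrightarrow>
     (\<exists>g\<in>G. \<exists>a'. a = g + a' \<and> torc TYPE('k) i (Dl (rees G B l) a'))"
proof -
  obtain X0 where X0: "finite X0" "\<And>i a l. torc TYPE('k::field) i (Dl (rees G B l) a) \<Longrightarrow>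
     \<exists>(a0, l0)\<in>X0. l0 \<le> l \<and> (\<exists>s\<in>nsums G (l - l0). a = a0 + s) \<and>
        (\<exists>c :: 'x set \<Rightarrow> 'k. cyc i (Dl (rees G B l0) a0) c \<and> \<not> bdy i (Dl (rees G B l) a) c)"
    by (rule rees_homology_finitely_generated[OF G B]) (rule that)
  define k1 where "k1 = Max (insert 0 (snd ` X0))"
  have "\<exists>g\<in>G. \<exists>a'. a = g + a' \<and> torc TYPE('k) i (Dl (rees G B l) a')"
    if l: "k1 \<le> l" and tor: "torc TYPE('k) i (Dl (rees G B (Suc l)) a)" for i a l
  proof -
    obtain a0 l0 s c where *: "(a0, l0) \<in> X0" "s \<in> nsums G (Suc l - l0)" "a = a0 + s"
      "cyc i (Dl (rees G B l0) a0) c" "\<not> bdy i (Dl (rees G B (Suc l)) a) (c :: 'x set \<Rightarrow> 'k)"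
      using X0(2)[OF tor] by (elim bexE exE conjE case_prodE) auto
    have "l0 \<le> k1" unfolding k1_def using X0(1) *(1) by (intro Max_ge) (auto intro: image_eqI[of _ snd "(a0, l0)"])
    then have l0: "l0 \<le> l" "Suc l - l0 = Suc (l - l0)" using l by auto
    then obtain g t where gt: "s = g + t" "g \<in> G" "t \<in> nsums G (l - l0)" using *(2) by (auto simp: nsums_Suc)
    have cy: "cyc i (Dl (rees G B l) (a0 + t)) c"
      using cyc_mono[OF *(4)] Dl_qle[OF qleI[OF l0(1) gt(3), of a0], of B] by simp
    have a: "a = g + (a0 + t)" using *(3) gt(1) by (simp add: ac_simps)
    have "\<not> bdy i (Dl (rees G B l) (a0 + t)) c"
      using *(5) bdy_mono[of i _ c] Dl_qle[OF qle_Suc[OF gt(2)], of B "a0 + t" l] unfolding a by auto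
    then have "torc TYPE('k) i (Dl (rees G B l) (a0 + t))" using cy unfolding torc_def by blast
    then show ?thesis using gt(2) a by blast
  qed
  then show ?thesis by blast
qed

text \<open>Ensures that the maximum in \<open>reg\<close> is taken over a finite set.\<close>

lemma finite_rees_homology:
  fixes G :: "('x::finite) mon set"
  assumes G: "finite G" and B: "finite B"
  shows "finite {a. \<exists>i. torc TYPE('k::field) i (Dl (rees G B l) a)}"
proof -
  obtain X0 where X0: "finite X0" "\<And>i a l. torc TYPE('k::field) i (Dl (rees G B l) a) \<Longrightarrow>
     \<exists>(a0, l0)\<in>X0. l0 \<le> l \<and> (\<exists>s\<in>nsums G (l - l0). a = a0 + s) \<and>
        (\<exists>c :: 'x set \<Rightarrow> 'k. cyc i (Dl (rees G B l0) a0) c \<and> \<not> bdy i (Dl (rees G B l) a) c)"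
    by (rule rees_homology_finitely_generated[OF G B]) (rule that)
  have "{a. \<exists>i. torc TYPE('k::field) i (Dl (rees G B l) a)}
      \<subseteq> (\<Union>(a0, l0)\<in>X0. (\<lambda>s. a0 + s) ` nsums G (l - l0))"
  proof clarify
    fix a i assume "torc TYPE('k) i (Dl (rees G B l) a)"
    from X0(2)[OF this] show "a \<in> (\<Union>(a0, l0)\<in>X0. (\<lambda>s. a0 + s) ` nsums G (l - l0))" by auto
  qed
  then show ?thesis
    by (rule finite_subset) (auto intro!: finite_UN_I X0(1) finite_imageI finite_nsums[OF G])
qed

lemma torc_card_le:
  fixes D :: "('x::finite) set set"
  assumes "torc (K :: 'a::field itself) i D"
  shows "i \<le> card (UNIV :: 'x set)"
proof -
  obtain c :: "'x set \<Rightarrow> 'a" where c: "cyc i D c" "\<not> bdy i D c" using assms by (auto simp: torc_def)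
  have "\<exists>A. c A \<noteq> 0"
  proof (rule ccontr)
    assume "\<not> ?thesis"
    then have "bdy i D c" unfolding bdy_def by (intro exI[of _ "\<lambda>_. 0"]) (simp add: chain_def bd_def)
    then show False using c(2) by simp
  qed
  then obtain A where "c A \<noteq> 0" by blast
  then have "card A = i" using c(1) by (auto simp: cyc_def chain_def)
  then show ?thesis using card_mono[of "UNIV :: 'x set" A] by auto
qed

section \<open>Homological shift ideals of an ideal with linear powers\<close>

text \<open>The generators in \<open>linear_resolution\<close> are homogeneous polynomials, not
  monomials; but all their terms lie in \<open>U\<close> and have degree \<open>d\<close>, so these
  terms generate as well.\<close>

lemma linear_resolution_mideal:
  fixes U :: "('x::finite) mon set"
  assumes U: "upset U" and lin: "linear_resolution (mideal U :: ('x, 'k::field) mpol set)"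
  shows "\<exists>d. U = upclosure {a \<in> U. mdeg a = d} \<and>
     (\<forall>i a. torc TYPE('k) i (Dl U a) \<longrightarrow> mdeg a = i + d)"
proof -
  obtain d and F :: "('x, 'k) mpol set" where d: "F \<subseteq> hcomp d" "mideal U = ideal_gen F"
      "\<And>i j. j \<noteq> i + d \<Longrightarrow> \<not> tor_nonzero i (mideal U :: ('x, 'k) mpol set) j"
    using lin unfolding linear_resolution_def by blast
  let ?V = "upclosure {a \<in> U. mdeg a = d}"
  have "F \<subseteq> mideal U" using d(2) ideal_gen_superset by simp
  have "F \<subseteq> mideal ?V"
  proof
    fix f assume "f \<in> F"
    then have "keys f \<subseteq> {a \<in> U. mdeg a = d}"
      using \<open>F \<subseteq> mideal U\<close> d(1) by (auto simp: mideal_def hcomp_def)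
    then show "f \<in> mideal ?V" using upclosure_superset[of _ "{a \<in> U. mdeg a = d}"] unfolding mideal_def by blast
  qed
  then have "(mideal U :: ('x, 'k) mpol set) \<subseteq> mideal ?V"
    unfolding d(2) by (rule ideal_gen_minimal) (simp add: is_ideal_mideal)
  then have "U \<subseteq> ?V" using xpow_in_mideal by blast
  moreover have "?V \<subseteq> U" using U by (auto simp: upclosure_def upsetD)
  ultimately have "U = ?V" by simp
  moreover have "mdeg a = i + d" if "torc TYPE('k) i (Dl U a)" for i a
    using d(3)[of "mdeg a" i] that by (auto simp: tor_nonzero_mideal[OF U])
  ultimately show ?thesis by blast
qed

lemma mdeg_rees_ge:
  assumes "\<And>g. g \<in> G \<Longrightarrow> mdeg g = d" "a \<in> rees G B l"
  shows "mdeg a \<ge> d * l"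
proof -
  obtain s b m where s: "a = s + b + m" "s \<in> nsums G l" using assms(2) by (auto simp: rees_def)
  have "mdeg s = d * l" by (rule mdeg_nsums[OF assms(1) s(2)])
  then show ?thesis using s(1) by simp
qed

text \<open>Linearity provides just some generating degree \<open>e\<close>. An exponent of degree
  \<open>d * k\<close> exists and is divisible by one of degree \<open>e\<close>, while no exponent
  has degree below \<open>d * k\<close>; so \<open>e = d * k\<close>.\<close>

lemma rees_homology_degree:
  fixes G :: "('x::finite) mon set"
  assumes G: "\<And>g. g \<in> G \<Longrightarrow> mdeg g = d" "G \<noteq> {}"
    and lin: "linear_resolution (mideal (rees G {0} k) :: ('x, 'k::field) mpol set)"
    and tor: "torc TYPE('k) i (Dl (rees G {0} k) a)"
  shows "mdeg a = i + d * k"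
proof -
  let ?U = "rees G {0} k"
  obtain e where e: "?U = upclosure {a \<in> ?U. mdeg a = e}"
      "\<And>i a. torc TYPE('k) i (Dl ?U a) \<Longrightarrow> mdeg a = i + e"
    using linear_resolution_mideal[OF upset_rees lin] by blast
  obtain s where s: "s \<in> nsums G k" using nsums_nonempty[OF G(2)] by blast
  then have "s + 0 + 0 \<in> ?U" by (intro reesI) simp_all
  then have "s \<in> upclosure {a \<in> ?U. mdeg a = e}" using e(1) by simp
  then obtain b m where b: "s = b + m" "b \<in> ?U" "mdeg b = e" by (auto simp: upclosure_def)
  have "mdeg s = d * k" by (rule mdeg_nsums[OF G(1) s])
  moreover have "e \<ge> d * k" using mdeg_rees_ge[OF G(1) b(2)] b(3) by simp
  ultimately have "e = d * k" using b by simp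
  then show ?thesis using e(2)[OF tor] by simp
qed

text \<open>A cycle of the linear strand stays nonzero in homology after multiplication by a generator of
  \<open>I\<close>, because \<open>I\<^sup>k\<^sup>+\<^sup>1\<close> has no elements in the degree of a possible bounding chain.\<close>

lemma HS_power_closed:
  fixes G :: "('x::finite) mon set"
  assumes G: "\<And>g. g \<in> G \<Longrightarrow> mdeg g = d" and g: "g \<in> G"
    and deg: "mdeg a = i + d * k" and tor: "torc TYPE('k::field) i (Dl (rees G {0} k) a)"
  shows "torc TYPE('k) i (Dl (rees G {0} (Suc k)) (g + a))"
proof -
  obtain c :: "'x set \<Rightarrow> 'k" where c: "cyc i (Dl (rees G {0} k) a) c" "\<not> bdy i (Dl (rees G {0} k) a) c"
    using tor by (auto simp: torc_def)
  have cy: "cyc i (Dl (rees G {0} (Suc k)) (g + a)) c"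
    using cyc_mono[OF c(1)] Dl_qle[OF qle_Suc[OF g], of "{0}" a k] by simp
  have "\<not> bdy i (Dl (rees G {0} (Suc k)) (g + a)) c"
  proof
    assume "bdy i (Dl (rees G {0} (Suc k)) (g + a)) c"
    then obtain e where e: "chain (Suc i) (Dl (rees G {0} (Suc k)) (g + a)) e" "\<And>B. bd e B = c B"
      by (auto simp: bdy_def)
    have "e A = 0" for A
    proof (rule ccontr)
      assume "e A \<noteq> 0"
      then have A: "A \<in> Dl (rees G {0} (Suc k)) (g + a)" "card A = Suc i" using e(1) by (auto simp: chain_def)
      then obtain n where n: "n \<in> rees G {0} (Suc k)" "g + a = exS A + n" by (auto simp: Dl_iff)
      \<comment> \<open>The left side is \<open>i + d * Suc k\<close>, whereas the right side is at
        least \<open>Suc i + d * Suc k\<close>.\<close>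
      have "mdeg (g + a) = mdeg (exS A + n)" using n(2) by simp
      then show False using mdeg_rees_ge[OF G n(1)] A(2) deg G[OF g] by simp
    qed
    then have "c B = 0" for B using e(2)[of B] by (simp add: bd_def)
    then have "bdy i (Dl (rees G {0} k) a) c"
      unfolding bdy_def by (intro exI[of _ "\<lambda>_. 0"]) (simp add: chain_def bd_def)
    then show False using c(2) by simp
  qed
  then show ?thesis using cy unfolding torc_def by blast
qed

text \<open>From \<open>k1\<close> on, the nonvanishing multidegrees of level \<open>k + 1\<close>
  are those of level \<open>k\<close> plus generators of \<open>I\<close>:
  \<open>rees_homology_step\<close> gives one inclusion, \<open>HS_power_closed\<close> the other.
  So \<open>B\<close> is the set of these multidegrees at level \<open>k1\<close>, all of degree
  \<open>i + d * k1\<close>.\<close>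

theorem HS_eventually_rees:
  fixes I :: "('x::finite, 'k::field) mpol set"
  assumes I: "monomial_ideal I" and lin: "linear_powers I"
  shows "\<exists>k1. (\<exists>J. \<forall>l. HS i (ideal_pow I (l + k1)) = J) \<or>
     (\<exists>G B d e. finite G \<and> G \<noteq> {} \<and> (\<forall>g\<in>G. mdeg g = d) \<and> d > 0 \<and>
        finite B \<and> B \<noteq> {} \<and> (\<forall>b\<in>B. mdeg b = e) \<and>
        (\<forall>l. HS i (ideal_pow I (l + k1)) = mideal (rees G B l)))"
proof -
  obtain G0 where G0: "finite G0" "I = mideal (upclosure G0)" using monomial_ideal_finite_gens[OF I] by blast
  have "rees G0 {0} 1 = upclosure G0"
    by (auto simp: rees_def upclosure_def nsums_Suc)
  then have I1: "ideal_pow I 1 = mideal (upclosure G0)" using ideal_pow_mideal[of G0 1] G0(2) by simp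
  have "linear_resolution (ideal_pow I 1)" using lin unfolding linear_powers_def by blast
  then have "linear_resolution (mideal (upclosure G0) :: ('x, 'k) mpol set)" unfolding I1 .
  then obtain d where d: "upclosure G0 = upclosure {a \<in> upclosure G0. mdeg a = d}"
    using linear_resolution_mideal[OF upset_upclosure] by blast
  define G where "G = {a \<in> upclosure G0. mdeg a = d}"
  have IG: "I = mideal (upclosure G)" using d G0(2) by (simp add: G_def)
  have finG: "finite G" unfolding G_def by (rule finite_subset[OF _ finite_mdeg_le[of d]]) auto
  have dG: "g \<in> G \<Longrightarrow> mdeg g = d" for g by (simp add: G_def)
  define T where "T k = {a. torc TYPE('k) i (Dl (rees G {0} k) a)}" for k
  have HS: "HS i (ideal_pow I k) = mideal (upclosure (T k))" for k
    unfolding HS_eq_mideal IG ideal_pow_mideal T_def tor_multi_nonzero_mideal[OF upset_rees] ..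
  show ?thesis
  proof (cases "G = {} \<or> d = 0")
    case True
    \<comment> \<open>Here \<open>I\<close> is zero or the whole ring, and its powers agree from
      exponent 1 on; exponent 0 is excluded because the zeroth power of the zero ideal is
      \<open>S\<close>.\<close>
    have "rees G {0} (l + 1) = rees G {0} 1" for l
    proof (cases "G = {}")
      case True
      then show ?thesis by (simp add: rees_def nsums_Suc)
    next
      case False
      then have "G = {0}" using True dG by (metis empty_iff insertI1 mdeg_eq_0_iff subsetI subset_singletonD)
      have "nsums G k = {0}" for k by (induction k) (auto simp: nsums_Suc \<open>G = {0}\<close>)
      then show ?thesis by (simp add: rees_def)
    qed
    then have "HS i (ideal_pow I (l + 1)) = mideal (upclosure (T 1))" for l by (simp only: HS T_def)
    then show ?thesis by blast
  next
    case False
    have deg: "mdeg a = i + d * k" if "a \<in> T k" "k \<ge> 1" for a k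
    proof (rule rees_homology_degree[where 'k = 'k, OF dG])
      show "linear_resolution (mideal (rees G {0} k) :: ('x, 'k) mpol set)"
        using lin that(2) unfolding linear_powers_def IG ideal_pow_mideal by blast
    qed (use False that in \<open>auto simp: T_def\<close>)
    obtain k0 where k0: "\<And>i a l. k0 \<le> l \<Longrightarrow> torc TYPE('k) i (Dl (rees G {0} (Suc l)) a) \<Longrightarrow>
        \<exists>g\<in>G. \<exists>a'. a = g + a' \<and> torc TYPE('k) i (Dl (rees G {0} l) a')"
      using rees_homology_step[OF finG, of "{0}"] by (metis finite.emptyI finite.insertI)
    \<comment> \<open>The maximum with 1 is taken because \<open>linear_powers\<close> says nothing
      about the zeroth power.\<close>
    define k1 where "k1 = max 1 k0"
    have step: "T (Suc k) = {g + a | g a. g \<in> G \<and> a \<in> T k}" if "k \<ge> k1" for k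
    proof (intro equalityI subsetI)
      fix a assume "a \<in> T (Suc k)"
      then show "a \<in> {g + a | g a. g \<in> G \<and> a \<in> T k}"
        using k0[of k i a] that unfolding T_def k1_def by auto
    next
      fix a assume "a \<in> {g + a | g a. g \<in> G \<and> a \<in> T k}"
      then obtain g b where "a = g + b" "g \<in> G" "b \<in> T k" by blast
      moreover from this have "mdeg b = i + d * k" using deg that by (simp add: k1_def)
      ultimately show "a \<in> T (Suc k)"
        using HS_power_closed[of G d g b i k] dG by (simp add: T_def)
    qed
    have T: "T (l + k1) = {s + b | s b. s \<in> nsums G l \<and> b \<in> T k1}" for l
    proof (induction l)
      case (Suc l)
      have "T (Suc l + k1) = {g + a | g a. g \<in> G \<and> a \<in> T (l + k1)}" using step[of "l + k1"] by simp
      also have "\<dots> = {s + b | s b. s \<in> nsums G (Suc l) \<and> b \<in> T k1}"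
        unfolding Suc
      proof (intro equalityI subsetI)
        fix x assume "x \<in> {g + a | g a. g \<in> G \<and> a \<in> {s + b | s b. s \<in> nsums G l \<and> b \<in> T k1}}"
        then obtain g s b where "x = (g + s) + b" "g \<in> G" "s \<in> nsums G l" "b \<in> T k1"
          by (auto simp: add.assoc)
        then show "x \<in> {s + b | s b. s \<in> nsums G (Suc l) \<and> b \<in> T k1}" unfolding nsums_Suc by blast
      next
        fix x assume "x \<in> {s + b | s b. s \<in> nsums G (Suc l) \<and> b \<in> T k1}"
        then obtain g s b where x: "x = g + s + b" "g \<in> G" "s \<in> nsums G l" "b \<in> T k1"
          unfolding nsums_Suc by blast
        then have "x = g + (s + b)" by (simp add: add.assoc)
        then show "x \<in> {g + a | g a. g \<in> G \<and> a \<in> {s + b | s b. s \<in> nsums G l \<and> b \<in> T k1}}"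
          using x by blast
      qed
      finally show ?case .
    qed auto
    have "upclosure (T (l + k1)) = rees G (T k1) l" for l
      unfolding T upclosure_def rees_def by blast
    then have HSl: "HS i (ideal_pow I (l + k1)) = mideal (rees G (T k1) l)" for l by (simp add: HS)
    have degB: "\<forall>b\<in>T k1. mdeg b = i + d * k1" using deg by (simp add: k1_def)
    then have finB: "finite (T k1)" by (intro finite_subset[OF _ finite_mdeg_le[of "i + d * k1"]]) auto
    show ?thesis
    \<comment> \<open>An empty \<open>T k1\<close> stays empty, and then the shift ideals are
      constantly zero.\<close>
    proof (cases "T k1 = {}")
      case True
      then have "rees G (T k1) l = {}" for l by (simp add: rees_def)
      then show ?thesis using HSl by auto
    next
      case ne: False
      show ?thesis
        by (intro exI[of _ k1] disjI2 exI[of _ G] exI[of _ "T k1"] exI[of _ d] exI[of _ "i + d * k1"] conjI)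
          (use False ne finG finB degB dG HSl in auto)
    qed
  qed
qed


section \<open>Associated primes and v-numbers of monomial ideals\<close>

lemma mult_expand:
  fixes f g :: "('x, 'k::field) mpol"
  shows "f * g = (\<Sum>a\<in>keys f. \<Sum>b\<in>keys g. single (a + b) (lookup f a * lookup g b))"
proof -
  have "f * g = (\<Sum>a\<in>keys f. single a (lookup f a)) * (\<Sum>b\<in>keys g. single b (lookup g b))"
    using pm_expand[of f] pm_expand[of g] by simp
  then show ?thesis by (simp add: sum_product mult_single)
qed

text \<open>Nothing cancels at an exponent that arises from a single pair of terms. A monomial order
  supplies such pairs as leading terms.\<close>

lemma lookup_mult_unique:
  fixes f g :: "('x, 'k::field) mpol"
  assumes "\<And>a b. a \<in> keys f \<Longrightarrow> b \<in> keys g \<Longrightarrow> a + b = m + n \<Longrightarrow> a = m \<and> b = n"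
  shows "lookup (f * g) (m + n) = lookup f m * lookup g n"
proof -
  have "lookup (f * g) (m + n) = (\<Sum>a\<in>keys f. \<Sum>b\<in>keys g. lookup f a * lookup g b when a + b = m + n)"
    by (subst mult_expand) (simp add: lookup_sum lookup_single)
  also have "\<dots> = (\<Sum>a\<in>keys f. \<Sum>b\<in>keys g. if b = n then (if a = m then lookup f m * lookup g n else 0) else 0)"
    by (intro sum.cong refl) (use assms in \<open>auto simp: when_def\<close>)
  also have "\<dots> = lookup f m * lookup g n"
    by (cases "n \<in> keys g") (simp_all add: in_keys_iff)
  finally show ?thesis .
qed

lemma lookup_xpow_mult: "lookup (xpow c * f) (c + m) = lookup f m"
  for f :: "('x, 'k::field) mpol"
  using lookup_mult_unique[of "xpow c" f c m] by (simp add: xpow_def)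

lemma keys_xpow_mult: "keys (xpow c * f) = (\<lambda>m. c + m) ` keys f"
  for f :: "('x, 'k::field) mpol"
proof (intro equalityI subsetI)
  fix n assume "n \<in> keys (xpow c * f)"
  then show "n \<in> (\<lambda>m. c + m) ` keys f" using keys_times_subset[of "xpow c" f] by auto
next
  fix n assume "n \<in> (\<lambda>m. c + m) ` keys f"
  then show "n \<in> keys (xpow c * f)" by (auto simp: in_keys_iff lookup_xpow_mult)
qed

section \<open>Monomial primes as colon ideals\<close>

text \<open>The exponents of the prime generated by the variables in \<open>A\<close>; on monomials
  its primality is \<open>vset_add\<close>.\<close>

definition vset :: "'x set \<Rightarrow> 'x mon set" where
  "vset A = {m. \<exists>x\<in>A. lookup m x > 0}"

lemma upset_vset [simp]: "upset (vset A)"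
  by (auto simp: upset_def vset_def lookup_add)

lemma vset_add: "m + n \<in> vset A \<longleftrightarrow> m \<in> vset A \<or> n \<in> vset A"
  by (auto simp: vset_def lookup_add)

lemma zero_notin_vset: "0 \<notin> vset A"
  by (simp add: vset_def)

text \<open>\<open>socle U A c\<close> says that the monomial \<open>x\<^sup>c\<close> satisfies \<open>J : x\<^sup>c = (x\<^sub>i : i \<in> A)\<close> for \<open>J\<close> with exponent
  set \<open>U\<close>.\<close>

definition socle :: "'x mon set \<Rightarrow> 'x set \<Rightarrow> 'x mon \<Rightarrow> bool" where
  "socle U A c \<longleftrightarrow> (\<forall>m. c + m \<in> U \<longleftrightarrow> m \<in> vset A)"

lemma leading_term_exists:
  fixes \<rho> :: "'x mon \<Rightarrow> nat"
  assumes "X \<noteq> {}" "finite X"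
  shows "\<exists>m\<in>X. \<forall>a\<in>X. \<rho> a \<le> \<rho> m"
proof -
  have "Max (\<rho> ` X) \<in> \<rho> ` X" using assms by (intro Max_in) auto
  then obtain m where "m \<in> X" "\<rho> m = Max (\<rho> ` X)" by auto
  then show ?thesis using assms(2) by (intro bexI[of _ m]) auto
qed

lemma leading_term_unique:
  fixes \<rho> :: "'x mon \<Rightarrow> nat"
  assumes \<rho>: "inj \<rho>" "\<And>a b c. \<rho> a < \<rho> b \<Longrightarrow> \<rho> (a + c) < \<rho> (b + c)"
    and le: "\<rho> a \<le> \<rho> m" "\<rho> b \<le> \<rho> n" and eq: "a + b = m + n"
  shows "a = m \<and> b = n"
proof -
  have "\<rho> a = \<rho> m"
  proof (rule ccontr)
    assume "\<rho> a \<noteq> \<rho> m"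
    then have "\<rho> (a + b) < \<rho> (m + b)" using le by (intro \<rho>(2)) simp
    moreover have "\<rho> (b + m) \<le> \<rho> (n + m)"
      using le(2) \<rho>(2)[of b n m] \<rho>(1) by (cases "b = n") (auto simp: inj_eq le_less)
    ultimately show False using eq by (simp add: add.commute)
  qed
  then have "a = m" using \<rho>(1) by (simp add: inj_eq)
  then show ?thesis using eq by simp
qed

text \<open>Leading terms are taken among the terms outside the ideal. Their product stays outside
  it and cannot be cancelled.\<close>

lemma prime_ideal_vset: "prime_ideal (mideal (vset A) :: ('x::finite, 'k::field) mpol set)"
  unfolding prime_ideal_def
proof (intro conjI allI impI)
  let ?P = "mideal (vset A) :: ('x, 'k) mpol set"
  show P: "is_ideal ?P" by (simp add: is_ideal_mideal)
  have "(1 :: ('x, 'k) mpol) = xpow 0" by (simp add: xpow_def)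
  then show "?P \<noteq> UNIV" using zero_notin_vset[of A] xpow_in_mideal[of 0 "vset A"] by blast
  fix f g :: "('x, 'k) mpol" assume fg: "f * g \<in> ?P"
  show "f \<in> ?P \<or> g \<in> ?P"
  proof (rule ccontr)
    assume no: "\<not> (f \<in> ?P \<or> g \<in> ?P)"
    obtain \<rho> :: "'x mon \<Rightarrow> nat" where \<rho>: "inj \<rho>" "\<And>a b c. \<rho> a < \<rho> b \<Longrightarrow> \<rho> (a + c) < \<rho> (b + c)"
      using monomial_order_exists by blast
    have ex: "\<exists>m\<in>{m \<in> keys h. m \<notin> vset A}. \<forall>a\<in>{m \<in> keys h. m \<notin> vset A}. \<rho> a \<le> \<rho> m"
      if "h \<notin> ?P" for h :: "('x, 'k) mpol"
      using that by (intro leading_term_exists) (auto simp: mideal_def)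
    obtain m where m: "m \<in> keys f" "m \<notin> vset A" "\<And>a. a \<in> keys f \<Longrightarrow> a \<notin> vset A \<Longrightarrow> \<rho> a \<le> \<rho> m"
      using ex[of f] no by auto
    obtain n where n: "n \<in> keys g" "n \<notin> vset A" "\<And>a. a \<in> keys g \<Longrightarrow> a \<notin> vset A \<Longrightarrow> \<rho> a \<le> \<rho> n"
      using ex[of g] no by auto
    have mn: "m + n \<notin> vset A" using m n by (simp add: vset_add)
    have "lookup (f * g) (m + n) = lookup f m * lookup g n"
    proof (rule lookup_mult_unique)
      fix a b assume ab: "a \<in> keys f" "b \<in> keys g" "a + b = m + n"
      then have "a \<notin> vset A" "b \<notin> vset A" using mn vset_add[of a b A] by auto
      then have "\<rho> a \<le> \<rho> m" "\<rho> b \<le> \<rho> n" using ab m(3) n(3) by auto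
      then show "a = m \<and> b = n" using leading_term_unique[OF \<rho>] ab(3) by blast
    qed
    then have "m + n \<in> keys (f * g)" using m(1) n(1) by (simp add: in_keys_iff)
    then show False using fg mn by (auto simp: mideal_def)
  qed
qed

lemma colon_mideal_xpow:
  "socle U A c \<Longrightarrow> colon (mideal U) (xpow c) = (mideal (vset A) :: ('x, 'k::field) mpol set)"
  by (auto simp: colon_def mideal_def mult.commute[of _ "xpow c"] keys_xpow_mult socle_def)

text \<open>If no term of \<open>f\<close> had the prime as its colon ideal, each would be
  multiplied into the ideal by a monomial outside the prime; the product of these monomials would do
  so for \<open>f\<close>. Thus v-numbers are attained by monomials.\<close>

lemma socle_of_colon:
  fixes f :: "('x, 'k::field) mpol"
  assumes U: "upset U" and P: "colon (mideal U) f = mideal (vset A)"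
  shows "\<exists>c\<in>keys f. socle U A c"
proof (rule ccontr)
  assume no: "\<not> ?thesis"
  have "c + m \<in> U" if "c \<in> keys f" "m \<in> vset A" for c m
  proof -
    have "xpow m \<in> colon (mideal U) f" unfolding P using that by simp
    then have "xpow m * f \<in> mideal U" by (simp add: colon_def)
    then show ?thesis using that(1) by (auto simp: mideal_def keys_xpow_mult add.commute)
  qed
  then have "\<forall>c\<in>keys f. \<exists>m. c + m \<in> U \<and> m \<notin> vset A" using no unfolding socle_def by blast
  then obtain \<mu> where \<mu>: "\<And>c. c \<in> keys f \<Longrightarrow> c + \<mu> c \<in> U" "\<And>c. c \<in> keys f \<Longrightarrow> \<mu> c \<notin> vset A" by metis
  \<comment> \<open>Exponent of the product of the chosen monomials; it avoids the prime because
    each factor does.\<close>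
  define m where "m = (\<Sum>c\<in>keys f. \<mu> c)"
  have "sum \<mu> X \<notin> vset A" if "finite X" "X \<subseteq> keys f" for X
    using that \<mu>(2) by (induction X) (auto simp: zero_notin_vset vset_add)
  then have "m \<notin> vset A" by (simp add: m_def)
  have "m + c \<in> U" if "c \<in> keys f" for c
  proof -
    have "m = \<mu> c + sum \<mu> (keys f - {c})" unfolding m_def by (simp add: sum.remove[OF _ that])
    then have "m + c = (c + \<mu> c) + sum \<mu> (keys f - {c})" by (simp add: ac_simps)
    then show ?thesis using upsetD[OF U \<mu>(1)[OF that]] by simp
  qed
  then have "xpow m \<in> colon (mideal U) f" by (auto simp: colon_def mideal_def keys_xpow_mult)
  then show False using \<open>m \<notin> vset A\<close> unfolding P by simp
qed

lemma colon_cong: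
  "is_ideal J \<Longrightarrow> f - g \<in> J \<Longrightarrow> colon J f = colon J g"
proof -
  assume J: "is_ideal J" and fg: "f - g \<in> J"
  have "h * f = h * g + h * (f - g)" "h * g = h * f - h * (f - g)" for h by (simp_all add: algebra_simps)
  then show ?thesis
    unfolding colon_def by (metis J fg ideal_add ideal_diff ideal_mult_left)
qed

text \<open>Choosing \<open>f\<close> with the fewest terms forces the leading monomials of all elements of
  \<open>P = J : f\<close> to lie in \<open>P\<close>.\<close>

lemma associated_prime_monomial:
  fixes f :: "('x::finite, 'k::field) mpol"
  assumes U: "upset U" and f: "colon (mideal U) f = P" and P: "prime_ideal P"
  shows "\<exists>A. P = mideal (vset A)"
proof -
  have J: "is_ideal (mideal U :: ('x, 'k) mpol set)" using U by (rule is_ideal_mideal)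
  have Pid: "is_ideal P" and P1: "P \<noteq> UNIV" and Pp: "\<And>g h. g * h \<in> P \<Longrightarrow> g \<in> P \<or> h \<in> P"
    using P by (auto simp: prime_ideal_def)
  obtain \<rho> :: "'x mon \<Rightarrow> nat" where \<rho>: "inj \<rho>" "\<And>a b c. \<rho> a < \<rho> b \<Longrightarrow> \<rho> (a + c) < \<rho> (b + c)"
    using monomial_order_exists by blast
  obtain f where f: "colon (mideal U) f = P"
      "\<And>g. colon (mideal U) g = P \<Longrightarrow> card (keys f) \<le> card (keys g)"
    using ex_has_least_nat[of "\<lambda>f. colon (mideal U) f = P" f "\<lambda>f. card (keys f)"] f by blast
  have lead: "\<exists>m\<in>keys h. \<forall>a\<in>keys h. \<rho> a \<le> \<rho> m" if "h \<noteq> 0" for h :: "('x, 'k) mpol"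
    using that by (intro leading_term_exists) simp_all
  have fne: "f \<noteq> 0"
  proof
    assume "f = 0"
    then have "P = UNIV" using f(1) ideal_0[OF J] by (auto simp: colon_def)
    then show False using P1 by simp
  qed
  have lead_in: "xpow m \<in> P"
    if h: "h \<in> P" and m: "m \<in> keys h" "\<And>a. a \<in> keys h \<Longrightarrow> \<rho> a \<le> \<rho> m" for h m
  proof (rule ccontr)
    assume nm: "xpow m \<notin> P"
    obtain c where c: "c \<in> keys f" "\<And>a. a \<in> keys f \<Longrightarrow> \<rho> a \<le> \<rho> c" using lead[OF fne] by blast
    have "lookup (h * f) (m + c) = lookup h m * lookup f c"
    proof (rule lookup_mult_unique)
      fix a b assume ab: "a \<in> keys h" "b \<in> keys f" "a + b = m + c"
      then have "\<rho> a \<le> \<rho> m" "\<rho> b \<le> \<rho> c" using c(2) m(2) by auto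
      then show "a = m \<and> b = c" using leading_term_unique[OF \<rho>] ab(3) by blast
    qed
    then have "m + c \<in> keys (h * f)" using m(1) c(1) by (simp add: in_keys_iff)
    moreover have "h * f \<in> mideal U" using h unfolding f(1)[symmetric] by (simp add: colon_def)
    ultimately have mc: "m + c \<in> U" by (auto simp: mideal_def)
    \<comment> \<open>Multiplying \<open>f\<close> by \<open>x\<^sup>m\<close>, which lies outside
      the prime \<open>P\<close>, does not change the colon ideal. The leading term of the product
      lies in the ideal and may be dropped, leaving fewer terms than \<open>f\<close> has.\<close>
    define f3 where "f3 = pfilter (\<lambda>a. a \<notin> U) (xpow m * f)"
    have "xpow m * f - f3 \<in> mideal U"
      by (auto simp: mideal_def in_keys_iff lookup_minus f3_def lookup_pfilter split: if_splits)
    then have "colon (mideal U) f3 = colon (mideal U) (xpow m * f)" using colon_cong[OF J] by metis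
    also have "\<dots> = P"
    proof (intro equalityI subsetI)
      fix g assume "g \<in> colon (mideal U) (xpow m * f)"
      then have "g * xpow m \<in> colon (mideal U) f" by (simp add: colon_def mult.assoc)
      then show "g \<in> P" unfolding f(1) using Pp nm by blast
    next
      fix g assume "g \<in> P"
      then have "xpow m * (g * f) \<in> mideal U"
        unfolding f(1)[symmetric] using ideal_mult_left[OF J] by (simp add: colon_def)
      then show "g \<in> colon (mideal U) (xpow m * f)" by (simp add: colon_def mult.left_commute)
    qed
    finally have "card (keys f) \<le> card (keys f3)" by (rule f(2))
    moreover have "keys f3 \<subseteq> (\<lambda>a. m + a) ` (keys f - {c})"
    proof
      fix n assume "n \<in> keys f3"
      then have n: "n \<in> keys (xpow m * f)" "n \<notin> U"
        by (auto simp: f3_def in_keys_iff lookup_pfilter split: if_splits)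
      then obtain a where "n = m + a" "a \<in> keys f" by (auto simp: keys_xpow_mult)
      then show "n \<in> (\<lambda>a. m + a) ` (keys f - {c})" using n(2) mc by auto
    qed
    then have "card (keys f3) \<le> card (keys f - {c})"
      by (meson card_image_le card_mono finite_Diff finite_imageI finite_keys le_trans)
    moreover have "card (keys f - {c}) < card (keys f)" using c(1) by (intro card_Diff1_less) auto
    ultimately show False by linarith
  qed
  \<comment> \<open>Since the leading monomial belongs to \<open>P\<close>, subtracting the leading
    term stays inside \<open>P\<close> and the remaining terms follow by induction on their
    number.\<close>
  have terms: "xpow k \<in> P" if "h \<in> P" "k \<in> keys h" for h k
    using that
  proof (induction "card (keys h)" arbitrary: h rule: less_induct)
    case less
    then have "h \<noteq> 0" by auto
    then obtain m where m: "m \<in> keys h" "\<And>a. a \<in> keys h \<Longrightarrow> \<rho> a \<le> \<rho> m" using lead by blast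
    have xm: "xpow m \<in> P" by (rule lead_in[OF less.prems(1) m])
    show ?case
    proof (cases "k = m")
      case False
      define h' where "h' = h - single 0 (lookup h m) * xpow m"
      have lk: "lookup h' a = (if a = m then 0 else lookup h a)" for a
        by (simp add: h'_def single_eq_xpow[symmetric] lookup_minus lookup_single when_def)
      have keys: "keys h' = keys h - {m}"
      proof (rule set_eqI)
        fix a show "a \<in> keys h' \<longleftrightarrow> a \<in> keys h - {m}" using lk[of a] by (simp add: in_keys_iff)
      qed
      have "card (keys h') < card (keys h)"
        unfolding keys by (rule card_Diff1_less[OF finite_keys m(1)])
      moreover have "k \<in> keys h'" unfolding keys using False less.prems(2) by blast
      moreover have "h' \<in> P"
        unfolding h'_def by (intro ideal_diff[OF Pid] ideal_mult_left[OF Pid] less.prems xm)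
      ultimately show ?thesis using less.hyps by blast
    qed (simp add: xm)
  qed
  define A where "A = {x. xpow (ex1 x) \<in> P}"
  have xpow_P: "xpow k \<in> P \<longleftrightarrow> k \<in> vset A" for k
  proof
    assume "k \<in> vset A"
    then obtain x where "x \<in> A" "mle (ex1 x) k" by (auto simp: vset_def ex1_le_iff)
    then have "xpow (ex1 x) \<in> P" "xpow k = xpow (k - ex1 x) * (xpow (ex1 x) :: ('x, 'k) mpol)"
      by (auto simp: A_def xpow_mult mle_diff')
    then show "xpow k \<in> P" by (simp add: ideal_mult_left[OF Pid])
  next
    assume "xpow k \<in> P"
    then show "k \<in> vset A"
    proof (induction "mdeg k" arbitrary: k rule: less_induct)
      case less
      have "k \<noteq> 0"
      proof
        assume "k = 0"
        then have "1 \<in> P" using less.prems by (simp add: xpow_def)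
        then show False using P1 ideal_eq_UNIV_iff[OF Pid] by simp
      qed
      then obtain y where "lookup k y \<noteq> 0" by (metis lookup_zero poly_mapping_eqI)
      then obtain k' where k': "k = ex1 y + k'" using ex1_le_iff[of y k] by (auto simp: mle_iff)
      then have "xpow (ex1 y) * xpow k' \<in> P" using less.prems by (simp add: xpow_mult)
      then consider "xpow (ex1 y) \<in> P" | "xpow k' \<in> P" using Pp by blast
      then show ?case
      proof cases
        case 1
        then have "y \<in> A" by (simp add: A_def)
        then show ?thesis using k' by (auto simp: vset_def lookup_add lookup_ex1)
      next
        case 2
        then have "k' \<in> vset A" using less.hyps[of k'] k' by simp
        then show ?thesis using k' by (simp add: vset_add)
      qed
    qed
  qed
  have "P \<subseteq> mideal (vset A)" using terms xpow_P by (auto simp: mideal_def)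
  moreover have "mideal (vset A) \<subseteq> P" using xpow_P by (intro mideal_subset_ideal[OF Pid]) simp
  ultimately show ?thesis by blast
qed

lemma Ass_mideal:
  assumes "upset U"
  shows "Ass (mideal U :: ('x::finite, 'k::field) mpol set) = {mideal (vset A) | A. \<exists>c. socle U A c}"
proof (intro equalityI subsetI)
  fix P :: "('x, 'k) mpol set" assume "P \<in> Ass (mideal U)"
  then obtain f where f: "prime_ideal P" "colon (mideal U) f = P" by (auto simp: Ass_def)
  then obtain A where A: "P = mideal (vset A)" using associated_prime_monomial[OF assms] by blast
  then show "P \<in> {mideal (vset A) | A. \<exists>c. socle U A c}" using socle_of_colon[OF assms, of f A] f(2) by blast
next
  fix P :: "('x, 'k) mpol set" assume "P \<in> {mideal (vset A) | A. \<exists>c. socle U A c}"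
  then obtain A c where "P = mideal (vset A)" "socle U A c" by blast
  then show "P \<in> Ass (mideal U)"
    unfolding Ass_def using prime_ideal_vset[of A] colon_mideal_xpow[of U A c, symmetric] by blast
qed

lemma vnum_at_mideal:
  assumes "upset U"
  shows "vnum_at (mideal (vset A)) (mideal U :: ('x::finite, 'k::field) mpol set)
    = (LEAST d. \<exists>c. mdeg c = d \<and> socle U A c)"
  unfolding vnum_at_def
proof (intro arg_cong[where f = Least] ext iffI)
  fix d assume "\<exists>f\<in>hcomp d. colon (mideal U) f = (mideal (vset A) :: ('x, 'k) mpol set)"
  then obtain f :: "('x, 'k) mpol" where f: "f \<in> hcomp d" "colon (mideal U) f = mideal (vset A)" by blast
  then show "\<exists>c. mdeg c = d \<and> socle U A c" using socle_of_colon[OF assms f(2)] by (auto simp: hcomp_def)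
next
  fix d assume "\<exists>c. mdeg c = d \<and> socle U A c"
  then obtain c where "mdeg c = d" "socle U A c" by blast
  then show "\<exists>f\<in>hcomp d. colon (mideal U) f = (mideal (vset A) :: ('x, 'k) mpol set)"
    using colon_mideal_xpow[of U A c] by (intro bexI[of _ "xpow c"]) (auto simp: hcomp_def)
qed

section \<open>Finite generation and convexity of the socle pairs\<close>

lemma qle_translate: "qle G (a, k) (b, l) \<Longrightarrow> qle G (a + m, k) (b + m, l)"
  unfolding qle_def by (force simp: ac_simps)

text \<open>The lower pair forces the colon ideal in the middle to contain the prime; the upper pair
  forces it to be contained in the prime.\<close>

lemma socle_convex:
  assumes "socle (rees G B k0) A c0" "qle G (c0, k0) (c', k')" "qle G (c', k') (c, k)" "socle (rees G B k) A c"
  shows "socle (rees G B k') A c'"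
  unfolding socle_def
proof (intro allI iffI)
  fix m assume "m \<in> vset A"
  then have "c0 + m \<in> rees G B k0" using assms(1) by (simp add: socle_def)
  then show "c' + m \<in> rees G B k'" using rees_qle qle_translate[OF assms(2)] by blast
next
  fix m assume "c' + m \<in> rees G B k'"
  then have "c + m \<in> rees G B k" using rees_qle qle_translate[OF assms(3)] by blast
  then show "m \<in> vset A" using assms(4) by (simp add: socle_def)
qed

text \<open>For \<open>x\<close> in \<open>A\<close>, multiplying by \<open>x\<close> moves the
  monomial into \<open>I\<^sup>l J\<close>. In the resulting factorization \<open>x\<close> divides
  the free monomial, the generator of \<open>J\<close> or one of the \<open>l\<close> generators of
  \<open>I\<close>. The first two cases lead to \<open>(b - ex1 x, 0)\<close>; the third destroys
  one generator of \<open>I\<close> and leads to \<open>(b, 1)\<close>.\<close>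

lemma socle_qle:
  assumes "socle (rees G B l) A c" "rees G B l \<noteq> {}"
  shows "\<exists>v\<in>(\<lambda>b. (b, 1)) ` B \<union> (\<lambda>(b, x). (b - ex1 x, 0)) ` (B \<times> UNIV). qle G v (c, l)"
proof -
  \<comment> \<open>For empty \<open>A\<close> the prime is zero, but the colon ideal contains the
    nonzero ideal itself.\<close>
  have "A \<noteq> {}"
  proof
    assume "A = {}"
    obtain u where "u \<in> rees G B l" using assms(2) by blast
    then have "c + u \<in> rees G B l" using upsetD[OF upset_rees, of u G B l c] by (simp add: add.commute)
    then show False using assms(1) \<open>A = {}\<close> by (auto simp: socle_def vset_def)
  qed
  then obtain x where "x \<in> A" by blast
  then have "ex1 x \<in> vset A" by (auto simp: vset_def lookup_ex1)
  then have "c + ex1 x \<in> rees G B l" using assms(1) by (simp add: socle_def)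
  then obtain s b m where c: "c + ex1 x = s + b + m" "s \<in> nsums G l" "b \<in> B" by (auto simp: rees_def)
  have "lookup c x + 1 = lookup s x + lookup b x + lookup m x"
    using arg_cong[OF c(1), of "\<lambda>p. lookup p x"] by (simp add: lookup_add lookup_ex1)
  then consider "mle (ex1 x) m" | "mle (ex1 x) b" | "lookup s x > 0"
    unfolding ex1_le_iff by linarith
  then show ?thesis
  proof cases
    case 1
    then obtain m' where "m = ex1 x + m'" by (auto simp: mle_iff)
    then have "c + ex1 x = (s + b + m') + ex1 x" using c(1) by (simp add: ac_simps)
    then have "c = s + b + m'" by simp
    \<comment> \<open>Subtraction is truncated, so \<open>b - ex1 x\<close> may equal
      \<open>b\<close>; the difference is absorbed into the free monomial.\<close>
    moreover have "b = (b - ex1 x) + (b - (b - ex1 x))"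
      by (rule poly_mapping_eqI) (simp add: lookup_add lookup_minus)
    ultimately have "c = (b - ex1 x) + s + ((b - (b - ex1 x)) + m')" by (metis add.assoc add.commute)
    then have "qle G (b - ex1 x, 0) (c, l)" unfolding qle_def using c(2) by auto
    then show ?thesis using c(3) by (intro bexI[of _ "(b - ex1 x, 0)"]) auto
  next
    case 2
    then have "c + ex1 x = ((b - ex1 x) + s + m) + ex1 x"
      using c(1) mle_diff'[of "ex1 x" b] by (metis add.assoc add.commute)
    then have "c = (b - ex1 x) + s + m" by simp
    then have "qle G (b - ex1 x, 0) (c, l)" unfolding qle_def using c(2) by auto
    then show ?thesis using c(3) by (intro bexI[of _ "(b - ex1 x, 0)"]) auto
  next
    case 3
    obtain M where M: "s = sum_mset M" "set_mset M \<subseteq> G" "size M = l" using c(2) by (auto simp: nsums_def)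
    have "\<exists>g\<in>#M. lookup g x > 0"
    proof (rule ccontr)
      assume "\<not> ?thesis"
      then have "\<forall>g\<in>#M. lookup g x = 0" by auto
      then have "lookup s x = 0" unfolding M(1) lookup_sum_mset by (induction M) auto
      then show False using 3 by simp
    qed
    then obtain g where g: "g \<in># M" "mle (ex1 x) g" by (auto simp: ex1_le_iff)
    then obtain N where N: "M = add_mset g N" by (metis multi_member_split)
    obtain g' where g': "g = ex1 x + g'" using g(2) by (auto simp: mle_iff)
    have "c + ex1 x = (b + sum_mset N + (g' + m)) + ex1 x"
      unfolding c(1) M(1) N g' by (simp add: ac_simps)
    then have "c = b + sum_mset N + (g' + m)" by simp
    moreover have "1 \<le> l" "sum_mset N \<in> nsums G (l - 1)" using M N by (auto simp: nsums_def)
    ultimately have "qle G (b, 1) (c, l)" unfolding qle_def by auto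
    then show ?thesis using c(3) by (intro bexI[of _ "(b, 1)"]) auto
  qed
qed

lemma bounded_mono_eventually_const:
  fixes w :: "nat \<Rightarrow> int"
  assumes mono: "\<And>l. L \<le> l \<Longrightarrow> w l \<le> w (Suc l)" and bound: "\<And>l. L \<le> l \<Longrightarrow> w l \<le> C"
  shows "\<exists>L' v. L \<le> L' \<and> (\<forall>l\<ge>L'. w l = v)"
proof -
  have mono': "w l \<le> w l'" if "L \<le> l" "l \<le> l'" for l l'
    using that(2,1) by (induction rule: dec_induct) (auto intro: order_trans mono)
  have fin: "finite (w ` {L..})"
    by (rule finite_subset[of _ "{w L..C}"]) (auto intro: mono' bound)
  have "Max (w ` {L..}) \<in> w ` {L..}" by (rule Max_in[OF fin]) auto
  then obtain L' where L': "L \<le> L'" "w L' = Max (w ` {L..})" by auto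
  have "w l = w L'" if "l \<ge> L'" for l
  proof (rule antisym)
    show "w l \<le> w L'" unfolding L'(2) using L'(1) that by (intro Max_ge[OF fin]) auto
    show "w L' \<le> w l" using L'(1) that by (intro mono')
  qed
  then show ?thesis using L'(1) by blast
qed

lemma rees_nonempty: "G \<noteq> {} \<Longrightarrow> B \<noteq> {} \<Longrightarrow> rees G B l \<noteq> {}"
  using nsums_nonempty[of G l] reesI[of _ G l _ B 0] by blast

text \<open>A finite set \<open>N0\<close> generates the pairs \<open>(c, l)\<close> satisfying
  \<open>socle\<close>, and \<open>L\<close> bounds its levels. Beyond \<open>L\<close> existence at
  one level implies existence at the level below, so it can only be lost; and the least degree minus
  \<open>d * l\<close> is nondecreasing and bounded by means of \<open>N0\<close>.\<close>

lemma socle_eventually: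
  fixes G :: "('x::finite) mon set"
  assumes G: "finite G" "G \<noteq> {}" "\<forall>g\<in>G. mdeg g = d" and B: "finite B" "B \<noteq> {}"
  shows "\<exists>L w. (\<forall>l\<ge>L. \<not> (\<exists>c. socle (rees G B l) A c)) \<or>
    (\<forall>l\<ge>L. (\<exists>c. socle (rees G B l) A c) \<and>
       int (LEAST e. \<exists>c. mdeg c = e \<and> socle (rees G B l) A c) = int d * int l + w)"
proof -
  have Gd: "mdeg g = d" if "g \<in> G" for g using G(3) that by simp
  define E where "E l \<longleftrightarrow> (\<exists>c. socle (rees G B l) A c)" for l
  define v where "v l = (LEAST e. \<exists>c. mdeg c = e \<and> socle (rees G B l) A c)" for l
  obtain N0 where N0': "finite N0 \<and> N0 \<subseteq> {(c, l). socle (rees G B l) A c} \<and>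
      (\<forall>p\<in>{(c, l). socle (rees G B l) A c}. \<exists>q\<in>N0. qle G q p)"
  proof (rule exE[OF qle_noetherian[OF G(1),
          of "(\<lambda>b. (b, 1)) ` B \<union> (\<lambda>(b, x). (b - ex1 x, 0)) ` (B \<times> UNIV)"]])
    show "finite ((\<lambda>b. (b, 1 :: nat)) ` B \<union> (\<lambda>(b, x). (b - ex1 x, 0)) ` (B \<times> UNIV))"
      using B(1) by simp
    fix p assume "p \<in> {(c, l). socle (rees G B l) A c}"
    then obtain c l where p: "p = (c, l)" "socle (rees G B l) A c" by blast
    show "\<exists>v\<in>(\<lambda>b. (b, 1)) ` B \<union> (\<lambda>(b, x). (b - ex1 x, 0)) ` (B \<times> UNIV). qle G v p"
      unfolding p(1) by (rule socle_qle[OF p(2) rees_nonempty[OF G(2) B(2)]])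
  qed
  have N0: "finite N0" "\<And>c l. (c, l) \<in> N0 \<Longrightarrow> socle (rees G B l) A c"
    using N0' by auto
  have N0_gen: "\<exists>c0 l0. (c0, l0) \<in> N0 \<and> qle G (c0, l0) (c, l)" if "socle (rees G B l) A c" for c l
  proof -
    have "(c, l) \<in> {(c, l). socle (rees G B l) A c}" using that by simp
    then obtain q where "q \<in> N0" "qle G q (c, l)" using N0' by meson
    then show ?thesis by (cases q) blast
  qed
  define L where "L = Max (insert 0 (snd ` N0))"
  have L: "l0 \<le> L" if "(c0, l0) \<in> N0" for c0 l0
    unfolding L_def using N0(1) that by (intro Max_ge) (auto intro: image_eqI[of _ snd "(c0, l0)"])
  \<comment> \<open>Removing a generator \<open>g\<close> of \<open>I\<close> together with the free
    monomial \<open>m\<close> gives a pair between a member of \<open>N0\<close> and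
    \<open>(c, Suc l)\<close>, to which convexity applies.\<close>
  have down: "\<exists>c'. socle (rees G B l) A c' \<and> mdeg c' + d \<le> mdeg c"
    if l: "L \<le> l" and c: "socle (rees G B (Suc l)) A c" for l c
  proof -
    obtain c0 l0 where q: "(c0, l0) \<in> N0" "qle G (c0, l0) (c, Suc l)" using N0_gen[OF c] by blast
    have l0: "l0 \<le> l" "Suc l - l0 = Suc (l - l0)" using L[OF q(1)] l by auto
    then obtain g t m where c': "c = c0 + (g + t) + m" "g \<in> G" "t \<in> nsums G (l - l0)"
      using q(2) unfolding qle_def by (auto simp: nsums_Suc)
    have q1: "qle G (c0, l0) (c0 + t, l)" by (rule qleI[OF l0(1) c'(3)])
    have "c = (c0 + t) + g + m" using c'(1) by (simp add: ac_simps)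
    moreover have "g \<in> nsums G (Suc l - l)" using c'(2) by (simp add: Suc_diff_le nsums_Suc)
    ultimately have q2: "qle G (c0 + t, l) (c, Suc l)" unfolding qle_def by auto
    have "socle (rees G B l) A (c0 + t)" by (rule socle_convex[OF N0(2)[OF q(1)] q1 q2 c])
    moreover have "mdeg (c0 + t) + d \<le> mdeg c" using c'(1) Gd[OF c'(2)] by simp
    ultimately show ?thesis by blast
  qed
  have vleast: "v l \<le> mdeg c" if "socle (rees G B l) A c" for l c
    unfolding v_def using that by (intro Least_le) blast
  have vex: "\<exists>c. mdeg c = v l \<and> socle (rees G B l) A c" if "E l" for l
    unfolding v_def by (rule LeastI_ex) (use that in \<open>auto simp: E_def\<close>)
  show ?thesis
  proof (cases "\<forall>l\<ge>L. E l")
    case False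
    then obtain L1 where L1: "L \<le> L1" "\<not> E L1" by blast
    have "\<not> E l" if "L1 \<le> l" for l
      using that
    proof (induction rule: dec_induct)
      case (step l)
      then show ?case using down[of l] L1(1) unfolding E_def by auto
    qed (rule L1(2))
    then show ?thesis unfolding E_def by blast
  next
    case True
    define w where "w l = int (v l) - int d * int l" for l
    have "w l \<le> w (Suc l)" if l: "L \<le> l" for l
    proof -
      obtain c where c: "mdeg c = v (Suc l)" "socle (rees G B (Suc l)) A c" using vex True l by (meson le_SucI)
      obtain c' where c': "socle (rees G B l) A c'" "mdeg c' + d \<le> mdeg c" using down[OF l c(2)] by blast
      have "v l + d \<le> v (Suc l)" using vleast[OF c'(1)] c'(2) c(1) by simp
      then show ?thesis unfolding w_def by (simp add: algebra_simps)
    qed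
    moreover define C where "C = Max (insert 0 ((\<lambda>(c0, l0). int (mdeg c0) - int d * int l0) ` N0))"
    have "w l \<le> C" if l: "L \<le> l" for l
    proof -
      obtain c where c: "mdeg c = v l" "socle (rees G B l) A c" using vex True l by blast
      obtain c0 l0 where q: "(c0, l0) \<in> N0" "qle G (c0, l0) (c, l)" using N0_gen[OF c(2)] by blast
      then obtain s m where s: "l0 \<le> l" "s \<in> nsums G (l - l0)" "c = c0 + s + m" unfolding qle_def by auto
      \<comment> \<open>Dropping \<open>m\<close> gives a pair of the same level between
        \<open>(c0, l0)\<close> and \<open>(c, l)\<close>; its degree is determined by
        \<open>c0\<close> and \<open>l - l0\<close>, whence the bound \<open>C\<close>.\<close>
      have "qle G (c0 + s, l) (c, l)" using s(3) unfolding qle_def by auto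
      then have "socle (rees G B l) A (c0 + s)"
        using socle_convex[OF N0(2)[OF q(1)] qleI[OF s(1,2)] _ c(2)] by blast
      then have "v l \<le> mdeg (c0 + s)" by (rule vleast)
      moreover have "mdeg s = d * (l - l0)" by (rule mdeg_nsums[OF Gd s(2)])
      ultimately have "v l \<le> mdeg c0 + d * (l - l0)" by simp
      then have "int (v l) \<le> int (mdeg c0) + int d * (int l - int l0)"
        using s(1) by (metis of_nat_add of_nat_diff of_nat_le_iff of_nat_mult)
      then have "w l \<le> int (mdeg c0) - int d * int l0" unfolding w_def by (simp add: algebra_simps)
      also have "\<dots> \<le> C" unfolding C_def using N0(1) q(1) by (intro Max_ge) force+
      finally show ?thesis .
    qed
    ultimately obtain L' u where L': "L \<le> L'" "\<forall>l\<ge>L'. w l = u"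
      using bounded_mono_eventually_const[of L w C] by blast
    have "\<forall>l\<ge>L'. E l \<and> int (v l) = int d * int l + u"
      using True L' by (auto simp: w_def algebra_simps)
    then show ?thesis unfolding E_def v_def by blast
  qed
qed

text \<open>There are finitely many sets \<open>A\<close> of variables, so one threshold
  \<open>M\<close> serves all of them.\<close>

theorem Ass_vnum_eventually:
  fixes G :: "('x::finite) mon set"
  assumes G: "finite G" "G \<noteq> {}" "\<forall>g\<in>G. mdeg g = d" and B: "finite B" "B \<noteq> {}"
  shows "\<exists>L S w. finite S \<and> (\<forall>l\<ge>L. Ass (mideal (rees G B l) :: ('x, 'k::field) mpol set) = S \<and>
    (\<forall>P\<in>S. int (vnum_at P (mideal (rees G B l))) = int d * int l + w P))"
proof -
  define v where "v A l = (LEAST e. \<exists>c. mdeg c = e \<and> socle (rees G B l) A c)" for A l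
  define stab where "stab A L w \<longleftrightarrow> (\<forall>l\<ge>L. \<not> (\<exists>c. socle (rees G B l) A c)) \<or>
    (\<forall>l\<ge>L. (\<exists>c. socle (rees G B l) A c) \<and> int (v A l) = int d * int l + w)" for A L w
  have "\<forall>A. \<exists>L. \<exists>w. stab A L w"
    unfolding stab_def v_def using socle_eventually[OF G B] by blast
  then obtain L where "\<forall>A. \<exists>w. stab A (L A) w" by (rule choice[THEN exE])
  then obtain w where "\<forall>A. stab A (L A) (w A)" by (rule choice[THEN exE])
  then have Lw: "stab A (L A) (w A)" for A ..
  define M where "M = Max (range L)"
  have LM: "L A \<le> M" for A by (simp add: M_def)
  define S where "S = {A. \<exists>c. socle (rees G B M) A c}"
  have S: "A \<in> S \<longleftrightarrow> (\<exists>c. socle (rees G B l) A c)" if "M \<le> l" for A l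
  proof -
    have "L A \<le> l" "L A \<le> M" using LM[of A] that by auto
    then show ?thesis using Lw[of A] unfolding S_def stab_def by (elim disjE) simp_all
  qed
  have vS: "int (v A l) = int d * int l + w A" if "M \<le> l" "A \<in> S" for A l
  proof -
    have "L A \<le> l" using LM[of A] that by auto
    then show ?thesis using Lw[of A] S[OF that(1), of A] that(2) unfolding stab_def by (elim disjE) simp_all
  qed
  let ?I = "\<lambda>l. mideal (rees G B l) :: ('x, 'k) mpol set"
  let ?S = "(\<lambda>A. mideal (vset A) :: ('x, 'k) mpol set) ` S"
  \<comment> \<open>The intercept has to be a function of the ideal \<open>P\<close> rather than of
    a set \<open>A\<close> presenting it, so it is read off at level \<open>M\<close>.\<close>
  define W where "W P = int (vnum_at P (?I M)) - int d * int M" for P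
  have "Ass (?I l) = ?S" if "M \<le> l" for l
    unfolding Ass_mideal[OF upset_rees] using S[OF that] by auto
  moreover have "int (vnum_at P (?I l)) = int d * int l + W P" if l: "M \<le> l" and P: "P \<in> ?S" for l P
  proof -
    obtain A where A: "A \<in> S" "P = mideal (vset A)" using P by blast
    have "int (vnum_at P (?I l)) = int d * int l + w A" if "M \<le> l" for l
      unfolding A(2) vnum_at_mideal[OF upset_rees] v_def[symmetric] by (rule vS[OF that A(1)])
    then show ?thesis using l unfolding W_def by simp
  qed
  moreover have "finite ?S" by simp
  ultimately show ?thesis by (intro exI[of _ M] exI[of _ ?S] exI[of _ W] conjI allI impI ballI)
qed


section \<open>Regularity\<close>

text \<open>A monomial of least degree is a minimal generator and so gives a class in
  \<open>J / m J\<close>. The cycle is the indicator of the empty face; a face bounding it would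
  leave an exponent of smaller degree.\<close>

lemma torc_0:
  fixes U :: "('x::finite) mon set"
  assumes a: "a \<in> U" and min: "\<And>n. n \<in> U \<Longrightarrow> mdeg a \<le> mdeg n"
  shows "torc TYPE('k::field) 0 (Dl U a)"
proof -
  define c :: "'x set \<Rightarrow> 'k" where "c A = (if A = {} then 1 else 0)" for A
  have "{} \<in> Dl U a" using a unfolding Dl_iff by (intro bexI[of _ a]) (simp_all add: exS_def)
  then have "cyc 0 (Dl U a) c" by (auto simp: cyc_def chain_def c_def bd_def)
  moreover have "\<not> bdy 0 (Dl U a) c"
  proof
    assume "bdy 0 (Dl U a) c"
    then obtain e :: "'x set \<Rightarrow> 'k" where e: "chain (Suc 0) (Dl U a) e" "\<And>B. bd e B = c B" by (auto simp: bdy_def)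
    have "e A = 0" for A
    proof (rule ccontr)
      assume "e A \<noteq> 0"
      then have "A \<in> Dl U a" "card A = Suc 0" using e(1) by (auto simp: chain_def)
      then obtain n where n: "n \<in> U" "a = exS A + n" "card A = Suc 0" by (auto simp: Dl_iff)
      then have "mdeg a = Suc (mdeg n)" by simp
      then show False using min[OF n(1)] by simp
    qed
    then have "c {} = 0" using e(2)[of "{}"] by (simp add: bd_def)
    then show False by (simp add: c_def)
  qed
  ultimately show ?thesis unfolding torc_def by blast
qed

text \<open>Splitting off a generator of \<open>I\<close> shows that the regularity grows by at most
  \<open>d\<close> per step. The generators of degree \<open>d * l + e\<close> bound it from
  below.\<close>

theorem reg_eventually:
  fixes G :: "('x::finite) mon set"
  assumes G: "finite G" "G \<noteq> {}" "\<forall>g\<in>G. mdeg g = d"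
    and B: "finite B" "B \<noteq> {}" "\<forall>b\<in>B. mdeg b = e"
  shows "\<exists>L w. \<forall>l\<ge>L. reg (mideal (rees G B l) :: ('x, 'k::field) mpol set) = int d * int l + w"
proof -
  have Gd: "mdeg g = d" if "g \<in> G" for g using G(3) that by simp
  have Bd: "mdeg b = e" if "b \<in> B" for b using B(3) that by simp
  define R where "R l = {int (mdeg a) - int i | a i. torc TYPE('k) i (Dl (rees G B l) a)}" for l
  have reg: "reg (mideal (rees G B l) :: ('x, 'k) mpol set) = Max (R l)" for l
  proof -
    obtain u where "u \<in> rees G B l" using rees_nonempty[OF G(2) B(2)] by blast
    then have xu: "xpow u \<in> (mideal (rees G B l) :: ('x, 'k) mpol set)" by simp
    have "keys (xpow u :: ('x, 'k) mpol) \<noteq> keys 0" by simp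
    then have xu0: "xpow u \<noteq> (0 :: ('x, 'k) mpol)" by metis
    have ne: "mideal (rees G B l) \<noteq> ({0} :: ('x, 'k) mpol set)"
    proof
      assume eq: "mideal (rees G B l) = ({0} :: ('x, 'k) mpol set)"
      show False using xu xu0 unfolding eq by simp
    qed
    have "{int j - int i | i j. tor_nonzero i (mideal (rees G B l) :: ('x, 'k) mpol set) j} = R l"
      unfolding R_def tor_nonzero_mideal[OF upset_rees] by auto
    then show ?thesis using ne by (simp add: reg_def)
  qed
  have finR: "finite (R l)" for l
  proof (rule finite_subset)
    show "R l \<subseteq> (\<lambda>(a, i). int (mdeg a) - int i) `
        ({a. \<exists>i. torc TYPE('k) i (Dl (rees G B l) a)} \<times> {..card (UNIV :: 'x set)})"
    proof
      fix r assume "r \<in> R l"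
      then obtain a i where r: "r = int (mdeg a) - int i" "torc TYPE('k) i (Dl (rees G B l) a)"
        by (auto simp: R_def)
      show "r \<in> (\<lambda>(a, i). int (mdeg a) - int i) `
        ({a. \<exists>i. torc TYPE('k) i (Dl (rees G B l) a)} \<times> {..card (UNIV :: 'x set)})"
        using r torc_card_le[OF r(2)] by (intro image_eqI[of _ _ "(a, i)"]) auto
    qed
    show "finite ((\<lambda>(a, i). int (mdeg a) - int i) `
        ({a. \<exists>i. torc TYPE('k) i (Dl (rees G B l) a)} \<times> {..card (UNIV :: 'x set)}))"
      using finite_rees_homology[OF G(1) B(1), where 'k = 'k] by (intro finite_imageI finite_cartesian_product) auto
  qed
  have low: "int d * int l + int e \<in> R l" for l
  proof -
    obtain s b where s: "s \<in> nsums G l" "b \<in> B" using nsums_nonempty[OF G(2)] B(2) by blast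
    have sb: "s + b + 0 \<in> rees G B l" using s by (rule reesI)
    have deg: "mdeg (s + b) = d * l + e" using mdeg_nsums[OF Gd s(1)] Bd[OF s(2)] by simp
    have "torc TYPE('k) 0 (Dl (rees G B l) (s + b))"
    proof (rule torc_0)
      fix n assume "n \<in> rees G B l"
      then obtain s' b' m where n: "n = s' + b' + m" "s' \<in> nsums G l" "b' \<in> B" by (auto simp: rees_def)
      then show "mdeg (s + b) \<le> mdeg n" using mdeg_nsums[OF Gd n(2)] Bd[OF n(3)] deg by simp
    qed (use sb in simp)
    then show ?thesis unfolding R_def using deg by (intro CollectI exI[of _ "s + b"] exI[of _ 0]) simp
  qed
  obtain k1 where k1: "\<And>i a l. k1 \<le> l \<Longrightarrow> torc TYPE('k) i (Dl (rees G B (Suc l)) a) \<Longrightarrow>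
        \<exists>g\<in>G. \<exists>a'. a = g + a' \<and> torc TYPE('k) i (Dl (rees G B l) a')"
    using rees_homology_step[OF G(1) B(1)] by metis
  \<comment> \<open>The sign is opposite to the one used for v-numbers: regularity minus
    \<open>d * l\<close> is nonincreasing.\<close>
  define w where "w l = int d * int l - Max (R l)" for l
  have "w l \<le> w (Suc l)" if kl: "k1 \<le> l" for l
  proof -
    have "Max (R (Suc l)) \<in> R (Suc l)" using low[of "Suc l"] by (intro Max_in finR) auto
    then obtain a i where a: "Max (R (Suc l)) = int (mdeg a) - int i" "torc TYPE('k) i (Dl (rees G B (Suc l)) a)"
      by (auto simp: R_def)
    obtain g a' where g: "g \<in> G" "a = g + a'" "torc TYPE('k) i (Dl (rees G B l) a')"
      using k1[OF kl a(2)] by blast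
    have "int (mdeg a') - int i \<in> R l" using g(3) by (auto simp: R_def)
    then have "int (mdeg a') - int i \<le> Max (R l)" by (rule Max_ge[OF finR])
    then show ?thesis using a(1) g(2) Gd[OF g(1)] by (simp add: w_def algebra_simps)
  qed
  moreover have "w l \<le> 0" for l
    using Max_ge[OF finR low[of l]] by (simp add: w_def)
  ultimately obtain L v where L: "\<forall>l\<ge>L. w l = v"
    using bounded_mono_eventually_const[of k1 w 0] by blast
  have "\<forall>l\<ge>L. reg (mideal (rees G B l) :: ('x, 'k) mpol set) = int d * int l + (- v)"
    using L by (auto simp: reg w_def)
  then show ?thesis by blast
qed

section \<open>Noetherian properties of the polynomial ring\<close>

definition lead_exps :: "('x mon \<Rightarrow> nat) \<Rightarrow> ('x, 'k::field) mpol set \<Rightarrow> 'x mon set" where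
  "lead_exps \<rho> J = {m. \<exists>f\<in>J. m \<in> keys f \<and> (\<forall>a\<in>keys f. \<rho> a \<le> \<rho> m)}"

lemma lookup_const_mult:
  fixes g :: "('x, 'k::field) mpol"
  shows "lookup (single 0 c * g) a = c * lookup g a"
proof -
  have "lookup (single 0 c * g) (0 + a) = lookup (single (0 :: 'x mon) c) 0 * lookup g a"
  proof (rule lookup_mult_unique)
    fix x y assume "x \<in> keys (single (0 :: 'x mon) c)" "x + y = 0 + a"
    then show "x = 0 \<and> y = a" by (auto split: if_splits)
  qed
  then show ?thesis by simp
qed

text \<open>Division with remainder: the leading term of an element of \<open>J'\<close> is
  cancelled by a multiple of an element of \<open>J\<close>, and the rank of the leading monomial
  drops.\<close>

lemma ideal_eq_of_lead_exps:
  fixes J :: "('x, 'k::field) mpol set"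
  assumes \<rho>: "inj \<rho>" and J: "is_ideal J" "is_ideal J'" "J \<subseteq> J'" and le: "lead_exps \<rho> J' \<subseteq> lead_exps \<rho> J"
  shows "J' = J"
proof -
  have "f \<in> J" if "f \<in> J'" "\<And>a. a \<in> keys f \<Longrightarrow> \<rho> a < n" for f n
    using that
  proof (induction n arbitrary: f)
    case 0
    then have "keys f = {}" by blast
    then show ?case using ideal_0[OF J(1)] by simp
  next
    case (Suc n)
    show ?case
    proof (cases "\<exists>m\<in>keys f. \<rho> m = n")
      case False
      then have "\<rho> a < n" if "a \<in> keys f" for a using Suc.prems(2)[OF that] that by (auto simp: less_Suc_eq)
      then show ?thesis using Suc by blast
    next
      case True
      then obtain m where m: "m \<in> keys f" "\<rho> m = n" by blast
      then have "m \<in> lead_exps \<rho> J'" using Suc.prems by (force simp: lead_exps_def less_Suc_eq_le)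
      then obtain g where g: "g \<in> J" "m \<in> keys g" "\<And>a. a \<in> keys g \<Longrightarrow> \<rho> a \<le> n"
        using le m(2) by (auto simp: lead_exps_def)
      define c where "c = lookup f m / lookup g m"
      define r where "r = single 0 c * g"
      have r: "r \<in> J" unfolding r_def by (intro ideal_mult_left J g)
      have lr: "lookup r a = c * lookup g a" for a
        by (simp add: r_def lookup_const_mult)
      have "f - r \<in> J"
      proof (rule Suc.IH)
        show "f - r \<in> J'" using Suc.prems(1) r J by (auto intro: ideal_diff)
        fix a assume a: "a \<in> keys (f - r)"
        have "a \<noteq> m"
        proof
          assume "a = m"
          then have "lookup (f - r) a = 0" using g(2) by (simp add: lookup_minus lr c_def in_keys_iff)
          then show False using a by (simp add: in_keys_iff)
        qed
        moreover have "\<rho> a \<le> n"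
        proof -
          have "a \<in> keys f \<or> a \<in> keys g"
          proof (rule ccontr)
            assume "\<not> ?thesis"
            then have "lookup (f - r) a = 0" by (simp add: lookup_minus lr in_keys_iff)
            then show False using a by (simp add: in_keys_iff)
          qed
          then show ?thesis using Suc.prems(2)[of a] g(3)[of a] by auto
        qed
        ultimately show "\<rho> a < n" using m(2) \<rho> by (auto simp: inj_eq le_less)
      qed
      then show ?thesis using ideal_add[OF J(1) _ r, of "f - r"] by simp
    qed
  qed
  note * = this
  have "f \<in> J" if "f \<in> J'" for f
  proof (rule *[OF that, of "Suc (Max (\<rho> ` keys f))"])
    fix a assume "a \<in> keys f"
    then show "\<rho> a < Suc (Max (\<rho> ` keys f))" by (simp add: less_Suc_eq_le)
  qed
  then show ?thesis using J(3) by blast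
qed

text \<open>In a strictly increasing chain, Dickson's lemma gives finitely many generators for the
  leading exponents of the union. All of them occur at some stage \<open>N\<close>, and equal
  leading exponents stop the chain there.\<close>

lemma ideal_family_has_maximal:
  fixes \<F> :: "('x::finite, 'k::field) mpol set set"
  assumes ideals: "\<And>J. J \<in> \<F> \<Longrightarrow> is_ideal J" and J0: "J0 \<in> \<F>"
  shows "\<exists>M\<in>\<F>. J0 \<subseteq> M \<and> (\<forall>N\<in>\<F>. M \<subseteq> N \<longrightarrow> N = M)"
proof (rule ccontr)
  assume no: "\<not> ?thesis"
  obtain \<rho> :: "'x mon \<Rightarrow> nat" where \<rho>: "inj \<rho>" "\<And>a b c. \<rho> a < \<rho> b \<Longrightarrow> \<rho> (a + c) < \<rho> (b + c)"
    using monomial_order_exists by blast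
  have "\<exists>c. \<forall>n. (c n \<in> \<F> \<and> J0 \<subseteq> c n) \<and> c n \<subset> c (Suc n)"
  proof (rule dependent_nat_choice[where P = "\<lambda>_ J. J \<in> \<F> \<and> J0 \<subseteq> J" and Q = "\<lambda>_ J J'. J \<subset> J'"])
    show "\<exists>J. J \<in> \<F> \<and> J0 \<subseteq> J" using J0 by blast
    fix J and n :: nat assume J: "J \<in> \<F> \<and> J0 \<subseteq> J"
    have "\<not> (\<forall>N\<in>\<F>. J \<subseteq> N \<longrightarrow> N = J)"
    proof
      assume "\<forall>N\<in>\<F>. J \<subseteq> N \<longrightarrow> N = J"
      then have "\<exists>M\<in>\<F>. J0 \<subseteq> M \<and> (\<forall>N\<in>\<F>. M \<subseteq> N \<longrightarrow> N = M)"
        using J by (intro bexI[of _ J] conjI) simp_all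
      with no show False ..
    qed
    then obtain N where "N \<in> \<F>" "J \<subseteq> N" "N \<noteq> J" by auto
    then show "\<exists>J'. (J' \<in> \<F> \<and> J0 \<subseteq> J') \<and> J \<subset> J'"
      using J by (intro exI[of _ N]) auto
  qed
  then obtain c where c: "\<And>n. c n \<in> \<F>" "\<And>n. c n \<subset> c (Suc n)" by blast
  have mono: "c k \<subseteq> c n" if "k \<le> n" for k n
    using that by (rule lift_Suc_mono_le[of c, rotated]) (use c(2) in blast)
  have idc: "is_ideal (c n)" for n by (rule ideals[OF c(1)])
  define W where "W = (\<Union>n. lead_exps \<rho> (c n))"
  obtain X where X: "finite X" "X \<subseteq> W" "\<And>m. m \<in> W \<Longrightarrow> \<exists>n\<in>X. mle n m"
    using dickson[of "UNIV :: 'x set" W lookup, OF finite_UNIV] unfolding mle_def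
    by (elim exE conjE) simp
  have "\<forall>x\<in>X. \<exists>n. x \<in> lead_exps \<rho> (c n)" using X(2) by (auto simp: W_def)
  then obtain \<nu> where \<nu>: "\<And>x. x \<in> X \<Longrightarrow> x \<in> lead_exps \<rho> (c (\<nu> x))" by metis
  define N where "N = Max (insert 0 (\<nu> ` X))"
  have NX: "\<nu> x \<le> N" if "x \<in> X" for x unfolding N_def using X(1) that by (intro Max_ge) auto
  have "lead_exps \<rho> (c (Suc N)) \<subseteq> lead_exps \<rho> (c N)"
  proof
    fix m assume "m \<in> lead_exps \<rho> (c (Suc N))"
    then have "m \<in> W" by (auto simp: W_def)
    then obtain x k where x: "x \<in> X" "m = x + k" using X(3)[of m] by (auto simp: mle_iff)
    then obtain f where f: "f \<in> c (\<nu> x)" "x \<in> keys f" "\<And>a. a \<in> keys f \<Longrightarrow> \<rho> a \<le> \<rho> x"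
      using \<nu>[OF x(1)] by (auto simp: lead_exps_def)
    have "xpow k * f \<in> c N" using mono[OF NX[OF x(1)]] f(1) by (intro ideal_mult_left[OF idc]) blast
    moreover have "m \<in> keys (xpow k * f)" using f(2) x(2) by (auto simp: keys_xpow_mult add.commute)
    moreover have "\<rho> a \<le> \<rho> m" if ak: "a \<in> keys (xpow k * f)" for a
    proof -
      obtain b where b: "a = b + k" "b \<in> keys f" using ak by (auto simp: keys_xpow_mult add.commute)
      show ?thesis using f(3)[OF b(2)] \<rho>(2)[of b x k] \<rho>(1) unfolding b(1) x(2)
        by (cases "b = x") (auto simp: inj_eq le_less)
    qed
    ultimately show "m \<in> lead_exps \<rho> (c N)" unfolding lead_exps_def by blast
  qed
  then have "c (Suc N) = c N"
    using ideal_eq_of_lead_exps[OF \<rho>(1) idc idc] c(2) by blast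
  then show False using c(2)[of N] by simp
qed

section \<open>Prime avoidance and nonzerodivisors\<close>

lemma is_ideal_colon: "is_ideal J \<Longrightarrow> is_ideal (colon J g)"
  unfolding is_ideal_iff colon_def by (auto simp: algebra_simps)

lemma prime_prod:
  assumes P: "prime_ideal P" and X: "finite X" "\<And>x. x \<in> X \<Longrightarrow> h x \<notin> P"
  shows "prod h X \<notin> P"
  using X
proof (induction X)
  case empty
  then show ?case using P ideal_eq_UNIV_iff[of P] by (auto simp: prime_ideal_def)
next
  case (insert x X)
  then show ?case using P by (auto simp: prime_ideal_def)
qed

lemma prod_in_ideal:
  assumes "is_ideal J" "finite X" "x \<in> X" "h x \<in> J" shows "prod h X \<in> J"
  using assms by (simp add: prod.remove[of X x] ideal_mult_right)

text \<open>The hypothesis that no prime contains another one allows a direct induction.\<close>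

lemma prime_avoidance:
  fixes \<P> :: "'a::comm_ring_1 set set"
  assumes M: "is_ideal M" and "finite \<P>" and "\<And>P. P \<in> \<P> \<Longrightarrow> prime_ideal P"
    and "\<And>P Q. P \<in> \<P> \<Longrightarrow> Q \<in> \<P> \<Longrightarrow> Q \<subseteq> P \<Longrightarrow> Q = P" and "\<And>P. P \<in> \<P> \<Longrightarrow> \<not> M \<subseteq> P"
  shows "\<exists>f\<in>M. \<forall>P\<in>\<P>. f \<notin> P"
  using assms(2-)
proof (induction \<P>)
  case empty
  then show ?case using ideal_0[OF M] by blast
next
  case (insert P \<P>)
  have "\<exists>f\<in>M. \<forall>P\<in>\<P>. f \<notin> P"
    by (rule insert.IH) (use insert.prems in \<open>blast+\<close>)
  then obtain f where f: "f \<in> M" "\<And>Q. Q \<in> \<P> \<Longrightarrow> f \<notin> Q" by blast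
  have P: "prime_ideal P" "is_ideal P" using insert.prems(1)[of P] by (auto simp: prime_ideal_def)
  show ?case
  proof (cases "f \<in> P")
    case False
    then show ?thesis using f by blast
  next
    case True
    have "\<forall>Q\<in>\<P>. \<exists>q\<in>Q. q \<notin> P" using insert.prems(2)[of P] insert.hyps(2) by blast
    then obtain q where q: "\<And>Q. Q \<in> \<P> \<Longrightarrow> q Q \<in> Q" "\<And>Q. Q \<in> \<P> \<Longrightarrow> q Q \<notin> P" by metis
    obtain s where s: "s \<in> M" "s \<notin> P" using insert.prems(3)[of P] by blast
    \<comment> \<open>\<open>z\<close> lies in \<open>M\<close> and in every prime of
      \<open>\<P>\<close> but not in \<open>P\<close>, while \<open>f\<close> lies in
      \<open>P\<close> and avoids \<open>\<P>\<close>; so \<open>f + z\<close> avoids them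
      all.\<close>
    define z where "z = s * prod q \<P>"
    have zM: "z \<in> M" unfolding z_def by (rule ideal_mult_right[OF M s(1)])
    have "prod q \<P> \<notin> P" using prime_prod[OF P(1) insert.hyps(1)] q(2) by blast
    then have zP: "z \<notin> P" using P(1) s(2) unfolding z_def prime_ideal_def by blast
    have "f + z \<notin> Q" if "Q \<in> insert P \<P>" for Q
    proof
      assume fz: "f + z \<in> Q"
      have Q: "is_ideal Q" using insert.prems(1)[OF that] by (simp add: prime_ideal_def)
      show False
      proof (cases "Q = P")
        case True
        then show False using ideal_diff[OF Q fz, of f] \<open>f \<in> P\<close> zP by simp
      next
        case False
        then have QP: "Q \<in> \<P>" using that by simp
        then have "z \<in> Q" unfolding z_def
          using prod_in_ideal[where h = q, OF Q insert.hyps(1) QP q(1)[OF QP]] by (intro ideal_mult_left[OF Q])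
        then show False using ideal_diff[OF Q fz, of z] f(2)[OF QP] by simp
      qed
    qed
    then show ?thesis using ideal_add[OF M f(1) zM] by blast
  qed
qed

text \<open>A nonzero divisor is found by avoiding the maximal annihilators of elements of \<open>S/L\<close>; there are
  finitely many of them because finitely many of the elements generate all others.\<close>

lemma nonzerodivisor_exists:
  fixes L M :: "('x::finite, 'k::field) mpol set"
  assumes L: "is_ideal L" and M: "is_ideal M" and soc: "\<And>g. (\<And>h. h \<in> M \<Longrightarrow> h * g \<in> L) \<Longrightarrow> g \<in> L"
  shows "\<exists>f\<in>M. \<forall>g. g * f \<in> L \<longrightarrow> g \<in> L"
proof -
  define mx where "mx g \<longleftrightarrow> g \<notin> L \<and> (\<forall>g'. g' \<notin> L \<longrightarrow> colon L g \<subseteq> colon L g' \<longrightarrow> colon L g' = colon L g)" for g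
  have ex_mx: "\<exists>g'. mx g' \<and> colon L g \<subseteq> colon L g'" if "g \<notin> L" for g
  proof -
    have "\<exists>N\<in>{colon L g | g. g \<notin> L}. colon L g \<subseteq> N \<and> (\<forall>N'\<in>{colon L g | g. g \<notin> L}. N \<subseteq> N' \<longrightarrow> N' = N)"
      by (rule ideal_family_has_maximal) (use is_ideal_colon[OF L] that in blast)+
    then obtain g' where "g' \<notin> L" "colon L g \<subseteq> colon L g'"
        "\<forall>N'\<in>{colon L g | g. g \<notin> L}. colon L g' \<subseteq> N' \<longrightarrow> N' = colon L g'" by blast
    then show ?thesis unfolding mx_def by (intro exI[of _ g']) blast
  qed
  have prime: "prime_ideal (colon L g)" if g: "mx g" for g
    unfolding prime_ideal_def
  proof (intro conjI allI impI)
    show "is_ideal (colon L g)" by (rule is_ideal_colon[OF L])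
    have gL: "g \<notin> L" using g by (simp add: mx_def)
    then have "1 \<notin> colon L g" by (simp add: colon_def)
    then show "colon L g \<noteq> UNIV" by blast
    fix a b assume ab: "a * b \<in> colon L g"
    show "a \<in> colon L g \<or> b \<in> colon L g"
    proof (cases "a \<in> colon L g")
      case False
      then have "a * g \<notin> L" by (simp add: colon_def)
      moreover have "colon L g \<subseteq> colon L (a * g)"
      proof
        fix x assume "x \<in> colon L g"
        then have "a * (x * g) \<in> L" using ideal_mult_left[OF L] by (simp add: colon_def)
        then show "x \<in> colon L (a * g)" by (simp add: colon_def ac_simps)
      qed
      ultimately have "colon L (a * g) = colon L g" using g unfolding mx_def by blast
      moreover have "b \<in> colon L (a * g)" using ab by (simp add: colon_def ac_simps)
      ultimately show ?thesis by simp
    qed simp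
  qed
  \<comment> \<open>A maximal member \<open>N\<close> already contains every element with maximal
    annihilator, although it is generated over \<open>L\<close> by the finite set
    \<open>X\<close>.\<close>
  define \<F> where "\<F> = {ideal_gen (L \<union> X) | X. finite X \<and> (\<forall>x\<in>X. mx x)}"
  have "\<exists>N\<in>\<F>. ideal_gen (L \<union> {}) \<subseteq> N \<and> (\<forall>N'\<in>\<F>. N \<subseteq> N' \<longrightarrow> N' = N)"
  proof (rule ideal_family_has_maximal)
    show "is_ideal J" if "J \<in> \<F>" for J using that is_ideal_ideal_gen unfolding \<F>_def by blast
    show "ideal_gen (L \<union> {}) \<in> \<F>" unfolding \<F>_def by blast
  qed
  then obtain N where N: "N \<in> \<F>" and N_max: "\<forall>N'\<in>\<F>. N \<subseteq> N' \<longrightarrow> N' = N"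
    by (elim bexE conjE)
  obtain X where X: "N = ideal_gen (L \<union> X)" "finite X" "\<And>x. x \<in> X \<Longrightarrow> mx x"
    using N unfolding \<F>_def by (elim CollectE exE conjE) simp
  have gN: "g \<in> N" if "mx g" for g
  proof -
    have "ideal_gen (L \<union> insert g X) \<in> \<F>" unfolding \<F>_def using X(2,3) that by blast
    moreover have "N \<subseteq> ideal_gen (L \<union> insert g X)"
      unfolding X(1) using ideal_gen_superset[of "L \<union> insert g X"] by (intro ideal_gen_minimal is_ideal_ideal_gen) blast
    ultimately have "ideal_gen (L \<union> insert g X) = N" using N_max by simp
    then show ?thesis using ideal_gen_superset[of "L \<union> insert g X"] by blast
  qed
  define \<P> where "\<P> = {colon L g | g. mx g}"
  have "\<P> \<subseteq> colon L ` X"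
  proof
    fix P assume "P \<in> \<P>"
    then obtain g where g: "P = colon L g" "mx g" by (auto simp: \<P>_def)
    \<comment> \<open>Otherwise each \<open>x\<close> is killed modulo \<open>L\<close> by an
      element outside \<open>colon L g\<close>. The product of these kills \<open>N\<close>, in
      particular \<open>g\<close>, against primality of \<open>colon L g\<close>.\<close>
    have "\<exists>x\<in>X. colon L x \<subseteq> colon L g"
    proof (rule ccontr)
      assume "\<not> ?thesis"
      then have "\<forall>x\<in>X. \<exists>h. h \<in> colon L x \<and> h \<notin> colon L g" by blast
      then obtain h where h: "\<And>x. x \<in> X \<Longrightarrow> h x \<in> colon L x" "\<And>x. x \<in> X \<Longrightarrow> h x \<notin> colon L g" by metis
      have "L \<union> X \<subseteq> colon L (prod h X)"
      proof
        fix y assume "y \<in> L \<union> X"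
        then show "y \<in> colon L (prod h X)"
        proof
          assume "y \<in> L"
          then show ?thesis by (simp add: colon_def ideal_mult_right[OF L])
        next
          assume y: "y \<in> X"
          have "prod h X \<in> colon L y" using prod_in_ideal[where h = h, OF is_ideal_colon[OF L] X(2) y h(1)[OF y]] .
          then show ?thesis by (simp add: colon_def mult.commute)
        qed
      qed
      then have "N \<subseteq> colon L (prod h X)" unfolding X(1) by (rule ideal_gen_minimal) (rule is_ideal_colon[OF L])
      then have "prod h X \<in> colon L g" using gN[OF g(2)] by (auto simp: colon_def mult.commute)
      moreover have "prod h X \<notin> colon L g" by (rule prime_prod[OF prime[OF g(2)] X(2) h(2)])
      ultimately show False by simp
    qed
    then obtain x where x: "x \<in> X" "colon L x \<subseteq> colon L g" by blast
    have "colon L g = colon L x" using X(3)[OF x(1)] x(2) g(2) unfolding mx_def by blast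
    then show "P \<in> colon L ` X" using g(1) x(1) by blast
  qed
  then have fin: "finite \<P>" using X(2) by (auto intro: finite_subset)
  have "\<exists>f\<in>M. \<forall>P\<in>\<P>. f \<notin> P"
  proof (rule prime_avoidance[OF M fin])
    show "prime_ideal P" if "P \<in> \<P>" for P using that prime by (auto simp: \<P>_def)
    show "Q = P" if PQ: "P \<in> \<P>" "Q \<in> \<P>" "Q \<subseteq> P" for P Q
    proof -
      obtain g g' where "P = colon L g" "mx g" "Q = colon L g'" "mx g'" using PQ(1,2) unfolding \<P>_def by blast
      then show ?thesis using PQ(3) unfolding mx_def by blast
    qed
    show "\<not> M \<subseteq> P" if P: "P \<in> \<P>" for P
    proof
      assume "M \<subseteq> P"
      obtain g where g: "P = colon L g" "mx g" using P unfolding \<P>_def by blast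
      have "h * g \<in> L" if "h \<in> M" for h using \<open>M \<subseteq> P\<close> that g(1) by (auto simp: colon_def)
      then have "g \<in> L" by (rule soc)
      then show False using g(2) by (simp add: mx_def)
    qed
  qed
  then obtain f where f: "f \<in> M" "\<And>P. P \<in> \<P> \<Longrightarrow> f \<notin> P" by blast
  have "g \<in> L" if "g * f \<in> L" for g
  proof (rule ccontr)
    assume "g \<notin> L"
    then obtain g' where g': "mx g'" "colon L g \<subseteq> colon L g'" using ex_mx by blast
    have "f \<in> colon L g" using that by (simp add: colon_def mult.commute)
    then show False using g' f(2)[of "colon L g'"] unfolding \<P>_def by blast
  qed
  then show ?thesis using f(1) by blast
qed


section \<open>Depth and Koszul homology\<close>

lemma in_irrelevant_ideal_iff:
  "f \<in> (irrelevant_ideal :: ('x::finite, 'k::field) mpol set) \<longleftrightarrow> lookup f 0 = 0"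
proof -
  have "range (\<lambda>x. xpow (single x 1)) = (xpow ` range ex1 :: ('x, 'k) mpol set)"
    by (auto simp: ex1_def)
  then have irr: "irrelevant_ideal = (mideal (upclosure (range ex1)) :: ('x, 'k) mpol set)"
    by (simp add: irrelevant_ideal_def ideal_gen_xpow)
  have up: "m \<in> upclosure (range ex1) \<longleftrightarrow> m \<noteq> 0" for m :: "'x mon"
  proof
    assume "m \<in> upclosure (range ex1)"
    then obtain x n where "m = ex1 x + n" by (auto simp: upclosure_def)
    then have "mdeg m = Suc (mdeg n)" by simp
    then show "m \<noteq> 0" by auto
  next
    assume "m \<noteq> 0"
    then obtain y where "lookup m y \<noteq> 0" by (metis lookup_zero poly_mapping_eqI)
    then obtain n where "m = ex1 y + n" using ex1_le_iff[of y m] by (auto simp: mle_iff)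
    then show "m \<in> upclosure (range ex1)" by (simp add: upclosureI)
  qed
  have "f \<in> irrelevant_ideal \<longleftrightarrow> (\<forall>m\<in>keys f. m \<noteq> 0)"
    unfolding irr mideal_def mem_Collect_eq subset_eq up ..
  then show ?thesis by (metis in_keys_iff)
qed

lemma is_ideal_irrelevant: "is_ideal irrelevant_ideal"
  unfolding irrelevant_ideal_def by (rule is_ideal_ideal_gen)

lemma ideal_gen_insert:
  assumes "is_ideal L"
  shows "h \<in> ideal_gen (insert f L) \<longleftrightarrow> (\<exists>g. h - g * f \<in> L)"
proof -
  have "ideal_gen L = L" using assms ideal_gen_minimal[of L L] ideal_gen_superset[of L] by blast
  then show ?thesis by (simp add: module.span_insert[OF module_times])
qed

lemma vin_insert:
  fixes v :: "('x, 'k::field) fvec"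
  assumes L: "is_ideal L" and v: "v \<in> fmod F i"
  shows "vin (ideal_gen (insert f L)) v \<longleftrightarrow> (\<exists>u\<in>fmod F i. vin L (v - vscale f u))"
proof
  assume "vin (ideal_gen (insert f L)) v"
  then have "\<forall>b. \<exists>g. lookup v b - g * f \<in> L" by (simp add: vin_def ideal_gen_insert[OF L])
  then obtain g where g: "\<And>b. lookup v b - g b * f \<in> L" by metis
  define u where "u = (\<Sum>b\<in>keys v. single b (g b))"
  have lu: "lookup u b = (if b \<in> keys v then g b else 0)" for b
    by (simp add: u_def lookup_sum lookup_single when_def)
  have "keys u \<subseteq> keys v" by (auto simp: in_keys_iff lu)
  then have "u \<in> fmod F i" using v by (auto simp: fmod_def)
  moreover have "vin L (v - vscale f u)" unfolding vin_def
  proof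
    fix b show "lookup (v - vscale f u) b \<in> L"
      using g[of b] ideal_0[OF L] by (cases "b \<in> keys v") (auto simp: lookup_minus lookup_vscale lu mult.commute in_keys_iff)
  qed
  ultimately show "\<exists>u\<in>fmod F i. vin L (v - vscale f u)" by blast
next
  assume "\<exists>u\<in>fmod F i. vin L (v - vscale f u)"
  then obtain u where "vin L (v - vscale f u)" by blast
  then have "lookup v b - lookup u b * f \<in> L" for b
    by (simp add: vin_def lookup_minus lookup_vscale mult.commute)
  then show "vin (ideal_gen (insert f L)) v" unfolding vin_def ideal_gen_insert[OF L] by blast
qed

text \<open>\<open>hvan i L\<close> states that the \<open>i\<close>th Koszul homology of \<open>S/L\<close> vanishes.\<close>

definition hvan :: "nat \<Rightarrow> ('x::finite, 'k::field) mpol set \<Rightarrow> bool" where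
  "hvan i L \<longleftrightarrow> (\<forall>v\<in>fmod koszul i. vin L (kdiff v) \<longrightarrow> (\<exists>w\<in>fmod koszul (Suc i). vin L (v - kdiff w)))"

definition regular_on :: "('a::comm_ring_1) set \<Rightarrow> 'a \<Rightarrow> bool" where
  "regular_on L f \<longleftrightarrow> (\<forall>g. g * f \<in> L \<longrightarrow> g \<in> L)"

lemma regular_vin: "regular_on L f \<Longrightarrow> vin L (vscale f v) \<Longrightarrow> vin L v"
  by (auto simp: regular_on_def vin_def lookup_vscale mult.commute)

lemma kres_koszul: "kres (koszul :: ('x::finite, 'k::field) fcomplex)"
  by (rule kres.intro) (rule koszul_free_resolution_K)

lemma shom_kdiff: "shom (kdiff :: ('x::finite, 'k::field) fvec \<Rightarrow> _)"
  using kres.shom_d[OF kres_koszul, of 0] by simp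

lemma kdiff_fmod_0:
  fixes v :: "('x::finite, 'k::field) fvec"
  assumes "v \<in> fmod koszul 0" shows "kdiff v = 0"
proof -
  have "kdiff v \<in> {0}"
    by (rule koszul_closed[OF kdiff_additive _ _ _ assms, where D = UNIV]) (auto simp: kdiff_kel)
  then show ?thesis by simp
qed

lemma fmod_koszul_large:
  fixes v :: "('x::finite, 'k::field) fvec"
  assumes "v \<in> fmod koszul i" "i > card (UNIV :: 'x set)" shows "v = 0"
proof -
  have "keys v = {}"
  proof (rule ccontr)
    assume "keys v \<noteq> {}"
    then obtain b where "b \<in> keys v" by blast
    then obtain A :: "'x set" where "card A = i" using assms(1) by (auto simp: fmod_def)
    then show False using assms(2) card_mono[of "UNIV :: 'x set" A] by simp
  qed
  then show ?thesis by simp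
qed

lemma hvan_large:
  fixes L :: "('x::finite, 'k::field) mpol set"
  assumes "is_ideal L" "i > card (UNIV :: 'x set)"
  shows "hvan i L"
  unfolding hvan_def
proof (intro ballI impI)
  fix v :: "('x, 'k) fvec" assume "v \<in> fmod koszul i"
  then have "v = 0" using assms(2) by (rule fmod_koszul_large)
  then show "\<exists>w\<in>fmod koszul (Suc i). vin L (v - kdiff w)"
    using vin_0[OF assms(1)] by (intro bexI[of _ 0]) (simp_all add: shom_0[OF shom_kdiff] fmod_closed)
qed

text \<open>The zeroth Koszul homology is \<open>S/(L + m) = K\<close>, represented by the basis
  element of the empty set.\<close>

lemma not_hvan_0:
  fixes L :: "('x::finite, 'k::field) mpol set"
  assumes L: "is_ideal L" "L \<subseteq> irrelevant_ideal"
  shows "\<not> hvan 0 L"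
proof
  assume h: "hvan 0 L"
  interpret F: kres "koszul :: ('x, 'k) fcomplex" by (rule kres_koszul)
  let ?v = "fgen (enc ({} :: 'x set)) :: ('x, 'k) fvec"
  have v: "?v \<in> fmod koszul 0" by (rule fgen_fmod) simp
  then have "vin L (kdiff ?v)" using kdiff_fmod_0 vin_0[OF L(1)] by metis
  then obtain w where w: "w \<in> fmod koszul (Suc 0)" "vin L (?v - kdiff w)" using h v unfolding hvan_def by blast
  have "lookup (?v - kdiff w) (enc ({} :: 'x set)) \<in> irrelevant_ideal" using w(2) L(2) by (auto simp: vin_def)
  then have "lookup (lookup (?v - kdiff w) (enc ({} :: 'x set))) 0 = 0" by (simp add: in_irrelevant_ideal_iff)
  moreover have "lookup (lookup (kdiff w) (enc ({} :: 'x set))) 0 = 0"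
    using F.zcyc_d[OF w(1)] by (simp add: zcyc_def) (simp add: koszul_def)
  ultimately show False by (simp add: lookup_minus fgen_def)
qed

text \<open>Top Koszul homology is the socle of \<open>S/L\<close>: the multiple by \<open>g\<close>
  of the top basis element is a cycle modulo \<open>L\<close> when all variables kill
  \<open>g\<close>, and there are no boundaries in top degree.\<close>

lemma hvan_top_socle:
  fixes L :: "('x::finite, 'k::field) mpol set"
  assumes L: "is_ideal L" and h: "hvan (card (UNIV :: 'x set)) L"
    and g: "\<And>y. xpow (ex1 y) * g \<in> L"
  shows "g \<in> L"
proof -
  let ?b = "enc (UNIV :: 'x set)"
  define v where "v = vscale g (fgen ?b)"
  have v: "v \<in> fmod koszul (card (UNIV :: 'x set))" unfolding v_def by (intro fmod_vscale fgen_fmod) simp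
  have "fgen ?b = (kel UNIV 0 1 :: ('x, 'k) fvec)" by (simp add: fgen_def kel_def)
  then have "kdiff v = (\<Sum>y\<in>UNIV. vscale g (kel (UNIV - {y}) (ex1 y) (ksgn UNIV y)))"
    by (simp add: v_def shom_vscale[OF shom_kdiff] kdiff_kel vscale_sum_right)
  also have "vin L \<dots>"
  proof (rule vin_sum[OF L])
    fix y :: 'x
    have "g * single (ex1 y) s \<in> L" for s
      using ideal_mult_left[OF L g[of y], of "single 0 s"]
      by (subst single_eq_xpow) (simp add: ac_simps)
    then show "vin L (vscale g (kel (UNIV - {y}) (ex1 y) (ksgn UNIV y)))"
      unfolding vin_def by (auto simp: lookup_vscale kel_def lookup_single when_def ideal_0[OF L])
  qed
  finally obtain w where w: "w \<in> fmod koszul (Suc (card (UNIV :: 'x set)))" "vin L (v - kdiff w)"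
    using h v unfolding hvan_def by blast
  have "w = 0" using fmod_koszul_large[OF w(1)] by simp
  then have "vin L v" using w(2) by (simp add: shom_0[OF shom_kdiff])
  then have "lookup v ?b \<in> L" by (simp add: vin_def)
  then show ?thesis by (simp add: v_def lookup_vscale fgen_def)
qed

text \<open>The two halves of the long exact sequence of \<open>0 \<rightarrow> S/L \<rightarrow> S/L \<rightarrow> S/(L, f) \<rightarrow> 0\<close>, in which
  multiplication by \<open>f\<close> is zero on homology.\<close>

lemma hvan_insert:
  fixes L :: "('x::finite, 'k::field) mpol set"
  assumes L: "is_ideal L" and f: "regular_on L f" and h: "hvan j L" "hvan (Suc j) L"
  shows "hvan (Suc j) (ideal_gen (insert f L))"
  unfolding hvan_def
proof (intro ballI impI)
  fix v :: "('x, 'k) fvec" assume v: "v \<in> fmod koszul (Suc j)" "vin (ideal_gen (insert f L)) (kdiff v)"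
  note d = shom_kdiff[where 'x = 'x and 'k = 'k]
  have dv: "kdiff v \<in> fmod koszul j" using v(1) by (rule koszul_diff_range)
  \<comment> \<open>The class of \<open>u\<close> is the image under the connecting map; regularity
    of \<open>f\<close> makes \<open>u\<close> a cycle modulo \<open>L\<close>.\<close>
  obtain u where u: "u \<in> fmod koszul j" "vin L (kdiff v - vscale f u)"
    using v(2) vin_insert[OF L dv] by blast
  have "vin L (kdiff (kdiff v - vscale f u))" by (rule shom_vin[OF d L u(2)])
  moreover have "kdiff (kdiff v - vscale f u) = - vscale f (kdiff u)"
    by (simp add: shom_diff[OF d] shom_vscale[OF d] koszul_diff_diff[OF v(1)])
  ultimately have "vin L (- vscale f (kdiff u))" by simp
  then have "vin L (vscale f (kdiff u))" using ideal_uminus[OF L] by (fastforce simp: vin_def)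
  then have "vin L (kdiff u)" by (rule regular_vin[OF f])
  then obtain w where w: "w \<in> fmod koszul (Suc j)" "vin L (u - kdiff w)" using h(1) u(1) unfolding hvan_def by blast
  have "kdiff (v - vscale f w) = (kdiff v - vscale f u) + vscale f (u - kdiff w)"
    by (simp add: shom_diff[OF d] shom_vscale[OF d] vscale_diff_right)
  then have "vin L (kdiff (v - vscale f w))" using vin_add[OF L u(2) vin_vscale[OF L w(2)]] by simp
  moreover have "v - vscale f w \<in> fmod koszul (Suc j)" by (intro fmod_diff fmod_vscale v w)
  ultimately obtain w' where w': "w' \<in> fmod koszul (Suc (Suc j))" "vin L (v - vscale f w - kdiff w')"
    using h(2) unfolding hvan_def by blast
  have "vin L (v - kdiff w' - vscale f w)" using w'(2) by (simp add: algebra_simps)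
  then have "vin (ideal_gen (insert f L)) (v - kdiff w')"
    using vin_insert[OF L, of "v - kdiff w'" koszul "Suc j" f] w(1) fmod_diff[OF v(1) koszul_diff_range[OF w'(1)]]
    by blast
  then show "\<exists>w\<in>fmod koszul (Suc (Suc j)). vin (ideal_gen (insert f L)) (v - kdiff w)" using w'(1) by blast
qed

lemma hvan_of_insert:
  fixes L :: "('x::finite, 'k::field) mpol set"
  assumes L: "is_ideal L" and f: "regular_on L f" "f \<in> irrelevant_ideal"
    and h: "hvan (Suc i) (ideal_gen (insert f L))"
  shows "hvan i L"
  unfolding hvan_def
proof (intro ballI impI)
  fix v :: "('x, 'k) fvec" assume v: "v \<in> fmod koszul i" "vin L (kdiff v)"
  note d = shom_kdiff[where 'x = 'x and 'k = 'k]
  have "lookup f 0 = 0" using f(2) by (simp add: in_irrelevant_ideal_iff)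
  from koszul_mult_homotopy[OF this] obtain H where H: "\<And>i. shom (H i)"
     "\<And>i v. v \<in> fmod koszul i \<Longrightarrow> H i v \<in> fmod koszul (Suc i)"
     "\<And>v. v \<in> fmod koszul 0 \<Longrightarrow> vscale f v = kdiff (H 0 v)"
     "\<And>i v. v \<in> fmod koszul (Suc i) \<Longrightarrow> vscale f v = kdiff (H (Suc i) v) + H i (kdiff v)"
    by blast
  \<comment> \<open>The null homotopy of \<open>f\<close> bounds \<open>f v\<close> modulo
    \<open>L\<close> by \<open>w\<close>. Hence \<open>w\<close> is a cycle modulo
    \<open>(L, f)\<close> whose image under the connecting map is the class of
    \<open>v\<close>.\<close>
  define w where "w = H i v"
  have w: "w \<in> fmod koszul (Suc i)" unfolding w_def by (rule H(2)[OF v(1)])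
  have fw: "vin L (vscale f v - kdiff w)"
  proof (cases i)
    case 0
    then show ?thesis using H(3) v(1) vin_0[OF L] by (simp add: w_def)
  next
    case (Suc j)
    then have "vscale f v - kdiff w = H j (kdiff v)" using H(4) v(1) by (simp add: w_def)
    then show ?thesis using shom_vin[OF H(1) L v(2)] by simp
  qed
  then have "vin L (kdiff w - vscale f v)"
    using vin_diff[OF L vin_0[OF L] fw] by simp
  then have "vin (ideal_gen (insert f L)) (kdiff w)"
    using vin_insert[OF L koszul_diff_range[OF w]] v(1) by blast
  then obtain w' where w': "w' \<in> fmod koszul (Suc (Suc i))" "vin (ideal_gen (insert f L)) (w - kdiff w')"
    using h w unfolding hvan_def by blast
  then obtain u where u: "u \<in> fmod koszul (Suc i)" "vin L (w - kdiff w' - vscale f u)"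
    using vin_insert[OF L fmod_diff[OF w koszul_diff_range[OF w'(1)]]] by blast
  have "kdiff (w - kdiff w' - vscale f u) = kdiff w - vscale f (kdiff u)"
    by (simp add: shom_diff[OF d] shom_vscale[OF d] koszul_diff_diff[OF w'(1)])
  then have "vin L (kdiff w - vscale f (kdiff u))" using shom_vin[OF d L u(2)] by simp
  then have "vin L ((vscale f v - kdiff w) + (kdiff w - vscale f (kdiff u)))" by (rule vin_add[OF L fw])
  then have "vin L (vscale f (v - kdiff u))" by (simp add: vscale_diff_right)
  then have "vin L (v - kdiff u)" by (rule regular_vin[OF f(1)])
  then show "\<exists>w\<in>fmod koszul (Suc i). vin L (v - kdiff w)" using u(1) by blast
qed

section \<open>Regular sequences and depth\<close>

lemma ideal_gen_Un_ideal_gen: "ideal_gen (ideal_gen A \<union> B) = ideal_gen (A \<union> B)"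
proof
  show "ideal_gen (ideal_gen A \<union> B) \<subseteq> ideal_gen (A \<union> B)"
    using ideal_gen_superset[of "A \<union> B"]
    by (intro ideal_gen_minimal is_ideal_ideal_gen Un_least) auto
  show "ideal_gen (A \<union> B) \<subseteq> ideal_gen (ideal_gen A \<union> B)"
    using ideal_gen_superset[of "ideal_gen A \<union> B"] ideal_gen_superset[of A]
    by (intro ideal_gen_minimal is_ideal_ideal_gen) blast
qed

lemma ideal_gen_ideal: "is_ideal L \<Longrightarrow> ideal_gen L = L"
  using ideal_gen_minimal[of L L] ideal_gen_superset[of L] by blast

lemma regular_seq_Cons:
  assumes L: "is_ideal L"
  shows "regular_seq L (f # fs) \<longleftrightarrow> regular_on L f \<and> regular_seq (ideal_gen (insert f L)) fs"
proof -
  have gen: "ideal_gen (ideal_gen (insert f L) \<union> X) = ideal_gen (L \<union> insert f X)" for X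
    by (simp add: ideal_gen_Un_ideal_gen)
  have "(\<forall>r<Suc (length fs). Q r) \<longleftrightarrow> Q 0 \<and> (\<forall>r<length fs. Q (Suc r))" for Q
    by (auto simp: less_Suc_eq_0_disj)
  then show ?thesis
    unfolding regular_seq_def gen
    by (simp add: ideal_gen_ideal[OF L] regular_on_def) blast
qed

lemma ideal_gen_insert_irrelevant:
  fixes L :: "('x::finite, 'k::field) mpol set"
  shows "L \<subseteq> irrelevant_ideal \<Longrightarrow> f \<in> irrelevant_ideal \<Longrightarrow> ideal_gen (insert f L) \<subseteq> irrelevant_ideal"
  by (rule ideal_gen_minimal[OF _ is_ideal_irrelevant]) simp

text \<open>Each element of the sequence raises a nonvanishing homological degree by one, and
  nothing survives above the number of variables.\<close>

lemma regular_seq_length: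
  fixes L :: "('x::finite, 'k::field) mpol set"
  assumes "is_ideal L" "\<not> hvan p L" "set fs \<subseteq> irrelevant_ideal" "regular_seq L fs"
  shows "length fs + p \<le> card (UNIV :: 'x set)"
  using assms
proof (induction fs arbitrary: L p)
  case Nil
  then show ?case using hvan_large[of L p] by (simp add: not_le[symmetric]) (meson not_le)
next
  case (Cons f fs)
  have f: "regular_on L f" "regular_seq (ideal_gen (insert f L)) fs"
    using Cons.prems(4) regular_seq_Cons[OF Cons.prems(1)] by auto
  have "\<not> hvan (Suc p) (ideal_gen (insert f L))"
    using hvan_of_insert[OF Cons.prems(1) f(1)] Cons.prems(2,3) by auto
  then have "length fs + Suc p \<le> card (UNIV :: 'x set)"
    using Cons.prems(3) f(2) by (intro Cons.IH) (auto simp: is_ideal_ideal_gen)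
  then show ?case by simp
qed

text \<open>While \<open>p\<close> is below the number of variables, top homology vanishes, so
  \<open>S/L\<close> has no socle and \<open>nonzerodivisor_exists\<close> applies. Passing to
  \<open>(L, f)\<close> raises the bound \<open>p\<close> by one.\<close>

lemma regular_seq_exists:
  fixes L :: "('x::finite, 'k::field) mpol set"
  assumes "is_ideal L" "L \<subseteq> irrelevant_ideal" "\<And>j. j > p \<Longrightarrow> hvan j L" "p + r = card (UNIV :: 'x set)"
  shows "\<exists>fs. length fs = r \<and> set fs \<subseteq> irrelevant_ideal \<and> regular_seq L fs"
  using assms
proof (induction r arbitrary: L p)
  case 0
  have "1 \<notin> L" using 0(2) by (auto simp: in_irrelevant_ideal_iff)
  then have "L \<noteq> UNIV" by blast
  then have "regular_seq L []" using 0(1) by (simp add: regular_seq_def ideal_gen_ideal)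
  then show ?case by simp
next
  case (Suc r)
  have "\<exists>f\<in>irrelevant_ideal. \<forall>g. g * f \<in> L \<longrightarrow> g \<in> L"
  proof (rule nonzerodivisor_exists[OF Suc.prems(1) is_ideal_irrelevant])
    fix g assume "\<And>h. h \<in> irrelevant_ideal \<Longrightarrow> h * g \<in> L"
    moreover have "xpow (ex1 y) \<in> (irrelevant_ideal :: ('x, 'k) mpol set)" for y
      unfolding irrelevant_ideal_def ex1_def by (rule subsetD[OF ideal_gen_superset]) blast
    moreover have "hvan (card (UNIV :: 'x set)) L" using Suc.prems(3,4) by simp
    ultimately show "g \<in> L" using hvan_top_socle[OF Suc.prems(1)] by blast
  qed
  then obtain f where f: "f \<in> irrelevant_ideal" "regular_on L f" by (auto simp: regular_on_def)
  have "\<exists>fs. length fs = r \<and> set fs \<subseteq> irrelevant_ideal \<and> regular_seq (ideal_gen (insert f L)) fs"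
  proof (rule Suc.IH[of _ "Suc p"])
    fix j assume "j > Suc p"
    then obtain j' where "j = Suc j'" "j' > p" by (cases j) auto
    then show "hvan j (ideal_gen (insert f L))"
      using hvan_insert[OF Suc.prems(1) f(2)] Suc.prems(3) by simp
  next
    show "ideal_gen (insert f L) \<subseteq> irrelevant_ideal"
      by (rule ideal_gen_insert_irrelevant[OF Suc.prems(2) f(1)])
  qed (use Suc.prems(4) in \<open>simp_all add: is_ideal_ideal_gen\<close>)
  then obtain fs where "length fs = r" "set fs \<subseteq> irrelevant_ideal" "regular_seq (ideal_gen (insert f L)) fs" by blast
  then have "length (f # fs) = Suc r" "set (f # fs) \<subseteq> irrelevant_ideal" "regular_seq L (f # fs)"
    using f regular_seq_Cons[OF Suc.prems(1)] by auto
  then show ?case by blast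
qed

theorem depth_quot_eq:
  fixes L :: "('x::finite, 'k::field) mpol set"
  assumes L: "is_ideal L" "L \<subseteq> irrelevant_ideal"
  shows "depth_quot L = enat (card (UNIV :: 'x set) - Max {i. \<not> hvan i L})"
proof -
  let ?n = "card (UNIV :: 'x set)"
  have "{i. \<not> hvan i L} \<subseteq> {..?n}" using hvan_large[OF L(1)] by (auto simp: not_le[symmetric])
  then have fin: "finite {i. \<not> hvan i L}" by (rule finite_subset) simp
  have zero: "0 \<in> {i. \<not> hvan i L}" using not_hvan_0[OF L] by simp
  define p where "p = Max {i. \<not> hvan i L}"
  have p: "\<not> hvan p L" using Max_in[OF fin] zero unfolding p_def by blast
  have above: "hvan j L" if "j > p" for j
    using Max_ge[OF fin, of j] that unfolding p_def by (auto simp: not_le[symmetric])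
  have "p \<le> ?n" using p hvan_large[OF L(1), of p] by (auto simp: not_le[symmetric])
  then obtain fs where fs: "length fs = ?n - p" "set fs \<subseteq> irrelevant_ideal" "regular_seq L fs"
    using regular_seq_exists[where p = p and r = "?n - p", OF L above] by auto
  have "1 \<notin> L" using L(2) by (auto simp: in_irrelevant_ideal_iff)
  then have "L \<noteq> UNIV" by blast
  moreover have "(SUP fs\<in>{fs. set fs \<subseteq> irrelevant_ideal \<and> regular_seq L fs}. enat (length fs)) = enat (?n - p)"
  proof (rule antisym)
    show "(SUP fs\<in>{fs. set fs \<subseteq> irrelevant_ideal \<and> regular_seq L fs}. enat (length fs)) \<le> enat (?n - p)"
    proof (rule SUP_least)
      fix gs assume "gs \<in> {fs. set fs \<subseteq> irrelevant_ideal \<and> regular_seq L fs}"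
      then have "length gs + p \<le> ?n" using regular_seq_length[OF L(1) p] by blast
      then show "enat (length gs) \<le> enat (?n - p)" by simp
    qed
    show "enat (?n - p) \<le> (SUP fs\<in>{fs. set fs \<subseteq> irrelevant_ideal \<and> regular_seq L fs}. enat (length fs))"
      using fs by (intro SUP_upper2[of fs]) auto
  qed
  ultimately show ?thesis unfolding depth_quot_def p_def by simp
qed

section \<open>From Koszul homology of the quotient back to Tor of the ideal\<close>

text \<open>Dimension shift along \<open>0 \<rightarrow> J \<rightarrow> S \<rightarrow> S/J
  \<rightarrow> 0\<close>, by exactness of the Koszul complex. For \<open>i = 0\<close>, properness
  of \<open>J\<close> makes the augmentation vanish on vectors with entries in
  \<open>J\<close>.\<close>

lemma hvan_Suc_iff_tor:
  fixes J :: "('x::finite, 'k::field) mpol set"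
  assumes J: "is_ideal J" "J \<subseteq> irrelevant_ideal"
  shows "hvan (Suc i) J \<longleftrightarrow> tor_vanish koszul i J UNIV"
proof
  interpret F: kres "koszul :: ('x, 'k) fcomplex" by (rule kres_koszul)
  note d = shom_kdiff[where 'x = 'x and 'k = 'k]
  assume h: "hvan (Suc i) J"
  show "tor_vanish koszul i J UNIV" unfolding tor_vanish_def koszul_simps
  proof (intro allI impI)
    fix z :: "('x, 'k) fvec"
    assume z: "z \<in> fmod koszul i" "vin J z" "\<forall>j. i = Suc j \<longrightarrow> kdiff z = 0"
    have "zcyc koszul i z"
    proof (cases i)
      case 0
      have "lookup z (enc ({} :: 'x set)) \<in> irrelevant_ideal" using z(2) J(2) by (auto simp: vin_def)
      then have "lookup (lookup z (enc ({} :: 'x set))) 0 = 0" by (simp add: in_irrelevant_ideal_iff)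
      then have "aug koszul z = 0" by (simp add: koszul_def)
      then show ?thesis using z(1) 0 by (simp add: zcyc_def)
    next
      case (Suc j)
      then show ?thesis using z(1,3) by (simp add: zcyc_def)
    qed
    then obtain v where v: "v \<in> fmod koszul (Suc i)" "z = kdiff v" unfolding F.zcyc_iff by auto
    then obtain w where w: "w \<in> fmod koszul (Suc (Suc i))" "vin J (v - kdiff w)"
      using h z(2) unfolding hvan_def by blast
    have "kdiff (v - kdiff w) = z" using v(2) by (simp add: shom_diff[OF d] koszul_diff_diff[OF w(1)])
    then show "\<exists>w. w \<in> fmod koszul (Suc i) \<and> vin J w \<and> kdiff w = z"
      using w(2) fmod_diff[OF v(1) koszul_diff_range[OF w(1)]] by blast
  qed
next
  interpret F: kres "koszul :: ('x, 'k) fcomplex" by (rule kres_koszul)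
  note d = shom_kdiff[where 'x = 'x and 'k = 'k]
  assume t: "tor_vanish koszul i J UNIV"
  show "hvan (Suc i) J" unfolding hvan_def
  proof (intro ballI impI)
    fix v :: "('x, 'k) fvec" assume v: "v \<in> fmod koszul (Suc i)" "vin J (kdiff v)"
    have "kdiff v \<in> fmod koszul i" using v(1) by (rule koszul_diff_range)
    moreover have "kdiff (kdiff v) = 0" by (rule koszul_diff_diff[OF v(1)])
    moreover have "kdiff v \<in> vh koszul i UNIV" by (simp add: vh_def)
    ultimately obtain w where w: "w \<in> fmod koszul (Suc i)" "vin J w" "kdiff w = kdiff v"
      using t v(2) unfolding tor_vanish_def koszul_simps by blast
    have "zcyc koszul (Suc i) (v - w)"
      using w(3) fmod_diff[OF v(1) w(1)] by (simp add: zcyc_def shom_diff[OF d])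
    then obtain u where u: "u \<in> fmod koszul (Suc (Suc i))" "v - w = kdiff u" unfolding F.zcyc_iff by auto
    have "v - kdiff u = w" using u(2) by (simp add: algebra_simps)
    then show "\<exists>w\<in>fmod koszul (Suc (Suc i)). vin J (v - kdiff w)" using u(1) w(2) by metis
  qed
qed

text \<open>By \<open>rees_homology_step\<close> the finite set of nonvanishing homological degrees
  eventually shrinks weakly, hence becomes constant, and it determines the depth.\<close>

theorem depth_eventually:
  fixes G :: "('x::finite) mon set"
  assumes G: "finite G" "\<forall>g\<in>G. mdeg g = d" "d > 0" and B: "finite B"
  shows "\<exists>L c. \<forall>l\<ge>L. depth_quot (mideal (rees G B l) :: ('x, 'k::field) mpol set) = c"
proof -
  have Gd: "mdeg g = d" if "g \<in> G" for g using G(2) that by simp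
  define T where "T l = {i. \<exists>a. torc TYPE('k) i (Dl (rees G B l) a)}" for l
  have "T l \<subseteq> {..card (UNIV :: 'x set)}" for l using torc_card_le by (auto simp: T_def)
  then have finT: "finite (T l)" for l by (rule finite_subset) simp
  obtain k1 where k1: "\<And>i a l. k1 \<le> l \<Longrightarrow> torc TYPE('k) i (Dl (rees G B (Suc l)) a) \<Longrightarrow>
        \<exists>g\<in>G. \<exists>a'. a = g + a' \<and> torc TYPE('k) i (Dl (rees G B l) a')"
    using rees_homology_step[OF G(1) B] by metis
  have sub: "T (Suc l) \<subseteq> T l" if kl: "k1 \<le> l" for l
    using k1[OF kl] unfolding T_def by fast
  define w where "w l = - int (card (T l))" for l
  have "w l \<le> w (Suc l)" if "k1 \<le> l" for l
    using card_mono[OF finT sub[OF that]] by (simp add: w_def)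
  moreover have "w l \<le> 0" for l by (simp add: w_def)
  ultimately obtain L v where L: "k1 \<le> L" "\<forall>l\<ge>L. w l = v"
    using bounded_mono_eventually_const[of k1 w 0] by blast
  have step: "T (Suc l) = T l" if "L \<le> l" for l
  proof (rule card_subset_eq[OF finT sub])
    show "k1 \<le> l" using L(1) that by simp
    have "w (Suc l) = w l" using L(2) that by simp
    then show "card (T (Suc l)) = card (T l)" by (simp add: w_def)
  qed
  have T: "T l = T L" if "L \<le> l" for l
    using that by (induction rule: dec_induct) (auto simp: step)
  \<comment> \<open>At level 0 the ideal may be the whole ring; from level 1 on \<open>d > 0\<close>
    makes it proper, hence the maximum with 1.\<close>
  have "depth_quot (mideal (rees G B l) :: ('x, 'k) mpol set)
      = enat (card (UNIV :: 'x set) - Max (insert 0 (Suc ` T L)))" if l: "max 1 L \<le> l" for l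
  proof -
    let ?J = "mideal (rees G B l) :: ('x, 'k) mpol set"
    have J: "is_ideal ?J" by (simp add: is_ideal_mideal)
    have "0 \<notin> rees G B l"
    proof
      assume "0 \<in> rees G B l"
      then have "d * l \<le> mdeg (0 :: 'x mon)" using mdeg_rees_ge[OF Gd] by blast
      then show False using G(3) l by simp
    qed
    then have Jm: "?J \<subseteq> irrelevant_ideal" by (auto simp: mideal_def in_irrelevant_ideal_iff in_keys_iff)
    have hv: "hvan (Suc i) ?J \<longleftrightarrow> i \<notin> T l" for i
      unfolding hvan_Suc_iff_tor[OF J Jm] tor_vanish_koszul_iff T_def by auto
    \<comment> \<open>\<open>Suc\<close> is the shift from \<open>Tor\<close> of the ideal to
      homology of the quotient; 0 is added because the zeroth homology is \<open>K\<close>.\<close>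
    have "{i. \<not> hvan i ?J} = insert 0 (Suc ` T l)"
    proof (rule set_eqI)
      fix i show "i \<in> {i. \<not> hvan i ?J} \<longleftrightarrow> i \<in> insert 0 (Suc ` T l)"
        using not_hvan_0[OF J Jm] hv by (cases i) auto
    qed
    moreover have "T l = T L" by (rule T) (use l in simp)
    ultimately show ?thesis using depth_quot_eq[OF J Jm] by simp
  qed
  then show ?thesis by blast
qed


section \<open>Asymptotics of homological shift ideals\<close>

text \<open>All local v-numbers have the same slope \<open>d\<close>, so the minimum is attained at
  a prime with least intercept, the same for every \<open>l\<close>.\<close>

lemma vnum_eventually:
  fixes J :: "nat \<Rightarrow> ('x::finite, 'k::field) mpol set"
  assumes S: "finite S" and AV: "\<forall>l\<ge>L. Ass (J l) = S \<and>
      (\<forall>P\<in>S. int (vnum_at P (J l)) = int d * int l + w P)"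
  shows "\<exists>a b. \<forall>l\<ge>L. int (vnum (J l)) = a * int l + b"
proof (cases "S = {}")
  case True
  then have "int (vnum (J l)) = 0 * int l + 0" if "L \<le> l" for l using AV that by (simp add: vnum_def)
  then show ?thesis by blast
next
  case False
  define m where "m = Min (w ` S)"
  have "int (vnum (J l)) = int d * int l + m" if l: "L \<le> l" for l
  proof -
    have A: "Ass (J l) = S" and v: "P \<in> S \<Longrightarrow> int (vnum_at P (J l)) = int d * int l + w P" for P
      using AV l by simp_all
    have "m \<in> w ` S" unfolding m_def using S False by (intro Min_in) auto
    then obtain P where P: "P \<in> S" "w P = m" by auto
    have "vnum (J l) = (LEAST e. \<exists>P\<in>S. e = vnum_at P (J l))" using A False by (simp add: vnum_def)
    also have "\<dots> = vnum_at P (J l)"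
    proof (rule Least_equality)
      show "\<exists>Q\<in>S. vnum_at P (J l) = vnum_at Q (J l)" using P(1) by blast
      fix e assume "\<exists>Q\<in>S. e = vnum_at Q (J l)"
      then obtain Q where Q: "Q \<in> S" "e = vnum_at Q (J l)" by blast
      have "m \<le> w Q" unfolding m_def using S Q(1) by (intro Min_le) auto
      then have "int (vnum_at P (J l)) \<le> int e" using v[OF P(1)] v[OF Q(1)] P(2) Q(2) by simp
      then show "vnum_at P (J l) \<le> e" by simp
    qed
    finally show ?thesis using v[OF P(1)] P(2) by simp
  qed
  then show ?thesis by blast
qed

lemma eventually_of_shift:
  assumes "\<And>l. L \<le> l \<Longrightarrow> P (l + k1)"
  shows "\<forall>\<^sub>F k in sequentially. P k"
proof (rule eventually_sequentiallyI)
  fix k assume "L + k1 \<le> k"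
  then show "P k" using assms[of "k - k1"] by simp
qed

lemma linear_of_shift:
  fixes f :: "nat \<Rightarrow> int"
  assumes "\<And>l. L \<le> l \<Longrightarrow> f (l + k1) = a * int l + b"
  shows "\<forall>\<^sub>F k in sequentially. f k = a * int k + (b - a * int k1)"
  by (rule eventually_of_shift[of L _ k1]) (simp add: assms algebra_simps)

text \<open>Stated for any sequence of ideals, so that both alternatives of
  \<open>HS_eventually_rees\<close> end here; moving from \<open>l\<close> to
  \<open>k = l + m\<close> changes only the intercepts.\<close>

lemma asymptotics_of_shift:
  fixes J :: "nat \<Rightarrow> ('x::finite, 'k::field) mpol set"
  assumes A: "\<And>l. L \<le> l \<Longrightarrow> Ass (J (l + m)) = S"
    and D: "\<And>l. L \<le> l \<Longrightarrow> depth_quot (J (l + m)) = c"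
    and R: "\<And>l. L \<le> l \<Longrightarrow> reg (J (l + m)) = ar * int l + br"
    and V: "\<And>l. L \<le> l \<Longrightarrow> int (vnum (J (l + m))) = av * int l + bv"
    and VP: "\<And>l P. L \<le> l \<Longrightarrow> P \<in> S \<Longrightarrow> int (vnum_at P (J (l + m))) = ap P * int l + bp P"
  shows "(\<forall>\<^sub>F k in sequentially. Ass (J (k + 1)) = Ass (J k))
       \<and> (\<forall>\<^sub>F k in sequentially. depth_quot (J (k + 1)) = depth_quot (J k))
       \<and> (\<exists>a b :: int. \<forall>\<^sub>F k in sequentially. reg (J k) = a * int k + b)
       \<and> (\<exists>a b :: int. \<forall>\<^sub>F k in sequentially. int (vnum (J k)) = a * int k + b)
       \<and> (\<exists>a b :: ('x, 'k) mpol set \<Rightarrow> int. \<forall>\<^sub>F k in sequentially.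
            \<forall>P\<in>(THE A. \<forall>\<^sub>F k in sequentially. Ass (J k) = A). int (vnum_at P (J k)) = a P * int k + b P)"
proof (intro conjI)
  have evA: "\<forall>\<^sub>F k in sequentially. Ass (J k) = S"
    by (rule eventually_of_shift[of L _ m]) (rule A)
  \<comment> \<open>Two eventual values of one sequence coincide, so the description operator is
    determined.\<close>
  have the: "(THE A. \<forall>\<^sub>F k in sequentially. Ass (J k) = A) = S"
  proof (rule the_equality)
    show "\<forall>\<^sub>F k in sequentially. Ass (J k) = S" by (rule evA)
    fix S' assume "\<forall>\<^sub>F k in sequentially. Ass (J k) = S'"
    with evA have "\<forall>\<^sub>F k in sequentially. S' = S" by eventually_elim simp
    then show "S' = S" by simp
  qed
  show "\<forall>\<^sub>F k in sequentially. Ass (J (k + 1)) = Ass (J k)"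
  proof (rule eventually_of_shift[of L _ m])
    fix l assume "L \<le> l"
    then show "Ass (J (l + m + 1)) = Ass (J (l + m))"
      using A[of l] A[of "l + 1"] by (simp add: ac_simps)
  qed
  show "\<forall>\<^sub>F k in sequentially. depth_quot (J (k + 1)) = depth_quot (J k)"
  proof (rule eventually_of_shift[of L _ m])
    fix l assume "L \<le> l"
    then show "depth_quot (J (l + m + 1)) = depth_quot (J (l + m))"
      using D[of l] D[of "l + 1"] by (simp add: ac_simps)
  qed
  show "\<exists>a b :: int. \<forall>\<^sub>F k in sequentially. reg (J k) = a * int k + b"
    using linear_of_shift[of L "\<lambda>k. reg (J k)", OF R] by (intro exI)
  show "\<exists>a b :: int. \<forall>\<^sub>F k in sequentially. int (vnum (J k)) = a * int k + b"
    using linear_of_shift[of L "\<lambda>k. int (vnum (J k))", OF V] by (intro exI)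
  have "\<forall>\<^sub>F k in sequentially. \<forall>P\<in>S. int (vnum_at P (J k)) = ap P * int k + (bp P - ap P * int m)"
  proof (rule eventually_of_shift[of L _ m], rule ballI)
    fix l P assume "L \<le> l" "P \<in> S"
    then show "int (vnum_at P (J (l + m))) = ap P * int (l + m) + (bp P - ap P * int m)"
      using VP[of l P] by (simp add: algebra_simps)
  qed
  then show "\<exists>a b :: ('x, 'k) mpol set \<Rightarrow> int. \<forall>\<^sub>F k in sequentially.
      \<forall>P\<in>(THE A. \<forall>\<^sub>F k in sequentially. Ass (J k) = A). int (vnum_at P (J k)) = a P * int k + b P"
    unfolding the by (intro exI[of _ ap] exI[of _ "\<lambda>P. bp P - ap P * int m"])
qed

theorem theorem2p1:
  fixes I :: "('x::finite, 'k::field) mpol set" and i :: nat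
  assumes "monomial_ideal I" and "linear_powers I"
  shows "(\<forall>\<^sub>F k in sequentially.
            Ass (HS i (ideal_pow I (k + 1))) = Ass (HS i (ideal_pow I k)))
       \<and> (\<forall>\<^sub>F k in sequentially.
            depth_quot (HS i (ideal_pow I (k + 1))) = depth_quot (HS i (ideal_pow I k)))
       \<and> (\<exists>a b :: int. \<forall>\<^sub>F k in sequentially.
            reg (HS i (ideal_pow I k)) = a * int k + b)
       \<and> (\<exists>a b :: int. \<forall>\<^sub>F k in sequentially.
            int (vnum (HS i (ideal_pow I k))) = a * int k + b)
       \<and> (\<exists>a b :: ('x, 'k) mpol set \<Rightarrow> int. \<forall>\<^sub>F k in sequentially. \<forall>P\<in>Ass_inf i I.
            int (vnum_at P (HS i (ideal_pow I k))) = a P * int k + b P)"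
proof -
  let ?J = "\<lambda>k. HS i (ideal_pow I k)"
  obtain k1 where "(\<exists>J. \<forall>l. ?J (l + k1) = J) \<or>
     (\<exists>G B d e. finite G \<and> G \<noteq> {} \<and> (\<forall>g\<in>G. mdeg g = d) \<and> d > 0 \<and>
        finite B \<and> B \<noteq> {} \<and> (\<forall>b\<in>B. mdeg b = e) \<and> (\<forall>l. ?J (l + k1) = mideal (rees G B l)))"
    using HS_eventually_rees[OF assms] by (rule exE)
  then show ?thesis
  proof (elim disjE exE conjE)
    fix J assume "\<forall>l. ?J (l + k1) = J"
    then have J: "?J (l + k1) = J" for l ..
    show ?thesis
      unfolding Ass_inf_def
      by (rule asymptotics_of_shift[where J = ?J and L = 0 and m = k1 and S = "Ass J" and
            c = "depth_quot J" and ar = 0 and av = 0 and ap = "\<lambda>_. 0" and br = "reg J" and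
            bv = "int (vnum J)" and bp = "\<lambda>P. int (vnum_at P J)"]) (simp_all add: J)
  next
    fix G B d e assume G: "finite G" "G \<noteq> {}" "\<forall>g\<in>G. mdeg g = d" "d > 0"
      and B: "finite B" "B \<noteq> {}" "\<forall>b\<in>B. mdeg b = e" and "\<forall>l. ?J (l + k1) = mideal (rees G B l)"
    then have J: "?J (l + k1) = mideal (rees G B l)" for l by simp
    let ?K = "\<lambda>l. mideal (rees G B l) :: ('x, 'k) mpol set"
    obtain L1 S w where 1: "finite S" "\<forall>l\<ge>L1. Ass (?K l) = S \<and>
        (\<forall>P\<in>S. int (vnum_at P (?K l)) = int d * int l + w P)"
      using Ass_vnum_eventually[OF G(1-3) B(1,2), where 'k = 'k] by (elim exE conjE)
    obtain L2 c where 2: "\<forall>l\<ge>L2. depth_quot (?K l) = c"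
      using depth_eventually[OF G(1,3,4) B(1), where 'k = 'k] by (elim exE)
    obtain L3 r where 3: "\<forall>l\<ge>L3. reg (?K l) = int d * int l + r"
      using reg_eventually[OF G(1-3) B, where 'k = 'k] by (elim exE)
    obtain v v' where 4: "\<forall>l\<ge>L1. int (vnum (?K l)) = v * int l + v'"
      using vnum_eventually[OF 1] by (elim exE)
    show ?thesis
      unfolding Ass_inf_def
    proof (rule asymptotics_of_shift[where J = ?J and L = "max L1 (max L2 L3)" and m = k1])
      fix l assume "max L1 (max L2 L3) \<le> l"
      then have l: "L1 \<le> l" "L2 \<le> l" "L3 \<le> l" by auto
      show "Ass (?J (l + k1)) = S" unfolding J using 1(2) l by simp
      show "depth_quot (?J (l + k1)) = c" unfolding J using 2 l by simp
      show "reg (?J (l + k1)) = int d * int l + r" unfolding J using 3 l by simp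
      show "int (vnum (?J (l + k1))) = v * int l + v'" unfolding J using 4 l by simp
      show "int (vnum_at P (?J (l + k1))) = (\<lambda>_. int d) P * int l + w P" if "P \<in> S" for P
        unfolding J using 1(2) l that by simp
    qed
  qed
qed

end
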